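(* Let $\ell$ be a prime. (Odd case.) If $\ell$ is odd, then for every closed subgroup $H$ of $\operatorname{GL}_2(\mathbb{Z}_\ell)$ there is a closed subgroup $H_1$ of $H$ with $[H:H_1]\le 24$ such that for every positive integer $s$: if $L(H_1)\supseteq \ell^{s}\mathfrak{sl}_2(\mathbb{Z}_\ell)$, then $H_1$ contains $\mathcal{B}_\ell(4s)$. (Case $\ell=2$.) For every closed subgroup $H$ of $\operatorname{GL}_2(\mathbb{Z}_2)$ there is a closed subgroup $H_1$ of $H$ whose reduction modulo $2$ is trivial and with $[H:H_1]\le 192$, such that for every positive integer $s$: if $L(H_1)\supseteq 2^{s}\mathfrak{sl}_2(\mathbb{Z}_2)$, then $H_1$ contains $\mathcal{B}_2(6s)$.
   Context: For a closed subgroup $G$ of $\operatorname{GL}_2(\mathbb{Z}_\ell)$ (required to have trivial reduction modulo $2$ when $\ell=2$), define $\Theta(g)=g-\frac{\operatorname{tr}(g)}{2}\operatorname{Id}\in\mathfrak{sl}_2(\mathbb{Z}_\ell)$ for $g\in G$, and let the special Lie algebra $L(G)$ be the $\mathbb{Z}_\ell$-span of $\Theta(G)$, more precisely the closed subgroup of $\mathfrak{sl}_2(\mathbb{Z}_\ell)$ topologically generated by $\Theta(G)$. Here $\mathfrak{sl}_2(\mathbb{Z}_\ell)$ is the set of trace-zero $2\times 2$ matrices over $\mathbb{Z}_\ell$. For $n\ge1$, $\mathcal{B}_\ell(n)=\{g\in\operatorname{SL}_2(\mathbb{Z}_\ell): g\equiv \operatorname{Id}\pmod{\ell^n}\}$.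 *)

theory Defs
  imports
    "HOL-Analysis.Analysis"
    "HOL-Algebra.Coset"
    "Berlekamp_Zassenhaus.Finite_Field"
begin

text \<open>
  The prime \<open>\<ell>\<close> is the cardinality \<open>CARD('p)\<close> of a type \<open>'p :: prime_card\<close>.
  An \<open>\<ell>\<close>-adic integer is an element of the inverse limit of the rings \<open>\<int>/\<ell>\<^sup>n\<int>\<close>, given by
  its least nonnegative residues modulo every \<open>\<ell>\<^sup>n\<close>.
\<close>

typedef (overloaded) 'p adic_int =
  "{x :: nat \<Rightarrow> int. \<forall>n. 0 \<le> x n \<and> x n < int CARD('p :: prime_card) ^ n
      \<and> x (Suc n) mod int CARD('p) ^ n = x n}"
  morphisms residue Abs_adic_int
  by (rule exI[of _ "\<lambda>_. 0"]) (auto simp: prime_card prime_gt_0_nat)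

setup_lifting type_definition_adic_int

lemma prime_card_power_pos: "0 < int CARD('p :: prime_card) ^ n"
  by (simp add: prime_card prime_gt_0_nat)

lemma mod_power_Suc_mod: "(a mod (q::int) ^ Suc n) mod q ^ n = a mod q ^ n"
  by (rule mod_mod_cancel) (simp add: le_imp_power_dvd)

lemma residue_ops_closed:
  fixes a b :: "nat \<Rightarrow> int"
  assumes "\<And>n. a (Suc n) mod int CARD('p :: prime_card) ^ n = a n mod int CARD('p) ^ n"
  shows "0 \<le> a n mod int CARD('p) ^ n \<and> a n mod int CARD('p) ^ n < int CARD('p) ^ n
      \<and> (a (Suc n) mod int CARD('p) ^ Suc n) mod int CARD('p) ^ n = a n mod int CARD('p) ^ n"
  using assms[of n] prime_card_power_pos[of n, where 'p = 'p]
  by (simp only: mod_power_Suc_mod) simp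

instantiation adic_int :: (prime_card) comm_ring_1
begin

lift_definition zero_adic_int :: "'a adic_int" is "\<lambda>n. 0 mod int CARD('a) ^ n"
  by (intro allI residue_ops_closed) simp

lift_definition one_adic_int :: "'a adic_int" is "\<lambda>n. 1 mod int CARD('a) ^ n"
  by (intro allI residue_ops_closed) simp

lift_definition plus_adic_int :: "'a adic_int \<Rightarrow> 'a adic_int \<Rightarrow> 'a adic_int"
  is "\<lambda>x y n. (x n + y n) mod int CARD('a) ^ n"
  by (intro allI residue_ops_closed) (metis mod_add_eq mod_mod_trivial)

lift_definition times_adic_int :: "'a adic_int \<Rightarrow> 'a adic_int \<Rightarrow> 'a adic_int"
  is "\<lambda>x y n. (x n * y n) mod int CARD('a) ^ n"
  by (intro allI residue_ops_closed) (metis mod_mult_eq mod_mod_trivial)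

lift_definition uminus_adic_int :: "'a adic_int \<Rightarrow> 'a adic_int"
  is "\<lambda>x n. (- x n) mod int CARD('a) ^ n"
  by (intro allI residue_ops_closed) (metis mod_minus_eq mod_mod_trivial)

lift_definition minus_adic_int :: "'a adic_int \<Rightarrow> 'a adic_int \<Rightarrow> 'a adic_int"
  is "\<lambda>x y n. (x n - y n) mod int CARD('a) ^ n"
  by (intro allI residue_ops_closed) (metis mod_diff_eq mod_mod_trivial)

instance
proof
  fix a b c :: "'a adic_int"
  show "a + b + c = a + (b + c)" by transfer (rule ext, simp add: mod_simps add.assoc)
  show "a + b = b + a" by transfer (simp add: add.commute)
  show "0 + a = a" by transfer (rule ext, simp)
  show "- a + a = 0" by transfer (rule ext, simp add: mod_simps)
  show "a - b = a + - b" by transfer (rule ext, simp add: mod_simps)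
  show "a * b * c = a * (b * c)" by transfer (rule ext, simp add: mod_simps mult.assoc)
  show "a * b = b * a" by transfer (simp add: mult.commute)
  show "1 * a = a" by transfer (rule ext, simp add: mod_simps)
  show "(a + b) * c = a * c + b * c" by transfer (rule ext, simp add: mod_simps distrib_right)
  show "(0 :: 'a adic_int) \<noteq> 1"
  proof (transfer, rule notI)
    assume "(\<lambda>n. 0 mod int CARD('a) ^ n) = (\<lambda>n. 1 mod int CARD('a) ^ n)"
    from fun_cong[OF this, of 1] show False
      using prime_gt_1_nat[OF prime_card[where 'a = 'a]] by simp
  qed
qed

end

lemma residue_bounds: "0 \<le> residue (x :: 'p::prime_card adic_int) n \<and> residue x n < int CARD('p) ^ n"
  using residue[of x] by blast

lemma residue_Suc_mod: "residue (x :: 'p::prime_card adic_int) (Suc n) mod int CARD('p) ^ n = residue x n"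
  using residue[of x] by blast

lemma residue_add_mod:
  "residue (x :: 'p::prime_card adic_int) (k + n) mod int CARD('p) ^ n = residue x n"
proof (induction k)
  case 0
  show ?case using residue_bounds[of x n] by simp
next
  case (Suc k)
  have "residue x (Suc k + n) mod int CARD('p) ^ n
      = residue x (Suc (k + n)) mod int CARD('p) ^ (k + n) mod int CARD('p) ^ n"
    by (simp add: mod_mod_cancel le_imp_power_dvd)
  also have "\<dots> = residue x (k + n) mod int CARD('p) ^ n"
    by (simp only: add_Suc residue_Suc_mod)
  finally show ?case using Suc by simp
qed

lemma residue_of_nat:
  "residue (of_nat m :: 'p::prime_card adic_int) n = int m mod int CARD('p) ^ n"
  by (induction m)
    (simp_all add: zero_adic_int.rep_eq one_adic_int.rep_eq plus_adic_int.rep_eq mod_simps)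

lemma of_nat_dvd_iff_residue:
  fixes x :: "'p::prime_card adic_int"
  shows "of_nat CARD('p) ^ n dvd x \<longleftrightarrow> residue x n = 0"
proof
  assume "of_nat CARD('p) ^ n dvd x"
  then obtain y where x: "x = of_nat (CARD('p) ^ n) * y" by (auto elim: dvdE)
  show "residue x n = 0"
    unfolding x by (simp only: times_adic_int.rep_eq residue_of_nat, simp add: mod_simps)
next
  assume x0: "residue x n = 0"
  let ?q = "int CARD('p)"
  have q0: "?q ^ k > 0" for k by (rule prime_card_power_pos)
  have low: "residue x (n + k) mod ?q ^ k = residue x k" for k n
    by (rule residue_add_mod)
  have dvd: "?q ^ n dvd residue x (k + n)" for k
    using residue_add_mod[of x k n] x0 by (simp add: dvd_eq_mod_eq_0)
  define z where "z k = residue x (k + n) div ?q ^ n" for k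
  have z: "residue x (k + n) = ?q ^ n * z k" for k
    using dvd[of k] by (simp add: z_def)
  have bounds: "0 \<le> z k \<and> z k < ?q ^ k" for k
  proof -
    have "0 \<le> ?q ^ n * z k" "?q ^ n * z k < ?q ^ n * ?q ^ k"
      using residue_bounds[of x "k + n"] by (simp_all only: z power_add mult.commute)
    then show ?thesis
      using q0[of n] by (metis mult_less_cancel_left_pos mult_le_cancel_left_pos mult_zero_right)
  qed
  have "residue x (Suc k + n) mod ?q ^ (k + n) = residue x (k + n)" for k
    using residue_Suc_mod[of x "k + n"] by simp
  then have "?q ^ n * z (Suc k) mod (?q ^ n * ?q ^ k) = ?q ^ n * z k" for k
    by (simp only: z power_add mult.commute)
  then have step: "z (Suc k) mod ?q ^ k = z k" for k
    using q0[of n] by (simp add: mod_mult_mult1)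
  define y :: "'p adic_int" where "y = Abs_adic_int z"
  have y: "residue y = z"
    unfolding y_def using bounds step by (intro Abs_adic_int_inverse) simp
  have "x = of_nat (CARD('p) ^ n) * y"
  proof (rule residue_inject[THEN iffD1], rule ext)
    fix k
    have "residue x k = residue x (k + n) mod ?q ^ k"
      using low[of n k] by (simp add: add.commute)
    then show "residue x k = residue (of_nat (CARD('p) ^ n) * y) k"
      by (simp only: times_adic_int.rep_eq residue_of_nat y, simp add: mod_simps z)
  qed
  then show "of_nat CARD('p) ^ n dvd x" by simp
qed

text \<open>The \<open>\<ell>\<close>-adic topology: a set is open iff with each \<open>x\<close> it contains some \<open>x + \<ell>\<^sup>n \<int>\<^sub>\<ell>\<close>.
  Matrices carry the library's product topology.\<close>

instantiation adic_int :: (prime_card) topological_space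
begin

definition open_adic_int :: "'a adic_int set \<Rightarrow> bool" where
  "open_adic_int U \<longleftrightarrow> (\<forall>x\<in>U. \<exists>n. \<forall>y. of_nat CARD('a) ^ n dvd y - x \<longrightarrow> y \<in> U)"

instance
proof
  fix S T :: "'a adic_int set"
  assume S: "open S" and T: "open T"
  show "open (S \<inter> T)"
    unfolding open_adic_int_def
  proof
    fix x assume x: "x \<in> S \<inter> T"
    from x S obtain m where m: "\<And>y. of_nat CARD('a) ^ m dvd y - x \<Longrightarrow> y \<in> S"
      unfolding open_adic_int_def by blast
    from x T obtain n where n: "\<And>y. of_nat CARD('a) ^ n dvd y - x \<Longrightarrow> y \<in> T"
      unfolding open_adic_int_def by blast
    have "y \<in> S \<inter> T" if "of_nat CARD('a) ^ max m n dvd y - x" for y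
      using m[of y] n[of y] that by (meson IntI dvd_trans le_imp_power_dvd max.cobounded1 max.cobounded2)
    then show "\<exists>n. \<forall>y. of_nat CARD('a) ^ n dvd y - x \<longrightarrow> y \<in> S \<inter> T" by blast
  qed
next
  fix K :: "'a adic_int set set"
  assume K: "\<forall>S\<in>K. open S"
  show "open (\<Union>K)"
    unfolding open_adic_int_def
  proof
    fix x assume "x \<in> \<Union>K"
    then obtain S where "S \<in> K" "x \<in> S" by blast
    moreover from this K obtain n where "\<And>y. of_nat CARD('a) ^ n dvd y - x \<Longrightarrow> y \<in> S"
      unfolding open_adic_int_def by blast
    ultimately show "\<exists>n. \<forall>y. of_nat CARD('a) ^ n dvd y - x \<longrightarrow> y \<in> \<Union>K" by blast
  qed
qed (simp add: open_adic_int_def)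

end

type_synonym 'p mat2 = "'p adic_int ^ 2 ^ 2"

definition mat_cong :: "nat \<Rightarrow> 'p::prime_card mat2 \<Rightarrow> 'p mat2 \<Rightarrow> bool" where
  "mat_cong n A B \<longleftrightarrow> (\<forall>i j. of_nat CARD('p) ^ n dvd A $ i $ j - B $ i $ j)"

definition GL2 :: "'p::prime_card mat2 monoid" where
  "GL2 = \<lparr>carrier = {g. invertible g}, mult = (**), one = mat 1\<rparr>"

definition SL2 :: "'p::prime_card mat2 set" where
  "SL2 = {g. det g = 1}"

text \<open>Only the additive group structure is recorded.\<close>

definition sl2 :: "'p::prime_card mat2 monoid" where
  "sl2 = \<lparr>carrier = {X. trace X = 0}, mult = (+), one = 0\<rparr>"

definition closed_subgroup :: "'a::topological_space set \<Rightarrow> 'a monoid \<Rightarrow> bool" where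
  "closed_subgroup H G \<longleftrightarrow> subgroup H G \<and> closedin (top_of_set (carrier G)) H"

text \<open>\<open>[H : K] \<le> n\<close> in the ambient group \<open>G\<close>; finiteness is explicit because \<open>card\<close> of an infinite
  set is \<open>0\<close>.\<close>

definition index_le :: "'a monoid \<Rightarrow> 'a set \<Rightarrow> 'a set \<Rightarrow> nat \<Rightarrow> bool" where
  "index_le G H K n \<longleftrightarrow>
     finite (rcosets\<^bsub>G\<lparr>carrier := H\<rparr>\<^esub> K) \<and> card (rcosets\<^bsub>G\<lparr>carrier := H\<rparr>\<^esub> K) \<le> n"

text \<open>Meaningful when \<open>2\<close> divides \<open>t\<close>: always for odd \<open>\<ell>\<close>, and for \<open>\<ell> = 2\<close> when \<open>t\<close> is the
  trace of a matrix congruent to the identity modulo \<open>2\<close>.\<close>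

definition halve :: "'p::prime_card adic_int \<Rightarrow> 'p adic_int" where
  "halve t = (THE u. 2 * u = t)"

lemma two_mult_cancel:
  fixes u v :: "'p::prime_card adic_int"
  assumes "2 * u = 2 * v"
  shows "u = v"
proof -
  let ?q = "int CARD('p)"
  define w where "w = u - v"
  have "of_nat 2 * w = 0" using assms by (simp add: w_def right_diff_distrib)
  then have "residue (of_nat 2 * w) n = residue (0 :: 'p adic_int) n" for n by (simp only:)
  then have w2: "?q ^ n dvd 2 * residue w n" for n
    by (simp only: times_adic_int.rep_eq residue_of_nat zero_adic_int.rep_eq)
      (simp add: mod_simps dvd_eq_mod_eq_0)
  have "?q ^ n dvd residue w (Suc n)" for n
  proof (cases "CARD('p) = 2")
    case True
    then show ?thesis using w2[of "Suc n"] by simp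
  next
    case False
    then have "odd CARD('p)"
      using primes_dvd_imp_eq[OF two_is_prime_nat prime_card[where 'a = 'p]] by auto
    then have "coprime (?q ^ Suc n) 2"
      by (simp only: coprime_power_left_iff coprime_right_2_iff_odd) simp
    then have "?q ^ Suc n dvd residue w (Suc n)"
      using w2[of "Suc n"] by (simp only: coprime_dvd_mult_right_iff)
    then show ?thesis
      by (rule dvd_trans[OF le_imp_power_dvd[OF le_SucI[OF order_refl]]])
  qed
  then have "residue w n = 0" for n
    by (metis residue_Suc_mod dvd_eq_mod_eq_0)
  then have "residue w = residue (0 :: 'p adic_int)" by (simp add: fun_eq_iff zero_adic_int.rep_eq)
  then show "u = v" by (simp add: residue_inject w_def)
qed

lemma halve_eq: "2 * u = t \<Longrightarrow> halve t = u"
  unfolding halve_def by (rule the_equality) (auto intro: two_mult_cancel)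

lemma two_halve:
  fixes t :: "'p::prime_card adic_int"
  assumes "odd CARD('p) \<or> 2 dvd t"
  shows "2 * halve t = t"
proof -
  have "2 dvd t" if odd: "odd CARD('p)"
  proof -
    define z where "z n = residue t n * ((int CARD('p) ^ n + 1) div 2)" for n
    have z: "2 * z n = residue t n * (int CARD('p) ^ n + 1)" for n
    proof -
      have "2 * ((int CARD('p) ^ n + 1) div 2) = int CARD('p) ^ n + 1"
        by (rule dvd_mult_div_cancel) (use odd in simp)
      then show ?thesis by (metis z_def mult.left_commute)
    qed
    have cong: "z (Suc n) mod int CARD('p) ^ n = z n mod int CARD('p) ^ n" for n
    proof -
      let ?q = "int CARD('p) ^ n"
      have "?q dvd residue t (Suc n) - residue t n"
        by (metis residue_Suc_mod mod_mod_trivial mod_eq_dvd_iff)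
      then obtain c where "residue t (Suc n) = residue t n + ?q * c"
        by (metis add.commute diff_add_cancel dvdE)
      then have "2 * (z (Suc n) - z n)
          = ?q * (c * (int CARD('p) ^ Suc n + 1) + residue t n * (int CARD('p) - 1))"
        by (simp only: right_diff_distrib z) (simp add: algebra_simps)
      then have "?q dvd 2 * (z (Suc n) - z n)" by simp
      moreover have "coprime ?q 2" using odd by simp
      ultimately show ?thesis
        using coprime_dvd_mult_right_iff mod_eq_dvd_iff by blast
    qed
    define u :: "'p adic_int" where "u = Abs_adic_int (\<lambda>n. z n mod int CARD('p) ^ n)"
    have u: "residue u = (\<lambda>n. z n mod int CARD('p) ^ n)"
      unfolding u_def using residue_ops_closed[of z, OF cong]
      by (intro Abs_adic_int_inverse) blast
    have "of_nat 2 * u = t"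
    proof (rule residue_inject[THEN iffD1], rule ext)
      fix n
      have "residue (of_nat 2 * u) n = (2 * z n) mod int CARD('p) ^ n"
        by (simp only: times_adic_int.rep_eq residue_of_nat u mod_simps) simp
      also have "\<dots> = residue t n"
        using residue_bounds[of t n] by (simp add: z distrib_left)
      finally show "residue (of_nat 2 * u) n = residue t n" .
    qed
    then show ?thesis by (metis dvd_triv_left of_nat_numeral)
  qed
  then show ?thesis using assms halve_eq by (metis dvdE)
qed

definition Theta :: "'p::prime_card mat2 \<Rightarrow> 'p mat2" where
  "Theta g = g - mat (halve (trace g))"

lemma Theta_in_sl2:
  fixes g :: "'p::prime_card mat2"
  assumes "odd CARD('p) \<or> CARD('p) = 2 \<and> mat_cong 1 g (mat 1)"
  shows "Theta g \<in> carrier sl2"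
proof -
  have "2 dvd trace g" if "CARD('p) = 2" "mat_cong 1 g (mat 1)"
  proof -
    have "2 dvd g $ 1 $ 1 - 1" "2 dvd g $ 2 $ 2 - 1"
      using that(2)[unfolded mat_cong_def that(1), rule_format, of 1 1]
        that(2)[unfolded mat_cong_def that(1), rule_format, of 2 2]
      by (simp_all add: mat_def)
    then have "2 dvd (g $ 1 $ 1 - 1) + (g $ 2 $ 2 - 1) + 2" by (intro dvd_add dvd_refl)
    then show ?thesis by (simp add: trace_def sum_2)
  qed
  then have "2 * halve (trace g) = trace g" using assms two_halve by blast
  then have "trace g - 2 * halve (trace g) = 0" by simp
  then show ?thesis
    by (simp add: sl2_def Theta_def trace_def sum_2 mat_def algebra_simps)
qed

lemma group_GL2: "group (GL2 :: 'p::prime_card mat2 monoid)"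
proof (rule groupI)
  fix g :: "'p mat2" assume "g \<in> carrier GL2"
  then show "\<exists>h\<in>carrier GL2. h \<otimes>\<^bsub>GL2\<^esub> g = \<one>\<^bsub>GL2\<^esub>"
    by (auto simp: GL2_def invertible_def)
next
  show "\<one>\<^bsub>GL2\<^esub> \<in> carrier (GL2 :: 'p mat2 monoid)"
    by (auto simp: GL2_def invertible_def intro: exI[of _ "mat 1"])
qed (auto simp: GL2_def invertible_mult matrix_mul_assoc)

lemma group_sl2: "group (sl2 :: 'p::prime_card mat2 monoid)"
proof (rule groupI)
  fix X :: "'p mat2" assume "X \<in> carrier sl2"
  then show "\<exists>Y\<in>carrier sl2. Y \<otimes>\<^bsub>sl2\<^esub> X = \<one>\<^bsub>sl2\<^esub>"
    by (intro bexI[of _ "- X"]) (auto simp: sl2_def trace_def sum_negf)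
qed (auto simp: sl2_def trace_def sum.distrib add.assoc)

text \<open>The closed subgroup topologically generated by \<open>Theta ` G\<close>, as the intersection of all
  closed subgroups of \<open>sl2\<close> containing it. Only used for \<open>G\<close> with trivial reduction modulo \<open>2\<close> when \<open>\<ell> = 2\<close>.\<close>

definition special_Lie :: "'p::prime_card mat2 set \<Rightarrow> 'p mat2 set" where
  "special_Lie G = (\<lambda>S. closed_subgroup S sl2) hull (Theta ` G)"

definition scaled_sl2 :: "nat \<Rightarrow> 'p::prime_card mat2 set" where
  "scaled_sl2 s = map_matrix ((*) (of_nat CARD('p) ^ s)) ` carrier sl2"

text \<open>The group usually written \<open>\<B>\<^sub>\<ell>(n)\<close>.\<close>

definition ball_SL2 :: "nat \<Rightarrow> 'p::prime_card mat2 set" where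
  "ball_SL2 n = {g \<in> SL2. mat_cong n g (mat 1)}"

end

theory Submission
  imports Defs
begin

text \<open>
  Let \<open>P\<close> be the group of matrices of determinant \<open>1\<close> that are scalar multiples of elements of \<open>H1\<close>;
  commutators of elements of \<open>P\<close> lie in \<open>H1\<close>. For \<open>g = t + X\<close> with \<open>X = \<Theta>(g)\<close> the matrix \<open>X\<^sup>2\<close> is scalar, so
  every power of \<open>g\<close> is a combination of \<open>1\<close> and \<open>X\<close>; if \<open>X\<close> is nilpotent modulo \<open>\<ell>\<close>, the
  \<open>\<ell>\<^sup>s\<close>-th power of the normalization of \<open>g\<^sup>2\<close> is, up to a unit scalar, \<open>1 + \<ell>\<^sup>s u X\<close> with a unit \<open>u\<close>.
  Multiplying such elements shows that \<open>P\<close> realizes \<open>1 + \<ell>\<^sup>2\<^sup>s Z\<close> modulo \<open>\<ell>\<^sup>2\<^sup>s\<^sup>+\<^sup>1\<close> whenever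
  \<open>\<ell>\<^sup>s Z\<close> is in the span of the \<open>\<Theta>(g)\<close>; commutators then fill the levels from \<open>4s\<close> on
  (\<open>4s + 1\<close> for \<open>\<ell> = 2\<close>), and successive approximation gives the ball.

  For odd \<open>\<ell>\<close> the subgroup \<open>H1\<close> is chosen so that its image in \<open>PGL\<^sub>2(\<F>\<^sub>\<ell>)\<close> has a normal \<open>\<ell>\<close>-subgroup
  with abelian quotient of order prime to \<open>\<ell>\<close>, unless the image contains two distinct unipotent
  directions, which already generate everything. If the quotient has more than two elements, some
  \<open>h\<close> outside the \<open>\<ell>\<close>-part has trace prime to \<open>\<ell>\<close>; conjugation by \<open>h\<close> shows that \<open>[\<Theta>(h), X]\<close>
  comes from the \<open>\<ell>\<close>-part for every \<open>X\<close> in the special Lie algebra, which suffices since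
  \<open>\<Theta>(h)\<close> is itself a combination of brackets of such brackets. If \<open>\<ell>\<close> does not divide the order
  of the image, the class equation of its action on maximal cyclic subgroups yields the bound \<open>24\<close>.
  For \<open>\<ell> = 2\<close> the kernel of reduction modulo \<open>4\<close> will do.
\<close>

subsection \<open>Arithmetic of the adic integers\<close>

text \<open>The group \<open>H1\<close> has to be fixed before \<open>s\<close>, so it is cut out by
  conditions on \<open>H\<close> modulo ell (modulo 4 for ell = 2), which also makes it closed in
  \<open>H\<close>. The obstacle is that powers lose information: in (t + X)^2 the coefficient of X
  is 2t, so an element whose trace vanishes modulo ell, an involution of PGL_2(F_ell), reveals
  nothing of its X. A quotient of order at most 2 is therefore removed by passing to a subgroup; a
  larger one contains an h of unit trace, and an element g of trace zero is reached through h g and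
  adj(h) g, which have unit trace and add up to tr(h) g. The exponents count losses: ell^s from the
  hypothesis and ell^s from the power give level 2s, and a commutator doubles the level. For ell = 2
  brackets miss the off-diagonal part, which costs one level more, and 4s + 1 \<le> 6s. The constant
  24 is the order of PGL_2(F_3) and of the octahedral group; a dihedral group has a cyclic subgroup
  of index 2, the icosahedral group one of index 60/5 = 12.\<close>

abbreviation ell :: "'p::prime_card adic_int" where
  "ell \<equiv> of_nat CARD('p)"

definition red :: "'p::prime_card adic_int \<Rightarrow> 'p mod_ring" where
  "red x = of_int (residue x 1)"

lemma of_int_mod_ring_eq_iff:
  "(of_int a :: 'p::prime_card mod_ring) = of_int b \<longleftrightarrow> int CARD('p) dvd a - b"
proof -
  have "(of_int (a - b) :: 'p mod_ring) = 0 \<longleftrightarrow> int CARD('p) dvd a - b"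
    by (simp only: of_int_eq_0_iff_char_dvd semiring_char_mod_ring)
  then show ?thesis by (simp only: of_int_diff right_minus_eq)
qed

lemma of_int_mod_CARD: "(of_int (a mod int CARD('p)) :: 'p::prime_card mod_ring) = of_int a"
  by (simp add: of_int_mod_ring_eq_iff flip: mod_eq_dvd_iff)

lemma red_0 [simp]: "red 0 = 0"
  and red_1 [simp]: "red 1 = 1"
  and red_add [simp]: "red (x + y) = red x + red y"
  and red_diff [simp]: "red (x - y) = red x - red y"
  and red_uminus [simp]: "red (- x) = - red x"
  and red_mult [simp]: "red (x * y) = red x * red y"
  by (simp_all add: red_def of_int_mod_CARD zero_adic_int.rep_eq one_adic_int.rep_eq plus_adic_int.rep_eq
      minus_adic_int.rep_eq uminus_adic_int.rep_eq times_adic_int.rep_eq)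

lemma red_power [simp]: "red (x ^ n) = red x ^ n"
  by (induction n) simp_all

lemma red_of_nat [simp]: "red (of_nat n) = of_nat n"
  by (induction n) simp_all

lemma red_numeral [simp]: "red (numeral n) = numeral n"
  using red_of_nat[of "numeral n"] by simp

lemma red_eq_0_iff: "red x = 0 \<longleftrightarrow> ell dvd x"
proof -
  have "red x = 0 \<longleftrightarrow> int CARD('a) dvd residue x 1"
    using of_int_mod_ring_eq_iff[of "residue x 1" 0] by (simp add: red_def)
  also have "\<dots> \<longleftrightarrow> residue x 1 = 0"
    using residue_bounds[of x 1] by (auto dest: zdvd_imp_le)
  finally show ?thesis
    using of_nat_dvd_iff_residue[of 1 x] by simp
qed

lemma red_eq_iff: "red x = red y \<longleftrightarrow> ell dvd x - y"
  using red_eq_0_iff[of "x - y"] by simp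

lemma red_surj: "\<exists>x. red x = c"
  by (metis red_of_nat surj_of_nat_mod_ring)

lemma ell_dvd_mult_iff: "ell dvd a * b \<longleftrightarrow> ell dvd a \<or> ell dvd b"
  by (simp flip: red_eq_0_iff)

lemma ell_not_unit: "\<not> ell dvd (1 :: 'p::prime_card adic_int)"
  by (simp flip: red_eq_0_iff)

lemma ell_mult_eq_0D:
  fixes w :: "'p::prime_card adic_int"
  assumes "ell * w = 0" shows "w = 0"
proof -
  let ?q = "int CARD('p)"
  have "residue w n = 0" for n
  proof -
    have "residue (ell * w) (Suc n) = residue (0 :: 'p adic_int) (Suc n)" using assms by simp
    then have "?q ^ Suc n dvd ?q * residue w (Suc n)"
      by (simp only: times_adic_int.rep_eq residue_of_nat zero_adic_int.rep_eq)
        (simp add: mod_simps dvd_eq_mod_eq_0 del: power_Suc)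
    then have "?q ^ n dvd residue w (Suc n)"
      using prime_card_power_pos[of 1, where 'p = 'p] by simp
    then show ?thesis by (metis residue_Suc_mod dvd_eq_mod_eq_0)
  qed
  then show ?thesis by (simp add: fun_eq_iff zero_adic_int.rep_eq flip: residue_inject)
qed

lemma ell_power_cancel:
  fixes a b :: "'p::prime_card adic_int"
  assumes "ell ^ n * a = ell ^ n * b" shows "a = b"
proof -
  have "ell ^ n * c = 0 \<Longrightarrow> c = 0" for c :: "'p adic_int"
    by (induction n) (auto simp: mult.assoc dest: ell_mult_eq_0D)
  from this[of "a - b"] show ?thesis using assms by (simp add: right_diff_distrib)
qed

lemma ell_power_dvd_cancel:
  "ell ^ (n + m) dvd ell ^ n * z \<longleftrightarrow> ell ^ m dvd z"
proof
  assume "ell ^ (n + m) dvd ell ^ n * z"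
  then obtain c where "ell ^ n * z = ell ^ n * (ell ^ m * c)"
    by (auto simp: power_add mult.assoc)
  then show "ell ^ m dvd z" using ell_power_cancel by (metis dvd_triv_left)
qed (simp add: power_add mult_dvd_mono)

lemma nat_approx: "\<exists>r. ell ^ n dvd a - of_nat r"
proof -
  obtain r where r: "residue a n = int r" "int r < int CARD('a) ^ n"
    using residue_bounds[of a n] by (metis nonneg_int_cases)
  then have "ell ^ n dvd a - of_nat r"
    by (simp add: of_nat_dvd_iff_residue minus_adic_int.rep_eq residue_of_nat)
  then show ?thesis ..
qed

text \<open>Bezout gives an inverse modulo every power of ell. Inverses modulo ell^n are unique, so
  their least residues are compatible and define an element of the inverse limit.\<close>

lemma adic_unit_iff:
  fixes u :: "'p::prime_card adic_int"
  shows "u dvd 1 \<longleftrightarrow> \<not> ell dvd u"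
proof
  assume "\<not> ell dvd u"
  let ?q = "int CARD('p)"
  have cop: "coprime (residue u n) (?q ^ n)" for n
  proof (cases n)
    case (Suc k)
    have "\<not> ?q dvd residue u (Suc k)"
    proof
      assume "?q dvd residue u (Suc k)"
      then have "residue u 1 = 0"
        using residue_add_mod[of u k 1] by (simp add: dvd_eq_mod_eq_0)
      then show False using \<open>\<not> ell dvd u\<close> of_nat_dvd_iff_residue[of 1 u] by simp
    qed
    then have "coprime ?q (residue u (Suc k))"
      using prime_card_int by (intro prime_imp_coprime) auto
    then show ?thesis by (simp add: Suc coprime_commute)
  qed simp
  have "\<exists>z. 0 \<le> z \<and> z < ?q ^ n \<and> residue u n * z mod ?q ^ n = 1 mod ?q ^ n" for n
  proof -
    obtain z y where "z * residue u n + y * ?q ^ n = 1"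
      using bezout_int[of "residue u n" "?q ^ n"] cop[of n] by (auto simp: coprime_iff_gcd_eq_1)
    then have "residue u n * z mod ?q ^ n = 1 mod ?q ^ n"
      by (metis mod_mult_self2 mult.commute)
    then show ?thesis
      using prime_card_power_pos[of n, where 'p = 'p]
      by (intro exI[of _ "z mod ?q ^ n"]) (auto simp: mod_simps)
  qed
  then obtain z where z: "\<And>n. 0 \<le> z n \<and> z n < ?q ^ n"
    "\<And>n. residue u n * z n mod ?q ^ n = 1 mod ?q ^ n" by metis
  have "z (Suc n) mod ?q ^ n = z n" for n
  proof -
    have "residue u (Suc n) * z (Suc n) mod ?q ^ Suc n mod ?q ^ n = 1 mod ?q ^ n"
      by (simp only: z(2) mod_power_Suc_mod)
    then have "residue u n * z (Suc n) mod ?q ^ n = 1 mod ?q ^ n"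
      by (metis mod_power_Suc_mod mod_mult_left_eq residue_Suc_mod)
    then have "?q ^ n dvd residue u n * (z (Suc n) - z n)"
      using z(2)[of n] by (simp add: right_diff_distrib flip: mod_eq_dvd_iff)
    then have "?q ^ n dvd z (Suc n) - z n"
      using cop[of n] by (simp add: coprime_dvd_mult_right_iff coprime_commute)
    then show ?thesis using z(1)[of n] by (metis mod_eq_dvd_iff mod_pos_pos_trivial)
  qed
  then have "residue (Abs_adic_int z :: 'p adic_int) = z"
    using z(1) by (intro Abs_adic_int_inverse) simp
  then have "u * Abs_adic_int z = 1"
    using z(2) by (simp add: fun_eq_iff times_adic_int.rep_eq one_adic_int.rep_eq flip: residue_inject)
  then show "u dvd 1" by (metis dvdI)
qed (use ell_not_unit dvd_trans in blast)

lemma unit_iff_red: "u dvd 1 \<longleftrightarrow> red u \<noteq> 0"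
  by (simp add: adic_unit_iff red_eq_0_iff)

lemma ell_power_dvd_unit_mult:
  assumes "u dvd (1 :: 'p::prime_card adic_int)"
  shows "ell ^ n dvd u * x \<longleftrightarrow> ell ^ n dvd x"
proof
  from assms obtain v where v: "1 = u * v" by (elim dvdE)
  have "v * (u * x) = u * v * x" by (simp only: ac_simps)
  also have "\<dots> = x" by (simp flip: v)
  finally have eq: "v * (u * x) = x" .
  assume "ell ^ n dvd u * x"
  then have "ell ^ n dvd v * (u * x)" by (rule dvd_mult)
  then show "ell ^ n dvd x" by (simp only: eq)
qed simp

lemma two_unit: "odd CARD('p) \<Longrightarrow> (2 :: 'p::prime_card adic_int) dvd 1"
proof -
  assume "odd CARD('p)"
  then have "\<not> CARD('p) dvd 2"
    using primes_dvd_imp_eq[OF prime_card[where 'a = 'p] two_is_prime_nat] by auto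
  then have "(of_nat 2 :: 'p mod_ring) \<noteq> 0" by (simp only: of_nat_eq_0_iff_char_dvd semiring_char_mod_ring simp_thms)
  then show ?thesis by (simp add: unit_iff_red)
qed

lemma two_eq_ell: "CARD('p) = 2 \<Longrightarrow> (2 :: 'p::prime_card adic_int) = ell"
  by simp

text \<open>The factors T - 1 and T + 1 differ by the unit 2, so one of them is a unit and the other
  takes the whole power. Later T is the unknown scalar of an element of determinant 1, which this
  determines up to sign.\<close>

lemma square_eq_one_cong:
  fixes T :: "'p::prime_card adic_int"
  assumes "ell ^ m dvd T * T - 1" and odd: "odd CARD('p)"
  shows "ell ^ m dvd T - 1 \<or> ell ^ m dvd T + 1"
proof -
  have eq: "T * T - 1 = (T + 1) * (T - 1)" by (simp add: algebra_simps)
  have "\<not> (ell dvd T - 1 \<and> ell dvd T + 1)"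
  proof
    assume "ell dvd T - 1 \<and> ell dvd T + 1"
    then have "ell dvd (T + 1) - (T - 1)" by (elim conjE) (rule dvd_diff)
    moreover have "(T + 1) - (T - 1) = 2" by simp
    ultimately show False using two_unit[OF odd] adic_unit_iff by metis
  qed
  then consider "T + 1 dvd 1" | "T - 1 dvd 1" by (auto simp only: adic_unit_iff)
  then show ?thesis
  proof cases
    case 1
    then show ?thesis using assms(1) unfolding eq by (simp only: ell_power_dvd_unit_mult simp_thms)
  next
    case 2
    then show ?thesis using assms(1) unfolding eq mult.commute[of "T + 1"]
      by (simp only: ell_power_dvd_unit_mult simp_thms)
  qed
qed

text \<open>Now both factors are even, but being ell w and ell (w + 1), one of them is even only
  once. The price is one power of 2, hence the larger precision asked for ell = 2 below.\<close>

lemma square_eq_one_cong_even: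
  fixes T :: "'p::prime_card adic_int"
  assumes "ell ^ Suc m dvd T * T - 1" and even: "CARD('p) = 2"
  shows "ell ^ m dvd T - 1 \<or> ell ^ m dvd T + 1"
proof (cases m)
  case (Suc n)
  have two: "(2 :: 'p adic_int) = ell" by (rule two_eq_ell[OF even])
  have eq: "T * T - 1 = (T + 1) * (T - 1)" by (simp add: algebra_simps)
  have "ell dvd T * T - 1"
    using assms(1) by (rule dvd_trans[rotated]) simp
  then have "ell dvd T + 1 \<or> ell dvd T - 1"
    by (simp only: eq ell_dvd_mult_iff)
  moreover have "T - 1 = (T + 1) - ell" by (simp flip: two)
  ultimately have "ell dvd T - 1" by (metis dvd_diff dvd_refl)
  then obtain w where w: "T - 1 = ell * w" by (elim dvdE)
  have "T + 1 = (T - 1) + ell" by (simp flip: two)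
  then have w': "T + 1 = ell * (w + 1)" by (simp only: w distrib_left mult_1_right)
  have "T * T - 1 = ell ^ 2 * (w * (w + 1))"
    unfolding eq w w' by (simp add: power2_eq_square ac_simps)
  then have *: "ell ^ n dvd w * (w + 1)"
    using assms(1) ell_power_dvd_cancel[of 2 n "w * (w + 1)"] by (simp only: Suc add_2_eq_Suc)
  have "\<not> (ell dvd w \<and> ell dvd w + 1)"
    using ell_not_unit[where 'p = 'p] by (metis add_diff_cancel_left' dvd_diff)
  then consider "w dvd 1" | "w + 1 dvd 1" by (auto simp only: adic_unit_iff)
  then have "ell ^ n dvd w \<or> ell ^ n dvd w + 1"
  proof cases
    case 1
    then show ?thesis using * by (simp only: ell_power_dvd_unit_mult simp_thms)
  next
    case 2
    then show ?thesis using * unfolding mult.commute[of w]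
      by (simp only: ell_power_dvd_unit_mult simp_thms)
  qed
  then show ?thesis unfolding w w' Suc by (auto simp: mult_dvd_mono)
qed simp

subsection \<open>Two by two matrices\<close>

text \<open>Matrix identities are proved by splitting all matrices with \<open>mk2_cases\<close> and
  comparing entries as polynomials.\<close>

definition mk2 :: "'a \<Rightarrow> 'a \<Rightarrow> 'a \<Rightarrow> 'a \<Rightarrow> 'a ^ 2 ^ 2" where
  "mk2 a b c d = (\<chi> i j. if i = 1 then (if j = 1 then a else b) else (if j = 1 then c else d))"

lemma mk2_nth [simp]:
  "mk2 a b c d $ 1 $ 1 = a" "mk2 a b c d $ 1 $ 2 = b" "mk2 a b c d $ 2 $ 1 = c" "mk2 a b c d $ 2 $ 2 = d"
  by (simp_all add: mk2_def)

lemma mat2_eq_iff: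
  "(A :: 'a ^ 2 ^ 2) = B \<longleftrightarrow> A $ 1 $ 1 = B $ 1 $ 1 \<and> A $ 1 $ 2 = B $ 1 $ 2
      \<and> A $ 2 $ 1 = B $ 2 $ 1 \<and> A $ 2 $ 2 = B $ 2 $ 2"
  by (auto simp: vec_eq_iff forall_2)

lemma mk2_eq_iff [simp]: "mk2 a b c d = mk2 a' b' c' d' \<longleftrightarrow> a = a' \<and> b = b' \<and> c = c' \<and> d = d'"
  by (simp add: mat2_eq_iff)

lemma mk2_cases: obtains a b c d where "A = mk2 a b c d"
  by (metis mat2_eq_iff mk2_nth)

definition smat :: "'a::times \<Rightarrow> 'a ^ 2 ^ 2 \<Rightarrow> 'a ^ 2 ^ 2" (infixr "*m" 75) where
  "c *m A = map_matrix ((*) c) A"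

text \<open>The adjugate replaces the inverse, so that conjugation \<open>A ** X ** adj2 A\<close>
  stays polynomial; it is \<open>det A\<close> times the true conjugate, a unit factor that modules
  do not see.\<close>

definition adj2 :: "'a::uminus ^ 2 ^ 2 \<Rightarrow> 'a ^ 2 ^ 2" where
  "adj2 A = mk2 (A $ 2 $ 2) (- A $ 1 $ 2) (- A $ 2 $ 1) (A $ 1 $ 1)"

lemma mk2_simps [simp]:
  fixes a b c d a' b' c' d' r :: "'a::comm_ring_1"
  shows "mk2 a b c d + mk2 a' b' c' d' = mk2 (a + a') (b + b') (c + c') (d + d')"
    and "mk2 a b c d - mk2 a' b' c' d' = mk2 (a - a') (b - b') (c - c') (d - d')"
    and "- mk2 a b c d = mk2 (- a) (- b) (- c) (- d)"
    and "mk2 a b c d ** mk2 a' b' c' d'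
      = mk2 (a * a' + b * c') (a * b' + b * d') (c * a' + d * c') (c * b' + d * d')"
    and "r *m mk2 a b c d = mk2 (r * a) (r * b) (r * c) (r * d)"
    and "adj2 (mk2 a b c d) = mk2 d (- b) (- c) a"
    and "det (mk2 a b c d) = a * d - b * c"
    and "trace (mk2 a b c d) = a + d"
  by (simp_all add: mat2_eq_iff matrix_matrix_mult_def sum_2 smat_def adj2_def det_2 trace_def)

lemma mat_mk2: "mat r = mk2 r 0 0 r" by (simp add: mat2_eq_iff mat_def)
lemma zero_mk2: "0 = mk2 0 0 0 0" by (simp add: mat2_eq_iff)

lemmas mk2_const = mat_mk2 zero_mk2

lemma adj2_mult: "adj2 (A ** B) = adj2 B ** adj2 (A :: 'a::comm_ring_1 ^ 2 ^ 2)"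
  by (cases A rule: mk2_cases; cases B rule: mk2_cases) (simp add: algebra_simps)

lemma mult_adj2: "A ** adj2 A = mat (det (A :: 'a::comm_ring_1 ^ 2 ^ 2))"
  and adj2_mult_self: "adj2 A ** A = mat (det A)"
  by (cases A rule: mk2_cases; simp add: mat_mk2 algebra_simps)+

lemma det_adj2 [simp]: "det (adj2 A) = det (A :: 'a::comm_ring_1 ^ 2 ^ 2)"
  by (cases A rule: mk2_cases) (simp add: algebra_simps)

lemma det_mult2: "det (A ** B) = det A * det (B :: 'a::comm_ring_1 ^ 2 ^ 2)"
  by (cases A rule: mk2_cases; cases B rule: mk2_cases) (simp add: algebra_simps)

lemma det_smat: "det (c *m A) = c * c * det (A :: 'a::comm_ring_1 ^ 2 ^ 2)"
  by (cases A rule: mk2_cases) (simp add: algebra_simps)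

lemma smat_simps:
  fixes A B :: "'a::comm_ring_1 ^ 2 ^ 2"
  shows "(c *m A) ** B = c *m (A ** B)" "A ** (c *m B) = c *m (A ** B)" "c *m d *m A = (c * d) *m A"
    "1 *m A = A" "adj2 (c *m A) = c *m adj2 A" "adj2 (adj2 A) = A" "trace (c *m A) = c * trace A"
  by (cases A rule: mk2_cases; cases B rule: mk2_cases; simp add: algebra_simps)+

lemma adj2_inverse:
  fixes A :: "'a::comm_ring_1 ^ 2 ^ 2"
  assumes "v * det A = 1"
  shows "(v *m adj2 A) ** A = mat 1" "A ** (v *m adj2 A) = mat 1"
proof -
  have "v *m mat (det A) = mat 1" using assms by (simp add: mat_mk2)
  then show "(v *m adj2 A) ** A = mat 1" "A ** (v *m adj2 A) = mat 1"
    by (simp_all add: smat_simps mult_adj2 adj2_mult_self)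
qed

lemma unit_inverse: "(c :: 'a::comm_ring_1) dvd 1 \<Longrightarrow> \<exists>v. v * c = 1"
  by (metis dvdE mult.commute)

lemma invertible_iff_det: "invertible A \<longleftrightarrow> det (A :: 'a::comm_ring_1 ^ 2 ^ 2) dvd 1"
proof
  assume "invertible A"
  then obtain B where "A ** B = mat 1" by (auto simp: invertible_def)
  then have "det A * det B = 1" by (metis det_I det_mult2)
  then show "det A dvd 1" by (metis dvdI)
next
  assume "det A dvd 1"
  then obtain v where "v * det A = 1" using unit_inverse by blast
  then show "invertible A" unfolding invertible_def by (intro exI[of _ "v *m adj2 A"] conjI adj2_inverse)
qed

lemma inverse_unique2:
  fixes A :: "'a::comm_ring_1 ^ 2 ^ 2"
  assumes "B ** A = mat 1" "v * det A = 1" shows "B = v *m adj2 A"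
proof -
  have "B ** (A ** adj2 A) = adj2 A" using assms(1) by (simp add: matrix_mul_assoc)
  then have "det A *m B = adj2 A"
    by (cases B rule: mk2_cases) (simp add: mult_adj2 mat_mk2 algebra_simps)
  then show ?thesis using assms(2) by (metis smat_simps(3,4))
qed

lemma sl2_iff: "X \<in> carrier sl2 \<longleftrightarrow> X $ 2 $ 2 = - X $ 1 $ 1"
  by (auto simp: sl2_def trace_def sum_2 eq_neg_iff_add_eq_0 add.commute)

lemma mk2_in_sl2 [simp]: "mk2 a b c d \<in> carrier sl2 \<longleftrightarrow> d = - a"
  by (simp add: sl2_iff)

lemma sl2_cases:
  assumes "X \<in> carrier sl2" obtains a b c where "X = mk2 a b c (- a)"
  using assms by (metis mk2_cases mk2_in_sl2)

lemma sl2_closed [simp]: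
  assumes "X \<in> carrier sl2"
  shows "- X \<in> carrier sl2" "c *m X \<in> carrier sl2"
    "Y \<in> carrier sl2 \<Longrightarrow> X + Y \<in> carrier sl2" "Y \<in> carrier sl2 \<Longrightarrow> X - Y \<in> carrier sl2"
  using assms by (auto elim!: sl2_cases)

lemma zero_in_sl2 [simp]: "0 \<in> carrier sl2" by (simp add: sl2_iff)

lemma sl2_conj [simp]: "X \<in> carrier sl2 \<Longrightarrow> A ** X ** adj2 A \<in> carrier sl2"
  "X \<in> carrier sl2 \<Longrightarrow> adj2 A ** X ** A \<in> carrier sl2"
  by (cases A rule: mk2_cases, erule sl2_cases, simp add: algebra_simps)+

lemma sl2_bracket [simp]: "X ** Y - Y ** X \<in> carrier sl2"
  by (cases X rule: mk2_cases, cases Y rule: mk2_cases, simp add: algebra_simps)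

lemma sl2_square: "X \<in> carrier sl2 \<Longrightarrow> X ** X = mat (- det X)"
  by (erule sl2_cases) (simp add: mat_mk2 algebra_simps)

lemma scaled_sl2_eq: "scaled_sl2 s = {ell ^ s *m X | X. X \<in> carrier sl2}"
  by (auto simp: scaled_sl2_def smat_def)

subsection \<open>Congruences\<close>

lemma mat_cong_mk2 [simp]:
  "mat_cong n (mk2 a b c d) (mk2 a' b' c' d' :: 'p::prime_card mat2) \<longleftrightarrow>
     ell ^ n dvd a - a' \<and> ell ^ n dvd b - b' \<and> ell ^ n dvd c - c' \<and> ell ^ n dvd d - d'"
  by (auto simp: mat_cong_def forall_2)

lemma mat_cong_refl [simp]: "mat_cong n A A"
  by (simp add: mat_cong_def)

lemma dvd_diff_swap: "(d :: 'a::comm_ring_1) dvd a - b \<Longrightarrow> d dvd b - a"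
  by (metis dvd_minus_iff minus_diff_eq)

lemma mat_cong_sym: "mat_cong n A B \<Longrightarrow> mat_cong n B A"
  by (simp add: mat_cong_def dvd_diff_swap)

lemma mat_cong_trans [trans]: "mat_cong n A B \<Longrightarrow> mat_cong n B C \<Longrightarrow> mat_cong n A C"
  unfolding mat_cong_def by (metis (no_types, lifting) add_diff_eq diff_add_cancel dvd_add)

lemma mat_cong_mono: "mat_cong m A B \<Longrightarrow> n \<le> m \<Longrightarrow> mat_cong n A B"
  unfolding mat_cong_def by (meson dvd_trans le_imp_power_dvd)

lemma mat_cong_add: "mat_cong n A B \<Longrightarrow> mat_cong n A' B' \<Longrightarrow> mat_cong n (A + A') (B + B')"
  unfolding mat_cong_def by (auto simp: add_diff_add intro!: dvd_add)

lemma mat_cong_uminus: "mat_cong n A B \<Longrightarrow> mat_cong n (- A) (- B)"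
  unfolding mat_cong_def by (metis minus_diff_minus dvd_minus_iff vector_uminus_component)

lemma mat_cong_diff: "mat_cong n A B \<Longrightarrow> mat_cong n A' B' \<Longrightarrow> mat_cong n (A - A') (B - B')"
  using mat_cong_add[OF _ mat_cong_uminus, of n A B A' B'] by simp

lemma dvd_mult_diff_mult:
  fixes a b :: "'a::comm_ring_1"
  assumes "d dvd a - b" "d dvd a' - b'" shows "d dvd a * a' - b * b'"
proof -
  have "a * a' - b * b' = (a - b) * a' + b * (a' - b')" by (simp add: algebra_simps)
  then show ?thesis using assms by simp
qed

lemma dvd_add_diff_add:
  fixes a b :: "'a::comm_ring_1"
  assumes "d dvd a - b" "d dvd a' - b'" shows "d dvd (a + a') - (b + b')"
  using assms by (metis add_diff_add dvd_add)

lemma mat_cong_mult: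
  assumes "mat_cong n A B" "mat_cong n A' B'" shows "mat_cong n (A ** A') (B ** B')"
  using assms
  by (cases A rule: mk2_cases; cases B rule: mk2_cases; cases A' rule: mk2_cases; cases B' rule: mk2_cases)
    (auto intro!: dvd_add_diff_add dvd_mult_diff_mult)

lemma mat_cong_smat:
  assumes "ell ^ n dvd c - d" "mat_cong n A B" shows "mat_cong n (c *m A) (d *m B)"
  using assms by (cases A rule: mk2_cases; cases B rule: mk2_cases) (auto intro!: dvd_mult_diff_mult)

lemma mat_cong_adj2: "mat_cong n A B \<Longrightarrow> mat_cong n (adj2 A) (adj2 B)"
  by (cases A rule: mk2_cases; cases B rule: mk2_cases) (auto intro: dvd_diff_swap)

lemma mat_cong_iff: "mat_cong n A B \<longleftrightarrow> (\<exists>R. A = B + ell ^ n *m R)"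
proof
  assume "mat_cong n A B"
  then show "\<exists>R. A = B + ell ^ n *m R"
  proof (cases A rule: mk2_cases; cases B rule: mk2_cases)
    fix a b c d a' b' c' d' assume *: "A = mk2 a b c d" "B = mk2 a' b' c' d'"
    with \<open>mat_cong n A B\<close> obtain r1 r2 r3 r4 where
      "a - a' = ell ^ n * r1" "b - b' = ell ^ n * r2" "c - c' = ell ^ n * r3" "d - d' = ell ^ n * r4"
      by (auto elim!: dvdE)
    then have "A = B + ell ^ n *m mk2 r1 r2 r3 r4" using * by (simp add: algebra_simps)
    then show ?thesis by blast
  qed
next
  assume "\<exists>R. A = B + ell ^ n *m R"
  then show "mat_cong n A B"
    by (cases A rule: mk2_cases; cases B rule: mk2_cases) (auto simp: mat_cong_def smat_def)
qed

lemma mat_cong_det: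
  assumes "mat_cong n A B" shows "ell ^ n dvd det A - det B"
proof -
  obtain R where R: "A = B + ell ^ n *m R" using assms mat_cong_iff by blast
  show ?thesis
  proof (cases B rule: mk2_cases; cases R rule: mk2_cases)
    fix a b c d a' b' c' d' assume "B = mk2 a b c d" "R = mk2 a' b' c' d'"
    then have "det A - det B = ell ^ n * (a * d' + a' * d + ell ^ n * a' * d'
        - b * c' - b' * c - ell ^ n * b' * c')"
      by (simp add: R algebra_simps)
    then show ?thesis by simp
  qed
qed

lemma mat_cong_smat_cancel:
  "mat_cong (n + m) (ell ^ n *m A) (ell ^ n *m B) \<longleftrightarrow> mat_cong m A B"
  by (cases A rule: mk2_cases; cases B rule: mk2_cases)
    (simp add: ell_power_dvd_cancel flip: right_diff_distrib)

subsection \<open>Subgroups and their congruence filtrations\<close>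

lemma carrier_GL2: "A \<in> carrier GL2 \<longleftrightarrow> det A dvd 1"
  by (simp add: GL2_def invertible_iff_det)

lemma GL2_subgroup_one: "subgroup G GL2 \<Longrightarrow> mat 1 \<in> G"
  using subgroup.one_closed[of G GL2] by (simp add: GL2_def)

lemma GL2_subgroup_mult: "subgroup G GL2 \<Longrightarrow> A \<in> G \<Longrightarrow> B \<in> G \<Longrightarrow> A ** B \<in> G"
  using subgroup.m_closed[of G GL2 A B] by (simp add: GL2_def)

lemma GL2_subgroup_det: "subgroup G GL2 \<Longrightarrow> A \<in> G \<Longrightarrow> det A dvd 1"
  using subgroup.mem_carrier[of G GL2 A] by (simp add: carrier_GL2)

lemma GL2_inv: "A \<in> carrier GL2 \<Longrightarrow> v * det A = 1 \<Longrightarrow> inv\<^bsub>GL2\<^esub> A = v *m adj2 A"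
  using group.l_inv[OF group_GL2, of A] by (intro inverse_unique2) (simp_all add: GL2_def)

lemma GL2_subgroup_inv:
  assumes "subgroup G GL2" "A \<in> G" "v * det A = 1" shows "v *m adj2 A \<in> G"
  using subgroup.m_inv_closed[OF assms(1,2)] GL2_inv[OF subgroup.mem_carrier[OF assms(1,2)] assms(3)]
  by simp

lemma GL2_subgroupI:
  fixes G :: "'p::prime_card mat2 set"
  assumes "\<And>A. A \<in> G \<Longrightarrow> det A dvd 1" "mat 1 \<in> G" "\<And>A B. A \<in> G \<Longrightarrow> B \<in> G \<Longrightarrow> A ** B \<in> G"
    and inv: "\<And>A v. A \<in> G \<Longrightarrow> v * det A = 1 \<Longrightarrow> v *m adj2 A \<in> G"
  shows "subgroup G GL2"
proof (rule group.subgroupI[OF group_GL2])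
  show "G \<subseteq> carrier GL2" using assms(1) by (auto simp: carrier_GL2)
  show "G \<noteq> {}" using assms(2) by blast
  fix A assume A: "A \<in> G"
  obtain v where v: "v * det A = 1" using assms(1)[OF A] by (metis dvdE mult.commute)
  show "inv\<^bsub>GL2\<^esub> A \<in> G" using inv[OF A v] GL2_inv[OF _ v] assms(1)[OF A] by (simp add: carrier_GL2)
qed (use assms(3) in \<open>simp add: GL2_def\<close>)

text \<open>In determinant 1 the adjugate is the inverse, so no division is involved.\<close>

definition SL2_subgroup :: "'p::prime_card mat2 set \<Rightarrow> bool" where
  "SL2_subgroup K \<longleftrightarrow> K \<subseteq> SL2 \<and> mat 1 \<in> K \<and> (\<forall>A\<in>K. \<forall>B\<in>K. A ** B \<in> K) \<and> (\<forall>A\<in>K. adj2 A \<in> K)"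

text \<open>Passing to this group removes the determinants; commutators of its elements lie in \<open>G\<close> again.\<close>

definition proj_SL2 :: "'p::prime_card mat2 set \<Rightarrow> 'p mat2 set" where
  "proj_SL2 G = {A \<in> SL2. \<exists>c. c dvd 1 \<and> c *m A \<in> G}"

lemma SL2_iff: "A \<in> SL2 \<longleftrightarrow> det A = 1" by (simp add: SL2_def)

lemma SL2_subgroup_Int:
  assumes "subgroup G GL2" shows "SL2_subgroup (G \<inter> SL2)"
  unfolding SL2_subgroup_def
  using GL2_subgroup_one[OF assms] GL2_subgroup_mult[OF assms] GL2_subgroup_inv[OF assms, of _ 1]
  by (auto simp: SL2_iff det_mult2 smat_simps)

lemma proj_SL2E:
  assumes G: "subgroup G GL2" and p: "p \<in> proj_SL2 G"
  obtains c u where "det p = 1" "c dvd 1" "u dvd 1" "u * c = 1" "c *m p \<in> G" "u *m adj2 p \<in> G"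
proof -
  obtain c where *: "det p = 1" "c dvd 1" "c *m p \<in> G" using p by (auto simp: proj_SL2_def SL2_iff)
  obtain u where u: "u * c = 1" using unit_inverse[OF *(2)] by blast
  have "(u * u) * det (c *m p) = (u * c) * (u * c)" by (simp add: det_smat * algebra_simps)
  then have "(u * u) *m adj2 (c *m p) \<in> G" using GL2_subgroup_inv[OF G *(3)] u by simp
  moreover have "u * u * c = u" using u by (simp add: mult.assoc)
  ultimately have "u *m adj2 p \<in> G" by (simp add: smat_simps)
  moreover have "u dvd 1" using u by (metis dvdI)
  ultimately show ?thesis using that * u by blast
qed

lemma SL2_subgroup_proj:
  assumes G: "subgroup G GL2" shows "SL2_subgroup (proj_SL2 G)"
  unfolding SL2_subgroup_def
proof (intro conjI ballI)
  show "proj_SL2 G \<subseteq> SL2" by (auto simp: proj_SL2_def)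
  show "mat 1 \<in> proj_SL2 G"
    using GL2_subgroup_one[OF G] by (auto simp: proj_SL2_def SL2_iff smat_simps intro!: exI[of _ 1])
next
  fix A B assume "A \<in> proj_SL2 G" "B \<in> proj_SL2 G"
  then obtain c d where *: "det A = 1" "det B = 1" "c dvd 1" "d dvd 1" "c *m A \<in> G" "d *m B \<in> G"
    by (auto simp: proj_SL2_def SL2_iff)
  have "(c * d) *m (A ** B) \<in> G"
    using GL2_subgroup_mult[OF G *(5,6)] by (simp add: smat_simps mult.commute[of d])
  moreover have "c * d dvd 1" using *(3,4) by (metis mult_dvd_mono mult_1)
  ultimately show "A ** B \<in> proj_SL2 G" using * by (auto simp: proj_SL2_def SL2_iff det_mult2)
next
  fix A assume "A \<in> proj_SL2 G"
  then show "adj2 A \<in> proj_SL2 G" using proj_SL2E[OF G] unfolding proj_SL2_def SL2_iff by force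
qed

text \<open>The unknown scalar \<open>c\<close> of \<open>p\<close> cancels against its inverse
  \<open>u\<close> in the commutator, which therefore lies in \<open>G\<close> itself; a conjugate
  of \<open>p\<close> alone still carries \<open>c\<close>.\<close>

lemma proj_SL2_conj_commutator:
  assumes G: "subgroup G GL2" and h: "h \<in> G" "v * det h = 1" and p: "p \<in> proj_SL2 G"
  shows "v *m (h ** p ** adj2 h) \<in> proj_SL2 G"
    and "v *m (h ** p ** adj2 h ** adj2 p) \<in> G \<inter> SL2"
proof -
  obtain c u where *: "det p = 1" "c dvd 1" "c *m p \<in> G" and u: "u * c = 1" "u *m adj2 p \<in> G"
    using proj_SL2E[OF G p] by metis
  have h': "v *m adj2 h \<in> G" by (rule GL2_subgroup_inv[OF G h])
  have vh: "v * v * (det h * det h) = 1" using h(2) by (metis mult.assoc mult.commute mult_1)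
  have hp: "c *m v *m (h ** p ** adj2 h) \<in> G"
    using GL2_subgroup_mult[OF G GL2_subgroup_mult[OF G h(1) *(3)] h'] by (simp add: smat_simps mult.commute)
  then show "v *m (h ** p ** adj2 h) \<in> proj_SL2 G"
    using *(1,2) vh by (auto simp: proj_SL2_def SL2_iff det_smat det_mult2 mult.assoc)
  from GL2_subgroup_mult[OF G hp u(2)] have "(u * c) *m v *m (h ** p ** adj2 h ** adj2 p) \<in> G"
    by (simp add: smat_simps ac_simps)
  then have "v *m (h ** p ** adj2 h ** adj2 p) \<in> G" by (simp add: u(1) smat_simps)
  then show "v *m (h ** p ** adj2 h ** adj2 p) \<in> G \<inter> SL2"
    using *(1) vh by (auto simp: SL2_iff det_smat det_mult2 mult.assoc)
qed

lemma proj_SL2_commutator: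
  assumes G: "subgroup G GL2" and q: "q \<in> proj_SL2 G" and p: "p \<in> proj_SL2 G"
  shows "q ** p ** adj2 q ** adj2 p \<in> G \<inter> SL2"
proof -
  obtain c where *: "det q = 1" "c dvd 1" "c *m q \<in> G" using q by (auto simp: proj_SL2_def SL2_iff)
  obtain u where u: "u * c = 1" using unit_inverse[OF *(2)] by blast
  have "(u * u) * det (c *m q) = (u * c) * (u * c)" by (simp add: det_smat * algebra_simps)
  then have "(u * u) *m ((c *m q) ** p ** adj2 (c *m q) ** adj2 p) \<in> G \<inter> SL2"
    using proj_SL2_conj_commutator(2)[OF G *(3) _ p] u by simp
  moreover have "(u * u) * (c * c) = (u * c) * (u * c)" by (simp only: ac_simps)
  ultimately show ?thesis by (simp add: u smat_simps)
qed

section \<open>Open submodules of \<open>sl2\<close> and the graded pieces of the congruence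
  filtration\<close>

definition sl2_module :: "'p::prime_card mat2 set \<Rightarrow> bool" where
  "sl2_module V \<longleftrightarrow> V \<subseteq> carrier sl2 \<and> 0 \<in> V \<and> (\<forall>X\<in>V. \<forall>Y\<in>V. X + Y \<in> V) \<and> (\<forall>c. \<forall>X\<in>V. c *m X \<in> V)"

text \<open>For an additive subgroup of \<open>sl2\<close> this says that it contains ell^n
  \<open>sl2\<close>: openness with an explicit exponent.\<close>

definition cong_closed :: "nat \<Rightarrow> 'p::prime_card mat2 set \<Rightarrow> bool" where
  "cong_closed n V \<longleftrightarrow> (\<forall>X\<in>V. \<forall>Y\<in>carrier sl2. mat_cong n X Y \<longrightarrow> Y \<in> V)"

lemma sl2_moduleD:
  assumes "sl2_module V"
  shows "X \<in> V \<Longrightarrow> X \<in> carrier sl2" "0 \<in> V" "X \<in> V \<Longrightarrow> Y \<in> V \<Longrightarrow> X + Y \<in> V" "X \<in> V \<Longrightarrow> c *m X \<in> V"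
    "X \<in> V \<Longrightarrow> Y \<in> V \<Longrightarrow> X - Y \<in> V" "X \<in> V \<Longrightarrow> - X \<in> V"
proof -
  have neg: "- X = (-1) *m X" for X :: "'a mat2" by (cases X rule: mk2_cases) simp
  show "X \<in> V \<Longrightarrow> - X \<in> V" for X using assms neg by (auto simp: sl2_module_def)
  then show "X \<in> V \<Longrightarrow> Y \<in> V \<Longrightarrow> X - Y \<in> V" using assms
    unfolding sl2_module_def by (metis add_uminus_conv_diff)
qed (use assms in \<open>auto simp: sl2_module_def\<close>)

lemma sl2_module_unit:
  assumes V: "sl2_module V" and u: "u dvd 1" and X: "u *m X \<in> V"
  shows "X \<in> V"
proof -
  obtain v where v: "v * u = 1" using unit_inverse[OF u] by blast
  show ?thesis using sl2_moduleD(4)[OF V X, of v] by (simp add: smat_simps v)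
qed

text \<open>Multiples by natural numbers are sums, every scalar is congruent to a natural number
  modulo ell^n, and congruence closure absorbs the difference.\<close>

lemma sl2_moduleI:
  fixes V :: "'p::prime_card mat2 set"
  assumes V: "V \<subseteq> carrier sl2" "0 \<in> V" "\<And>X Y. X \<in> V \<Longrightarrow> Y \<in> V \<Longrightarrow> X + Y \<in> V" and cong: "cong_closed n V"
  shows "sl2_module V"
  unfolding sl2_module_def
proof (intro conjI ballI allI)
  fix c :: "'p adic_int" and X assume X: "X \<in> V"
  have nat: "of_nat r *m X \<in> V" for r
  proof (induction r)
    case 0
    have "of_nat 0 *m X = 0" by (cases X rule: mk2_cases) (simp add: zero_mk2)
    then show ?case using V by simp
  next
    case (Suc r)
    have "of_nat (Suc r) *m X = of_nat r *m X + X" by (cases X rule: mk2_cases) (simp add: algebra_simps)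
    then show ?case using V Suc X by simp
  qed
  obtain r where "ell ^ n dvd of_nat r - c" using nat_approx[of n c] dvd_diff_swap by blast
  then have "mat_cong n (of_nat r *m X) (c *m X)" by (rule mat_cong_smat) simp
  then show "c *m X \<in> V"
    using cong nat[of r] V(1) X by (auto simp: cong_closed_def)
qed (use V in auto)

text \<open>The graded piece of degree \<open>j\<close> of the congruence filtration of
  \<open>K\<close>. It depends on Z only modulo ell, but is kept as a preimage in \<open>sl2\<close>
  so that all spaces in play are modules over the same ring.\<close>

definition level :: "'p::prime_card mat2 set \<Rightarrow> nat \<Rightarrow> 'p mat2 set" where
  "level K j = {Z \<in> carrier sl2. \<exists>k\<in>K. mat_cong (Suc j) k (mat 1 + ell ^ j *m Z)}"

lemma levelI: "Z \<in> carrier sl2 \<Longrightarrow> k \<in> K \<Longrightarrow> mat_cong (Suc j) k (mat 1 + ell ^ j *m Z) \<Longrightarrow> Z \<in> level K j"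
  by (auto simp: level_def)

lemma mat_cong_smat_same: "mat_cong m Z W \<Longrightarrow> mat_cong (j + m) (ell ^ j *m Z) (ell ^ j *m W)"
  by (simp add: mat_cong_smat_cancel)

lemma one_plus_mult:
  "mat_cong (i + j) ((mat 1 + ell ^ i *m Z) ** (mat 1 + ell ^ j *m W)) (mat 1 + (ell ^ i *m Z + ell ^ j *m W))"
  unfolding mat_cong_iff
  by (rule exI[of _ "Z ** W"], cases Z rule: mk2_cases, cases W rule: mk2_cases)
    (simp add: mat_mk2 power_add algebra_simps)

lemma smat_add: "c *m (A + B) = c *m A + c *m (B :: 'a::comm_ring_1 ^ 2 ^ 2)"
  and smat_add_left: "(c + d) *m A = c *m A + d *m A"
  and smat_diff: "c *m (A - B) = c *m A - c *m B"
  and smat_uminus: "c *m (- A) = - (c *m A)"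
  by (cases A rule: mk2_cases; cases B rule: mk2_cases; simp add: algebra_simps)+

lemma level_cong_closed: "cong_closed 1 (level K j)"
  unfolding cong_closed_def level_def
proof safe
  fix X Y k assume "mat_cong 1 X Y" "k \<in> K" "mat_cong (Suc j) k (mat 1 + ell ^ j *m X)"
  then show "\<exists>k\<in>K. mat_cong (Suc j) k (mat 1 + ell ^ j *m Y)"
    using mat_cong_add[OF mat_cong_refl mat_cong_smat_same[of 1 X Y j]] mat_cong_trans
    by (metis Suc_eq_plus1)
qed

lemma level_module:
  assumes K: "SL2_subgroup K" and j: "j \<ge> 1" shows "sl2_module (level K j)"
proof (rule sl2_moduleI[OF _ _ _ level_cong_closed])
  show "level K j \<subseteq> carrier sl2" by (auto simp: level_def)
  have "mat 1 = mat 1 + ell ^ j *m (0 :: 'a mat2)" by (simp add: mk2_const)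
  then show "0 \<in> level K j" using K by (auto simp: level_def SL2_subgroup_def intro!: bexI[of _ "mat 1"])
  fix X Y assume "X \<in> level K j" "Y \<in> level K j"
  then obtain k l where *: "X \<in> carrier sl2" "Y \<in> carrier sl2" "k \<in> K" "l \<in> K"
    "mat_cong (Suc j) k (mat 1 + ell ^ j *m X)" "mat_cong (Suc j) l (mat 1 + ell ^ j *m Y)"
    by (auto simp: level_def)
  have "mat_cong (Suc j) (k ** l) (mat 1 + ell ^ j *m (X + Y))"
    using mat_cong_trans[OF mat_cong_mult[OF *(5,6)] mat_cong_mono[OF one_plus_mult]] j
    by (simp add: smat_add)
  moreover have "k ** l \<in> K" using * K by (auto simp: SL2_subgroup_def)
  ultimately show "X + Y \<in> level K j" using * by (auto intro: levelI)
qed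

primrec mpow :: "'a::comm_ring_1 ^ 2 ^ 2 \<Rightarrow> nat \<Rightarrow> 'a ^ 2 ^ 2" where
  "mpow A 0 = mat 1"
| "mpow A (Suc r) = mpow A r ** A"

lemma mpow_closed: "SL2_subgroup K \<Longrightarrow> A \<in> K \<Longrightarrow> mpow A r \<in> K"
  by (induction r) (auto simp: SL2_subgroup_def)

lemma one_plus_mpow:
  "mat_cong (j + j) (mpow (mat 1 + ell ^ j *m Z) r) (mat 1 + ell ^ j *m (of_nat r *m Z))"
proof (induction r)
  case 0
  show ?case by (cases Z rule: mk2_cases) (simp add: mat_mk2)
next
  case (Suc r)
  have "of_nat (Suc r) *m Z = of_nat r *m Z + Z" by (simp add: smat_add_left smat_simps add.commute)
  then show ?case
    using mat_cong_trans[OF mat_cong_mult[OF Suc mat_cong_refl] one_plus_mult] by (simp add: smat_add)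
qed

text \<open>The ell-th power multiplies the linear term by ell with an error of order ell^(2j);
  since j \<ge> 2, the error is invisible modulo ell^(j+2).\<close>

lemma level_Suc:
  assumes K: "SL2_subgroup K" and j: "j \<ge> 2" shows "level K j \<subseteq> level K (Suc j)"
proof
  fix Z :: "'a mat2" assume "Z \<in> level K j"
  then obtain k where k: "Z \<in> carrier sl2" "k \<in> K" "mat_cong (Suc j) k (mat 1 + ell ^ j *m Z)"
    by (auto simp: level_def)
  from k(3) obtain R where "k = mat 1 + ell ^ j *m Z + ell ^ Suc j *m R" by (auto simp: mat_cong_iff)
  then have R: "k = mat 1 + ell ^ j *m (Z + ell *m R)"
    by (simp add: smat_add smat_simps mult.commute)
  have "mat_cong (j + j) (mpow k CARD('a)) (mat 1 + ell ^ j *m (ell *m (Z + ell *m R)))"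
    unfolding R by (rule one_plus_mpow)
  then have "mat_cong (Suc (Suc j)) (mpow k CARD('a)) (mat 1 + ell ^ j *m (ell *m (Z + ell *m R)))"
    by (rule mat_cong_mono) (use j in simp)
  also have "mat_cong (Suc (Suc j)) (mat 1 + ell ^ j *m (ell *m (Z + ell *m R))) (mat 1 + ell ^ Suc j *m Z)"
    unfolding mat_cong_iff by (rule exI[of _ R]) (simp add: smat_add smat_simps ac_simps)
  finally show "Z \<in> level K (Suc j)" using k mpow_closed[OF K] by (blast intro: levelI)
qed

lemma level_mono:
  assumes K: "SL2_subgroup K" and "2 \<le> i" "i \<le> j" shows "level K i \<subseteq> level K j"
  using assms(3,2) level_Suc[OF K] by (induction j rule: dec_induct) (fastforce, meson le_trans subset_trans)

lemma SL2_ball_approx: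
  assumes K: "SL2_subgroup K" and lev: "\<And>j. j \<ge> m \<Longrightarrow> level K j = carrier sl2" and m: "m \<ge> 1"
    and A: "A \<in> ball_SL2 m"
  shows "\<exists>k\<in>K. mat_cong (m + i) k A"
proof (induction i)
  case 0
  show ?case using A K by (auto simp: ball_SL2_def SL2_subgroup_def intro!: bexI[of _ "mat 1"] mat_cong_sym)
next
  case (Suc i)
  let ?N = "m + i"
  obtain k where k: "k \<in> K" "mat_cong ?N k A" using Suc by blast
  have det: "det k = 1" "det A = 1" using K k(1) A by (auto simp: SL2_subgroup_def SL2_iff ball_SL2_def)
  have "mat_cong ?N (A ** adj2 k) (k ** adj2 k)" by (intro mat_cong_mult mat_cong_sym[OF k(2)]) simp
  then obtain R where R: "A ** adj2 k = mat 1 + ell ^ ?N *m R" by (auto simp: mat_cong_iff mult_adj2 det)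
  obtain a b c d where abcd: "R = mk2 a b c d" by (rule mk2_cases)
  \<comment> \<open>Determinant 1 reads tr R + ell^N det R = 0. Hence the trace of R vanishes modulo
    ell, R is congruent to an element of \<open>sl2\<close>, and the level at N can correct
    it.\<close>
  have "det (A ** adj2 k) = 1" by (simp add: det_mult2 det)
  then have "ell ^ ?N * (a + d + ell ^ ?N * (a * d - b * c)) = ell ^ ?N * 0"
    by (simp add: R abcd mat_mk2 algebra_simps)
  then have "a + d + ell ^ ?N * (a * d - b * c) = 0" by (rule ell_power_cancel)
  then have "d = - a - ell ^ ?N * (a * d - b * c)" by (simp add: eq_neg_iff_add_eq_0 algebra_simps)
  moreover have "ell ^ 1 dvd (ell :: 'a adic_int) ^ ?N" by (rule le_imp_power_dvd) (use m in simp)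
  moreover define Z where "Z = mk2 a b c (- a)"
  moreover have "d + a = - (ell ^ ?N * (a * d - b * c))" if "d = - a - ell ^ ?N * (a * d - b * c)"
    by (subst that) simp
  ultimately have Z: "mat_cong 1 R Z" "Z \<in> carrier sl2"
    by (simp_all add: abcd Z_def)
  then have "mat_cong (Suc ?N) (A ** adj2 k) (mat 1 + ell ^ ?N *m Z)"
    using mat_cong_add[OF mat_cong_refl mat_cong_smat_same[of 1 R]] by (simp add: R)
  moreover obtain l where l: "l \<in> K" "mat_cong (Suc ?N) l (mat 1 + ell ^ ?N *m Z)"
    using lev[of ?N] Z by (auto simp: level_def)
  ultimately have "mat_cong (Suc ?N) (l ** k) (A ** adj2 k ** k)"
    by (intro mat_cong_mult) (auto intro: mat_cong_trans mat_cong_sym)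
  also have "A ** adj2 k ** k = A" by (simp add: adj2_mult_self det flip: matrix_mul_assoc)
  finally show ?case using l k K by (auto simp: SL2_subgroup_def)
qed

lemma mat_mult_add_left: "(A + B) ** C = A ** C + B ** C" for A B C :: "'a::comm_ring_1 ^ 2 ^ 2"
  by (cases A rule: mk2_cases; cases B rule: mk2_cases; cases C rule: mk2_cases) (simp add: algebra_simps)

lemma adj2_mat: "adj2 (mat c) = mat (c :: 'a::comm_ring_1)" by (simp add: mat_mk2)

lemma adj2_one_plus: "Z \<in> carrier sl2 \<Longrightarrow> adj2 (mat 1 + c *m Z) = mat 1 - c *m Z"
  by (erule sl2_cases) (simp add: mat_mk2)

text \<open>Writing p q = q p + ell^(i+j) B, the group commutator becomes 1 + ell^(i+j) B (q
  p)^(-1), where B is congruent to the bracket and the last factor to 1.\<close>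

lemma level_bracket:
  assumes G: "subgroup G GL2" and Z: "Z \<in> level (proj_SL2 G) i" "W \<in> level (proj_SL2 G) j"
    and ij: "i \<ge> 1" "j \<ge> 1"
  shows "Z ** W - W ** Z \<in> level (G \<inter> SL2) (i + j)"
proof -
  obtain p q where p: "p \<in> proj_SL2 G" "mat_cong (Suc i) p (mat 1 + ell ^ i *m Z)"
    and q: "q \<in> proj_SL2 G" "mat_cong (Suc j) q (mat 1 + ell ^ j *m W)"
    using Z by (auto simp: level_def)
  obtain R S where "p = mat 1 + ell ^ i *m Z + ell ^ Suc i *m R" "q = mat 1 + ell ^ j *m W + ell ^ Suc j *m S"
    using p(2) q(2) by (auto simp: mat_cong_iff)
  then have p': "p = mat 1 + ell ^ i *m (Z + ell *m R)" and q': "q = mat 1 + ell ^ j *m (W + ell *m S)"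
    by (simp_all add: smat_add smat_simps mult.commute)
  have det: "det p = 1" "det q = 1" using p q by (auto simp: proj_SL2_def SL2_iff)
  define B where "B = (Z + ell *m R) ** (W + ell *m S) - (W + ell *m S) ** (Z + ell *m R)"
  have pq: "p ** q = q ** p + ell ^ (i + j) *m B"
    unfolding p' q' B_def
    by (cases "Z + ell *m R" rule: mk2_cases; cases "W + ell *m S" rule: mk2_cases)
      (simp add: mat_mk2 power_add algebra_simps)
  have "p ** q ** adj2 (q ** p) = mat 1 + ell ^ (i + j) *m (B ** adj2 (q ** p))"
    unfolding pq mat_mult_add_left mult_adj2 by (simp add: det_mult2 det smat_simps)
  then have comm: "p ** q ** adj2 p ** adj2 q = mat 1 + ell ^ (i + j) *m (B ** adj2 (q ** p))"
    by (simp add: adj2_mult matrix_mul_assoc)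
  have "mat_cong 1 (Z + ell *m R) Z" "mat_cong 1 (W + ell *m S) W"
    unfolding mat_cong_iff by auto
  then have "mat_cong 1 B (Z ** W - W ** Z)"
    unfolding B_def by (intro mat_cong_diff mat_cong_mult)
  moreover have "mat_cong 1 p (mat 1)" "mat_cong 1 q (mat 1)"
  proof -
    have *: "mat_cong 1 (mat 1 + ell ^ Suc k *m X) (mat 1)" for k and X :: "'a mat2"
      unfolding mat_cong_iff by (rule exI[of _ "ell ^ k *m X"]) (simp add: smat_simps)
    show "mat_cong 1 p (mat 1)" "mat_cong 1 q (mat 1)"
      using ij *[of "i - 1"] *[of "j - 1"] by (simp_all add: p' q')
  qed
  then have "mat_cong 1 (adj2 (q ** p)) (adj2 (mat 1 ** mat 1))"
    by (intro mat_cong_adj2 mat_cong_mult)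
  ultimately have "mat_cong 1 (B ** adj2 (q ** p)) ((Z ** W - W ** Z) ** adj2 (mat 1 ** mat 1))"
    by (rule mat_cong_mult)
  also have "(Z ** W - W ** Z) ** adj2 (mat 1 ** mat 1) = Z ** W - W ** Z"
    by (simp add: adj2_mat)
  finally have "mat_cong (Suc (i + j)) (p ** q ** adj2 p ** adj2 q) (mat 1 + ell ^ (i + j) *m (Z ** W - W ** Z))"
    using mat_cong_add[OF mat_cong_refl mat_cong_smat_same[of 1]] by (simp add: comm)
  then show ?thesis
    using proj_SL2_commutator[OF G p(1) q(1)] by (intro levelI) auto
qed

text \<open>Here \<open>h\<close> need not be close to the identity, so its commutator with an
  element of level \<open>j\<close> stays at level \<open>j\<close>. This is a passage from
  \<open>proj_SL2 G\<close> to \<open>G\<close> that does not raise the level.\<close>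

lemma level_conj:
  assumes G: "subgroup G GL2" and Z: "Z \<in> level (proj_SL2 G) j" and h: "h \<in> G" and j: "j \<ge> 1"
  shows "h ** Z ** adj2 h \<in> level (proj_SL2 G) j" (is ?conj)
    and "h ** Z ** adj2 h - det h *m Z \<in> level (G \<inter> SL2) j" (is ?comm)
proof -
  obtain v where v: "v * det h = 1" using unit_inverse[OF GL2_subgroup_det[OF G h]] by blast
  then have v1: "v dvd 1" by (metis dvdI)
  obtain p where p: "Z \<in> carrier sl2" "p \<in> proj_SL2 G" "mat_cong (Suc j) p (mat 1 + ell ^ j *m Z)"
    using Z by (auto simp: level_def)
  have "mat_cong (Suc j) (v *m (h ** p ** adj2 h)) (v *m (h ** (mat 1 + ell ^ j *m Z) ** adj2 h))"
    by (intro mat_cong_smat mat_cong_mult p(3)) auto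
  also have "v *m (h ** (mat 1 + ell ^ j *m Z) ** adj2 h) = (v * det h) *m mat 1 + ell ^ j *m v *m (h ** Z ** adj2 h)"
    by (cases Z rule: mk2_cases; cases h rule: mk2_cases) (simp add: mat_mk2 algebra_simps)
  finally have conj: "mat_cong (Suc j) (v *m (h ** p ** adj2 h)) (mat 1 + ell ^ j *m v *m (h ** Z ** adj2 h))"
    by (simp add: v smat_simps)
  have "v *m (h ** Z ** adj2 h) \<in> level (proj_SL2 G) j"
    using conj proj_SL2_conj_commutator(1)[OF G h v p(2)] p(1) by (intro levelI) auto
  then show ?conj by (rule sl2_module_unit[OF level_module[OF SL2_subgroup_proj[OF G] j] v1])
  have adj: "mat_cong (Suc j) (adj2 p) (mat 1 + ell ^ j *m (- Z))"
    using mat_cong_adj2[OF p(3)] by (simp add: adj2_one_plus p(1) smat_uminus)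
  have "mat_cong (Suc j) (v *m (h ** p ** adj2 h) ** adj2 p)
      (mat 1 + (ell ^ j *m (v *m (h ** Z ** adj2 h)) + ell ^ j *m (- Z)))"
    by (rule mat_cong_trans[OF mat_cong_mult[OF conj adj] mat_cong_mono[OF one_plus_mult]]) (use j in simp)
  then have "mat_cong (Suc j) (v *m (h ** p ** adj2 h) ** adj2 p) (mat 1 + ell ^ j *m (v *m (h ** Z ** adj2 h) - Z))"
    by (simp add: smat_diff smat_uminus)
  then have "v *m (h ** Z ** adj2 h) - Z \<in> level (G \<inter> SL2) j"
    using proj_SL2_conj_commutator(2)[OF G h v p(2)] p(1)
    by (intro levelI) (auto simp: smat_simps)
  then have "v *m (h ** Z ** adj2 h - det h *m Z) \<in> level (G \<inter> SL2) j"
    using v by (simp add: smat_diff smat_simps)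
  then show ?comm by (rule sl2_module_unit[OF level_module[OF SL2_subgroup_Int[OF G] j] v1])
qed

subsection \<open>Topology\<close>

lemma adic_open_cong: "open {y. ell ^ n dvd y - (x :: 'p::prime_card adic_int)}"
  unfolding open_adic_int_def
proof clarify
  fix z assume "ell ^ n dvd z - x"
  then have "ell ^ n dvd y - x" if "ell ^ n dvd y - z" for y
    using dvd_add[OF that \<open>ell ^ n dvd z - x\<close>] by simp
  then show "\<exists>m. \<forall>y. ell ^ m dvd y - z \<longrightarrow> y \<in> {y. ell ^ n dvd y - x}" by blast
qed

lemma open_mat2_iff:
  "open U \<longleftrightarrow> (\<forall>A\<in>U. \<exists>n. \<forall>B. mat_cong n A B \<longrightarrow> B \<in> (U :: 'p::prime_card mat2 set))"
proof
  assume U: "open U"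
  show "\<forall>A\<in>U. \<exists>n. \<forall>B. mat_cong n A B \<longrightarrow> B \<in> U"
  proof
    fix A assume "A \<in> U"
    from bspec[OF U[unfolded open_vec_def[of U]] this] obtain R where
      R0: "\<forall>i. open (R i) \<and> A $ i \<in> R i" "\<forall>B. (\<forall>i. B $ i \<in> R i) \<longrightarrow> B \<in> U"
      by (elim exE conjE)
    have R: "open (R i)" "A $ i \<in> R i" for i using R0(1) by simp_all
    have "\<exists>S. (\<forall>j. open (S j) \<and> A $ i $ j \<in> S j) \<and> (\<forall>v. (\<forall>j. v $ j \<in> S j) \<longrightarrow> v \<in> R i)" for i
      using R(1,2)[of i] unfolding open_vec_def by (rule bspec)
    then have "\<forall>i. \<exists>S. (\<forall>j. open (S j) \<and> A $ i $ j \<in> S j) \<and> (\<forall>v. (\<forall>j. v $ j \<in> S j) \<longrightarrow> v \<in> R i)" ..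
    from choice[OF this] obtain S where S:
      "\<forall>i. (\<forall>j. open (S i j) \<and> A $ i $ j \<in> S i j) \<and> (\<forall>v. (\<forall>j. v $ j \<in> S i j) \<longrightarrow> v \<in> R i)" ..
    have S1: "open (S i j)" "A $ i $ j \<in> S i j" for i j using S by simp_all
    have ex: "\<exists>n. \<forall>y. ell ^ n dvd y - A $ i $ j \<longrightarrow> y \<in> S i j" for i j
      using S1[of i j] unfolding open_adic_int_def by (rule bspec)
    define n where "n i j = (SOME n. \<forall>y. ell ^ n dvd y - A $ i $ j \<longrightarrow> y \<in> S i j)" for i j
    have n: "\<forall>y. ell ^ n i j dvd y - A $ i $ j \<longrightarrow> y \<in> S i j" for i j
      unfolding n_def by (rule someI_ex[OF ex])
    define N where "N = n 1 1 + n 1 2 + n 2 1 + n 2 2"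
    have "n i j \<le> N" for i j using exhaust_2[of i] exhaust_2[of j] by (auto simp: N_def)
    have "B \<in> U" if "mat_cong N A B" for B
    proof (rule R0(2)[THEN spec, THEN mp], rule allI)
      fix i
      have "ell ^ n i j dvd B $ i $ j - A $ i $ j" for j
        using mat_cong_mono[OF mat_cong_sym[OF that] \<open>\<And>i j. n i j \<le> N\<close>[of i j]] by (simp add: mat_cong_def)
      then have "\<forall>j. B $ i $ j \<in> S i j" using n by simp
      then show "B $ i \<in> R i" by (rule S[THEN spec, THEN conjunct2, THEN spec, THEN mp])
    qed
    then show "\<exists>n. \<forall>B. mat_cong n A B \<longrightarrow> B \<in> U" by (intro exI allI impI)
  qed
next
  assume U: "\<forall>A\<in>U. \<exists>n. \<forall>B. mat_cong n A B \<longrightarrow> B \<in> U"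
  show "open U"
    unfolding open_vec_def[of U]
  proof
    fix A assume "A \<in> U"
    then obtain n where n: "\<And>B. mat_cong n A B \<Longrightarrow> B \<in> U" using U by blast
    define R where "R i = {v. \<forall>j. v $ j \<in> {y. ell ^ n dvd y - A $ i $ j}}" for i
    have "open (R i)" for i unfolding R_def by (intro open_vector_box allI adic_open_cong)
    moreover have "B \<in> U" if "\<forall>i. B $ i \<in> R i" for B
      using that by (intro n) (auto simp: R_def mat_cong_def intro: dvd_diff_swap)
    ultimately show "\<exists>R. (\<forall>i. open (R i) \<and> A $ i \<in> R i) \<and> (\<forall>B. (\<forall>i. B $ i \<in> R i) \<longrightarrow> B \<in> U)"
      by (intro exI[of _ R]) (auto simp: R_def)
  qed
qed

text \<open>The complement of a union of residue classes is again a union of residue classes, hence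
  open.\<close>

lemma closed_cong_saturation: "closed {A. \<exists>X\<in>V. mat_cong n X (A :: 'p::prime_card mat2)}"
  unfolding closed_def open_mat2_iff
proof (intro ballI exI[of _ n] allI impI)
  fix A B assume "A \<in> - {A. \<exists>X\<in>V. mat_cong n X A}" "mat_cong n A B"
  then show "B \<in> - {A. \<exists>X\<in>V. mat_cong n X A}"
    using mat_cong_trans[OF _ mat_cong_sym, of n _ B A] by blast
qed

lemma closed_subgroup_sl2:
  assumes V: "sl2_module V" and cong: "cong_closed n V" shows "closed_subgroup V sl2"
  unfolding closed_subgroup_def
proof
  show "subgroup V sl2"
  proof (rule group.subgroupI[OF group_sl2])
    fix X assume X: "X \<in> V"
    have "inv\<^bsub>sl2\<^esub> X = - X"
      by (rule group.inv_equality[OF group_sl2]) (use sl2_moduleD[OF V] X in \<open>auto simp: sl2_def\<close>)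
    then show "inv\<^bsub>sl2\<^esub> X \<in> V" using sl2_moduleD(6)[OF V X] by simp
  qed (use sl2_moduleD[OF V] in \<open>auto simp: sl2_def\<close>)
  have "V = carrier sl2 \<inter> {A. \<exists>X\<in>V. mat_cong n X A}"
    using cong sl2_moduleD(1)[OF V] by (auto simp: cong_closed_def intro: mat_cong_refl)
  then show "closedin (top_of_set (carrier sl2)) V"
    using closed_cong_saturation unfolding closedin_closed by blast
qed

text \<open>Minimality is how the hypothesis on the special Lie algebra is exploited throughout: it
  suffices to exhibit an open module that contains every \<open>Theta g\<close>.\<close>

lemma special_Lie_subset:
  "sl2_module V \<Longrightarrow> cong_closed n V \<Longrightarrow> Theta ` G \<subseteq> V \<Longrightarrow> special_Lie G \<subseteq> V"
  unfolding special_Lie_def by (rule hull_minimal) (auto intro: closed_subgroup_sl2)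

lemma closed_subgroup_GL2_approx:
  assumes G: "closed_subgroup G GL2" and A: "det A = 1" and approx: "\<And>n. \<exists>k\<in>G. mat_cong n k A"
  shows "A \<in> G"
proof (rule ccontr)
  assume "A \<notin> G"
  obtain T where T: "closed T" "G = carrier GL2 \<inter> T"
    using G by (auto simp: closed_subgroup_def closedin_closed)
  with A \<open>A \<notin> G\<close> have "A \<in> - T" by (simp add: carrier_GL2)
  then obtain n where "\<And>B. mat_cong n A B \<Longrightarrow> B \<in> - T"
    using T(1) unfolding closed_def open_mat2_iff by blast
  then show False using approx[of n] T(2) mat_cong_sym by blast
qed

text \<open>Once one level from 2 on is full, all later ones are; approximation and closedness of
  \<open>G\<close> do the rest.\<close>

lemma ball_SL2_subset:
  fixes G :: "'p::prime_card mat2 set"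
  assumes G: "closed_subgroup G GL2" and m: "m \<ge> 2" and lev: "carrier sl2 \<subseteq> level (G \<inter> SL2) m"
  shows "ball_SL2 m \<subseteq> G"
proof
  fix A :: "'p mat2" assume A: "A \<in> ball_SL2 m"
  have sub: "SL2_subgroup (G \<inter> SL2)" using G by (intro SL2_subgroup_Int) (simp add: closed_subgroup_def)
  have "level (G \<inter> SL2) j = carrier sl2" if "j \<ge> m" for j
    using level_mono[OF sub m that] lev by (auto simp: level_def)
  then have approx: "\<exists>k\<in>G \<inter> SL2. mat_cong (m + i) k A" for i
    using SL2_ball_approx[OF sub _ _ A] m by simp
  have "\<exists>k\<in>G. mat_cong n k A" for n
    using approx[of n] mat_cong_mono[of "m + n" _ A n] by (metis IntD1 le_add2)
  then show "A \<in> G"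
    using A by (intro closed_subgroup_GL2_approx[OF G]) (auto simp: ball_SL2_def SL2_iff)
qed

text \<open>Both forms are needed: closedness in \<open>GL2\<close> feeds the ball theorems,
  closedness in \<open>H\<close> is what is finally asserted.\<close>

lemma closed_subgroup_cong:
  fixes H :: "'p::prime_card mat2 set"
  assumes H: "closed_subgroup H GL2" and K: "K \<subseteq> H" "subgroup K GL2"
    and cong: "\<And>A B. A \<in> K \<Longrightarrow> B \<in> H \<Longrightarrow> mat_cong n A B \<Longrightarrow> B \<in> K"
  shows "closed_subgroup K GL2" "closed_subgroup K (GL2\<lparr>carrier := H\<rparr>)"
proof -
  have eq: "K = H \<inter> {A. \<exists>X\<in>K. mat_cong n X A}" using K cong by (auto intro: mat_cong_refl)
  then have cl: "closedin (top_of_set H) K" using closed_cong_saturation unfolding closedin_closed by blast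
  have "subgroup H GL2" using H by (simp add: closed_subgroup_def)
  then have "subgroup K (GL2\<lparr>carrier := H\<rparr>)"
    using group.subgroup_incl[OF group_GL2 K(2) _ K(1)] by simp
  with cl show "closed_subgroup K (GL2\<lparr>carrier := H\<rparr>)" by (simp add: closed_subgroup_def)
  show "closed_subgroup K GL2"
    using K(2) closedin_trans[OF cl] H by (simp add: closed_subgroup_def)
qed

subsection \<open>Powers\<close>

text \<open>As X X is the scalar x, the binomial expansion splits into an even part T and an odd
  part C times X. Two terms of each are kept, the rest being divisible by x^2.\<close>

lemma mpow_one_plus:
  fixes X :: "'p::prime_card mat2"
  assumes X: "X \<in> carrier sl2" and x: "x = - det X"
  shows "\<exists>T C. mpow (mat 1 + X) r = mat T + C *m X \<and> x * x dvd T - (1 + of_nat (r choose 2) * x)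
    \<and> x * x dvd C - (of_nat r + of_nat (r choose 3) * x)"
proof (induction r)
  case 0
  have "mat 1 = mat 1 + 0 *m X" by (cases X rule: mk2_cases) (simp add: mat_mk2)
  then show ?case by (rule_tac exI[of _ 1], rule_tac exI[of _ 0]) (simp add: binomial_eq_0)
next
  case (Suc r)
  then obtain T C a b where *: "mpow (mat 1 + X) r = mat T + C *m X"
    "T - (1 + of_nat (r choose 2) * x) = x * x * a" "C - (of_nat r + of_nat (r choose 3) * x) = x * x * b"
    by (auto elim!: dvdE)
  have T: "T = 1 + of_nat (r choose 2) * x + x * x * a" and C: "C = of_nat r + of_nat (r choose 3) * x + x * x * b"
    using *(2,3) by (simp_all add: algebra_simps)
  have "(mat T + C *m X) ** (mat 1 + X) = mat (T + C * x) + (T + C) *m X"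
    using X x by (elim sl2_cases) (simp add: mat_mk2 algebra_simps)
  moreover have "T + C * x - (1 + of_nat (Suc r choose 2) * x) = x * x * (a + of_nat (r choose 3) + b * x)"
  proof -
    have "Suc r choose 2 = r + (r choose 2)" by (simp add: numeral_2_eq_2)
    then show ?thesis unfolding T C by (simp add: algebra_simps)
  qed
  moreover have "T + C - (of_nat (Suc r) + of_nat (Suc r choose 3) * x) = x * x * (a + b)"
  proof -
    have "Suc r choose 3 = (r choose 2) + (r choose 3)" by (simp add: numeral_3_eq_3 numeral_2_eq_2)
    then show ?thesis unfolding T C by (simp add: algebra_simps)
  qed
  ultimately show ?case using *(1) by (metis dvd_triv_left mpow.simps(2))
qed

text \<open>The condition on \<open>det X\<close> makes the coefficient of \<open>X\<close> in \<open>(1 + X)\<^sup>\<ell>\<close> have valuation exactly \<open>1\<close>;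
  it fails for the elements of order \<open>3\<close> when \<open>\<ell> = 3\<close>.\<close>

definition tame :: "'p::prime_card mat2 \<Rightarrow> bool" where
  "tame X \<longleftrightarrow> X \<in> carrier sl2 \<and> (ell ^ 2 dvd det X \<or> ell dvd det X \<and> CARD('p) \<ge> 5)"

lemma tame_dvd_det: "tame X \<Longrightarrow> ell dvd det X"
  unfolding tame_def by (metis dvd_mult_left power2_eq_square)

lemma tame_smat: "tame X \<Longrightarrow> tame (c *m X)"
  by (auto simp: tame_def det_smat)

lemma unit_one_plus: "ell dvd x - u \<Longrightarrow> u dvd 1 \<Longrightarrow> x dvd (1 :: 'p::prime_card adic_int)"
  by (auto simp: unit_iff_red simp flip: red_eq_iff)

text \<open>The coefficient of X is ell + binom(ell, 3) x modulo x^2. Here ell^2 divides x^2, and it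
  divides the middle term because ell^2 divides x, or ell divides both x and, for ell \<ge> 5, the
  binomial coefficient.\<close>

lemma mpow_tame:
  fixes X :: "'p::prime_card mat2"
  assumes X: "tame X"
  shows "\<exists>T u. mpow (mat 1 + X) CARD('p) = mat T + (ell * u) *m X \<and> T dvd 1 \<and> u dvd 1"
proof -
  define x where "x = - det X"
  have sl: "X \<in> carrier sl2" using X by (simp add: tame_def)
  let ?p = "CARD('p)"
  obtain T C where *: "mpow (mat 1 + X) ?p = mat T + C *m X"
    "x * x dvd T - (1 + of_nat (?p choose 2) * x)" "x * x dvd C - (ell + of_nat (?p choose 3) * x)"
    using mpow_one_plus[OF sl x_def] by blast
  have ellx: "ell dvd x"
    using tame_dvd_det[OF X] by (simp add: x_def)
  then have xx: "ell * ell dvd x * x" by (rule mult_dvd_mono) fact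
  have "ell dvd (T - (1 + of_nat (?p choose 2) * x)) + of_nat (?p choose 2) * x"
    using dvd_trans[OF ellx dvd_trans[OF _ *(2)]] ellx by (intro dvd_add) auto
  then have "T dvd 1" using unit_one_plus[of T 1] by simp
  have "ell * ell dvd of_nat (?p choose 3) * x"
  proof (cases "ell ^ 2 dvd det X")
    case True
    then show ?thesis by (simp add: x_def power2_eq_square)
  next
    case False
    then have "?p \<ge> 5" using X by (simp add: tame_def)
    then have "?p dvd ?p choose 3" by (intro dvd_choose_prime prime_card) auto
    then obtain c where "?p choose 3 = ?p * c" by (elim dvdE)
    then have "ell dvd (of_nat (?p choose 3) :: 'p adic_int)" by simp
    then show ?thesis using ellx by (rule mult_dvd_mono)
  qed
  then have "ell * ell dvd (C - (ell + of_nat (?p choose 3) * x)) + of_nat (?p choose 3) * x"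
    using dvd_trans[OF xx *(3)] by (intro dvd_add)
  then obtain e where "C - ell = ell * ell * e" by (auto elim: dvdE)
  then have C: "C = ell * (1 + ell * e)" by (simp add: algebra_simps)
  moreover have "1 + ell * e dvd 1" by (rule unit_one_plus[of _ 1]) auto
  ultimately show ?thesis using *(1) \<open>T dvd 1\<close> unfolding C by blast
qed

lemma mpow_smat: "mpow (c *m A) r = c ^ r *m mpow A r"
  by (induction r) (auto simp: smat_simps ac_simps)

lemma unit_power: "(c :: 'a::comm_ring_1) dvd 1 \<Longrightarrow> c ^ r dvd 1"
  by (metis dvd_power_same power_one)

lemma unit_mult: "(c :: 'a::comm_ring_1) dvd 1 \<Longrightarrow> d dvd 1 \<Longrightarrow> c * d dvd 1"
  by (metis mult_dvd_mono mult_1)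

lemma affine_eq_unit_smat:
  fixes X :: "'a::comm_ring_1 ^ 2 ^ 2"
  assumes "v * T = 1"
  shows "mat T + c *m X = T *m (mat 1 + (v * c) *m X)"
proof -
  have "T * (v * r) = r" for r using assms by (simp add: mult.commute flip: mult.assoc)
  then show ?thesis by (cases X rule: mk2_cases) (simp add: mat_mk2 distrib_left mult.assoc)
qed

text \<open>All powers lie in the span of 1 and the same X, exactly and not just up to congruence,
  so no errors accumulate over the \<open>n\<close> steps; each step contributes one factor ell and
  a unit.\<close>

lemma tame_power:
  fixes X :: "'p::prime_card mat2"
  assumes K: "SL2_subgroup K" and X: "tame X"
    and A: "mat T + (ell ^ i * u) *m X \<in> K" "T dvd 1" "u dvd 1"
  shows "\<exists>T u. mat T + (ell ^ (i + n) * u) *m X \<in> K \<and> T dvd 1 \<and> u dvd 1"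
proof (induction n)
  case 0
  then show ?case using A by auto
next
  case (Suc n)
  then obtain T u where Tu: "mat T + (ell ^ (i + n) * u) *m X \<in> K" "T dvd 1" "u dvd 1" by blast
  let ?p = "CARD('p)"
  obtain v where v: "v * T = 1" using unit_inverse[OF Tu(2)] by blast
  then have v1: "v dvd 1" by (metis dvdI)
  define Y where "Y = (v * (ell ^ (i + n) * u)) *m X"
  have A: "mat T + (ell ^ (i + n) * u) *m X = T *m (mat 1 + Y)"
    unfolding Y_def by (rule affine_eq_unit_smat[OF v])
  obtain S w where S: "mpow (mat 1 + Y) ?p = mat S + (ell * w) *m Y" "S dvd 1" "w dvd 1"
    using mpow_tame[of Y] X by (auto simp: Y_def tame_smat)
  have "mpow (T *m (mat 1 + Y)) ?p \<in> K" using mpow_closed[OF K Tu(1)] by (simp add: A)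
  also have "mpow (T *m (mat 1 + Y)) ?p = T ^ ?p *m (mat S + (ell * w) *m Y)"
    by (simp add: mpow_smat S)
  also have "\<dots> = mat (T ^ ?p * S) + (ell ^ (i + Suc n) * (T ^ ?p * w * v * u)) *m X"
    unfolding Y_def by (cases X rule: mk2_cases) (simp add: mat_mk2 algebra_simps)
  finally have mem: "mat (T ^ ?p * S) + (ell ^ (i + Suc n) * (T ^ ?p * w * v * u)) *m X \<in> K" .
  show ?case
    by (rule exI[of _ "T ^ ?p * S"], rule exI[of _ "T ^ ?p * w * v * u"])
      (intro conjI mem unit_mult unit_power Tu S v1)
qed

subsection \<open>Approximate directions\<close>

text \<open>The precision 2s + k is dictated by two demands. The product of 1 + ell^s X and 1 +
  ell^s Y has the unwanted term ell^(2s) X Y, which vanishes at this precision if X Y is 0 modulo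
  ell^k on \<open>N\<close>; so directions add up. And for X = ell^s Z it is fine enough to read off
  Z at level 2s. The unit \<open>T\<close> is the uncontrolled even part of a power.\<close>

definition directions :: "'p::prime_card mat2 set \<Rightarrow> 'p mat2 set \<Rightarrow> nat \<Rightarrow> nat \<Rightarrow> 'p mat2 set" where
  "directions G N s k = {X \<in> N. \<exists>p\<in>proj_SL2 G. \<exists>T. T dvd 1
      \<and> mat_cong (s + (s + k)) p (T *m (mat 1 + ell ^ s *m X))}"

lemma cong_closed_mono: "cong_closed m V \<Longrightarrow> m \<le> n \<Longrightarrow> cong_closed n V"
  unfolding cong_closed_def by (meson mat_cong_mono)

lemma directions_cong_closed:
  assumes N: "cong_closed 1 N" and k: "k \<ge> 1"
  shows "cong_closed (s + k) (directions G N s k)"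
  unfolding cong_closed_def directions_def
proof safe
  fix X Y p T assume *: "Y \<in> carrier sl2" "mat_cong (s + k) X Y" "X \<in> N" "p \<in> proj_SL2 G" "T dvd 1"
    "mat_cong (s + (s + k)) p (T *m (mat 1 + ell ^ s *m X))"
  show "Y \<in> N" using cong_closed_mono[OF N, of "s + k"] k * by (auto simp: cong_closed_def)
  have "mat_cong (s + (s + k)) (T *m (mat 1 + ell ^ s *m X)) (T *m (mat 1 + ell ^ s *m Y))"
    using *(2) by (intro mat_cong_smat mat_cong_add mat_cong_smat_same) auto
  from mat_cong_trans[OF *(6) this]
  show "\<exists>p\<in>proj_SL2 G. \<exists>T. T dvd 1 \<and> mat_cong (s + (s + k)) p (T *m (mat 1 + ell ^ s *m Y))"
    using * by blast
qed

lemma directions_module: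
  assumes G: "subgroup G GL2" and N: "sl2_module N" "cong_closed 1 N" and k: "k \<ge> 1"
    and NN: "\<And>X Y. X \<in> N \<Longrightarrow> Y \<in> N \<Longrightarrow> mat_cong k (X ** Y) 0"
  shows "sl2_module (directions G N s k)"
proof (rule sl2_moduleI[OF _ _ _ directions_cong_closed[OF N(2) k]])
  note P = SL2_subgroup_proj[OF G]
  show "directions G N s k \<subseteq> carrier sl2" using sl2_moduleD(1)[OF N(1)] by (auto simp: directions_def)
  have "mat 1 = 1 *m (mat 1 + ell ^ s *m (0 :: 'a mat2))" by (simp add: mk2_const)
  then show "0 \<in> directions G N s k"
    using P sl2_moduleD(2)[OF N(1)]
    by (auto simp: directions_def SL2_subgroup_def intro!: bexI[of _ "mat 1"] exI[of _ 1])
  fix X Y assume "X \<in> directions G N s k" "Y \<in> directions G N s k"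
  then obtain p q T U where *: "X \<in> N" "Y \<in> N" "p \<in> proj_SL2 G" "q \<in> proj_SL2 G" "T dvd 1" "U dvd 1"
    "mat_cong (s + (s + k)) p (T *m (mat 1 + ell ^ s *m X))"
    "mat_cong (s + (s + k)) q (U *m (mat 1 + ell ^ s *m Y))"
    by (auto simp: directions_def)
  have "mat_cong (s + (s + k)) (p ** q) ((T *m (mat 1 + ell ^ s *m X)) ** (U *m (mat 1 + ell ^ s *m Y)))"
    by (intro mat_cong_mult *)
  also have "(T *m (mat 1 + ell ^ s *m X)) ** (U *m (mat 1 + ell ^ s *m Y))
      = (T * U) *m (mat 1 + ell ^ s *m (X + Y) + ell ^ s *m ell ^ s *m (X ** Y))"
    by (cases X rule: mk2_cases; cases Y rule: mk2_cases) (simp add: mat_mk2 algebra_simps)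
  also have "mat_cong (s + (s + k)) \<dots> ((T * U) *m (mat 1 + ell ^ s *m (X + Y) + ell ^ s *m ell ^ s *m 0))"
    by (intro mat_cong_smat mat_cong_add mat_cong_smat_same NN *) auto
  also have "ell ^ s *m ell ^ s *m 0 = (0 :: 'a mat2)" by (simp add: zero_mk2)
  finally have "mat_cong (s + (s + k)) (p ** q) ((T * U) *m (mat 1 + ell ^ s *m (X + Y)))" by simp
  moreover have "p ** q \<in> proj_SL2 G" using P * by (auto simp: SL2_subgroup_def)
  ultimately show "X + Y \<in> directions G N s k"
    using * sl2_moduleD(3)[OF N(1)] unit_mult by (auto simp: directions_def)
qed

lemma directions_conj:
  assumes G: "subgroup G GL2" and N: "sl2_module N" "cong_closed 1 N" and k: "k \<ge> 1"
    and NN: "\<And>X Y. X \<in> N \<Longrightarrow> Y \<in> N \<Longrightarrow> mat_cong k (X ** Y) 0"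
    and h: "h \<in> G" and Nh: "\<And>X. X \<in> N \<Longrightarrow> h ** X ** adj2 h \<in> N" and X: "X \<in> directions G N s k"
  shows "h ** X ** adj2 h \<in> directions G N s k"
proof -
  obtain v where v: "v * det h = 1" using unit_inverse[OF GL2_subgroup_det[OF G h]] by blast
  then have v1: "v dvd 1" by (metis dvdI)
  obtain p T where p: "X \<in> N" "p \<in> proj_SL2 G" "T dvd 1"
    "mat_cong (s + (s + k)) p (T *m (mat 1 + ell ^ s *m X))"
    using X by (auto simp: directions_def)
  have "mat_cong (s + (s + k)) (v *m (h ** p ** adj2 h)) (v *m (h ** (T *m (mat 1 + ell ^ s *m X)) ** adj2 h))"
    by (intro mat_cong_smat mat_cong_mult p(4)) auto
  also have "v *m (h ** (T *m (mat 1 + ell ^ s *m X)) ** adj2 h)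
      = T *m ((v * det h) *m mat 1 + ell ^ s *m v *m (h ** X ** adj2 h))"
    by (cases X rule: mk2_cases; cases h rule: mk2_cases) (simp add: mat_mk2 algebra_simps)
  finally have "v *m (h ** X ** adj2 h) \<in> directions G N s k"
    using proj_SL2_conj_commutator(1)[OF G h v p(2)] p(1,3) Nh sl2_moduleD(4)[OF N(1)]
    by (auto simp: directions_def v smat_simps)
  moreover have "sl2_module (directions G N s k)" by (rule directions_module[OF G N k NN])
  ultimately show ?thesis using sl2_module_unit v1 by blast
qed

lemma directionsI:
  fixes X :: "'p::prime_card mat2"
  assumes V: "sl2_module (directions G N s k)" and N: "sl2_module N" and X: "X \<in> N"
    and p: "mat T + (ell ^ s * u) *m X \<in> proj_SL2 G" "T dvd 1" "u dvd 1"
  shows "X \<in> directions G N s k"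
proof -
  obtain v where v: "v * T = 1" using unit_inverse[OF p(2)] by blast
  have "mat T + (ell ^ s * u) *m X = T *m (mat 1 + ell ^ s *m ((v * u) *m X))"
    unfolding affine_eq_unit_smat[OF v] by (simp add: smat_simps ac_simps)
  then have "(v * u) *m X \<in> directions G N s k"
    using p X sl2_moduleD(4)[OF N] by (auto simp: directions_def intro!: bexI[OF _ p(1)])
  moreover have "v * u dvd 1" using unit_mult[OF _ p(3)] v by (metis dvdI)
  ultimately show ?thesis using sl2_module_unit[OF V] by blast
qed

text \<open>Since Z has trace zero, det (1 + ell^j Z) is 1 modulo ell^(2j), so det p = 1 forces T^2
  to be 1 modulo ell^(j+k). Hence T is 1 or -1 modulo ell^(j+1), with one power lost when ell = 2,
  and the sign is harmless because \<open>proj_SL2 G\<close> is stable under -1.\<close>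

lemma level_of_unit_multiple:
  fixes Z :: "'p::prime_card mat2"
  assumes p: "p \<in> proj_SL2 G" and T: "T dvd 1" and Z: "Z \<in> carrier sl2"
    and k: "odd CARD('p) \<and> k \<ge> 1 \<or> CARD('p) = 2 \<and> k \<ge> 2" "k \<le> j"
    and cong: "mat_cong (j + k) p (T *m (mat 1 + ell ^ j *m Z))"
  shows "Z \<in> level (proj_SL2 G) j"
proof -
  have p1: "det p = 1" using p by (simp add: proj_SL2_def SL2_iff)
  have "det (T *m (mat 1 + ell ^ j *m Z)) = T * T + ell ^ (j + j) * (T * T * det Z)"
    using Z by (elim sl2_cases) (simp add: mat_mk2 power_add algebra_simps)
  then have "ell ^ (j + k) dvd 1 - (T * T + ell ^ (j + j) * (T * T * det Z))"
    using mat_cong_det[OF cong] p1 by simp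
  moreover have "ell ^ (j + k) dvd ell ^ (j + j) * (T * T * det Z)"
    using le_imp_power_dvd[of "j + k" "j + j"] k(2) by (intro dvd_mult2) simp
  ultimately have "ell ^ (j + k) dvd 1 - (T * T + ell ^ (j + j) * (T * T * det Z)) + ell ^ (j + j) * (T * T * det Z)"
    by (rule dvd_add)
  then have "ell ^ (j + k) dvd 1 - T * T" by simp
  then have TT: "ell ^ (j + k) dvd T * T - 1" by (rule dvd_diff_swap)
  from k(1) consider "odd CARD('p)" "k \<ge> 1" | "CARD('p) = 2" "k \<ge> 2" by (elim disjE conjE)
  then have "ell ^ Suc j dvd T - 1 \<or> ell ^ Suc j dvd T + 1"
  proof cases
    case 1
    have "ell ^ Suc j dvd T * T - 1" by (rule dvd_trans[OF le_imp_power_dvd TT]) (use 1 in simp)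
    then show ?thesis using 1(1) by (rule square_eq_one_cong)
  next
    case 2
    have "ell ^ Suc (Suc j) dvd T * T - 1" by (rule dvd_trans[OF le_imp_power_dvd TT]) (use 2 in simp)
    then show ?thesis using 2(1) by (rule square_eq_one_cong_even)
  qed
  then have "ell ^ Suc j dvd 1 * T - 1 \<or> ell ^ Suc j dvd (-1) * T - 1"
    using dvd_minus_iff[of "ell ^ Suc j" "T + 1"] by (simp only: mult_1 mult_minus_left minus_add_distrib
      add_uminus_conv_diff)
  then obtain e where e: "e = 1 \<or> e = -1" "ell ^ Suc j dvd e * T - 1" by blast
  have "e *m p \<in> proj_SL2 G"
  proof -
    obtain c where c: "c dvd 1" "c *m p \<in> G" using p by (auto simp: proj_SL2_def)
    have "(c * e) *m e *m p = c *m p" using e(1) by (auto simp: smat_simps)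
    then have "(c * e) *m e *m p \<in> G" using c by simp
    moreover have "c * e dvd 1" using c(1) e(1) by auto
    moreover have "det (e *m p) = 1" using e(1) p1 by (auto simp: det_smat)
    ultimately show ?thesis unfolding proj_SL2_def SL2_iff by blast
  qed
  moreover have "mat_cong (Suc j) (e *m p) (e *m T *m (mat 1 + ell ^ j *m Z))"
    by (intro mat_cong_smat mat_cong_mono[OF cong]) (use k in auto)
  then have "mat_cong (Suc j) (e *m p) ((e * T) *m (mat 1 + ell ^ j *m Z))"
    by (simp only: smat_simps)
  then have "mat_cong (Suc j) (e *m p) (1 *m (mat 1 + ell ^ j *m Z))"
    by (rule mat_cong_trans[OF _ mat_cong_smat[OF e(2) mat_cong_refl]])
  then have "mat_cong (Suc j) (e *m p) (mat 1 + ell ^ j *m Z)"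
    by (simp only: smat_simps)
  ultimately show ?thesis using Z by (intro levelI)
qed

lemma directions_level:
  fixes Z :: "'p::prime_card mat2"
  assumes "ell ^ s *m Z \<in> directions G N s k" and Z: "Z \<in> carrier sl2"
    and k: "odd CARD('p) \<and> k \<ge> 1 \<or> CARD('p) = 2 \<and> k \<ge> 2" "k \<le> s + s"
  shows "Z \<in> level (proj_SL2 G) (s + s)"
proof -
  obtain p T where p: "p \<in> proj_SL2 G" "T dvd 1"
    "mat_cong (s + s + k) p (T *m (mat 1 + ell ^ (s + s) *m Z))"
    using assms(1) by (auto simp: directions_def smat_simps power_add add.assoc)
  then show ?thesis by (intro level_of_unit_multiple[OF p(1,2) Z k])
qed

text \<open>The determinant of g need not be a square, so g cannot be normalized to determinant 1,
  but g^2 can. The price is the factor 2t, the trace of g, in front of X.\<close>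

lemma square_in_proj_SL2:
  assumes G: "subgroup G GL2" and g: "g \<in> G" "v * det g = 1" "g = mat t + X" and X: "X \<in> carrier sl2"
  shows "mat (v * (t * t - det X)) + (v * (2 * t)) *m X \<in> proj_SL2 G"
proof -
  have eq: "mat (v * (t * t - det X)) + (v * (2 * t)) *m X = v *m (g ** g)"
    unfolding g(3) using X by (elim sl2_cases) (simp add: mat_mk2 algebra_simps)
  have "v * v * (det g * det g) = (v * det g) * (v * det g)" by (simp only: ac_simps)
  then have "det (v *m (g ** g)) = 1" by (simp add: det_smat det_mult2 g(2))
  moreover have "det g *m v *m (g ** g) = (v * det g) *m (g ** g)" by (simp add: smat_simps mult.commute)
  then have "det g *m v *m (g ** g) \<in> G" using GL2_subgroup_mult[OF G g(1) g(1)] by (simp add: g(2) smat_simps)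
  ultimately show ?thesis
    unfolding eq proj_SL2_def SL2_iff using GL2_subgroup_det[OF G g(1)] by blast
qed

text \<open>\<open>e\<close> is the valuation of 2, that is 0 or 1: the factor 2t already supplies
  ell^e, and \<open>s - e\<close> further ell-th powers supply the rest. Tameness makes t a unit
  through det g = t^2 + det X.\<close>

lemma tame_in_proj_SL2:
  fixes X :: "'p::prime_card mat2"
  assumes G: "subgroup G GL2" and g: "g \<in> G" "g = mat t + X" and X: "tame X"
    and e: "(2 :: 'p adic_int) = ell ^ e * w" "w dvd 1" "e \<le> s"
  shows "\<exists>T u. mat T + (ell ^ s * u) *m X \<in> proj_SL2 G \<and> T dvd 1 \<and> u dvd 1"
proof -
  have sl: "X \<in> carrier sl2" using X by (simp add: tame_def)
  have dX: "ell dvd det X" by (rule tame_dvd_det[OF X])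
  have unit: "det g dvd 1" by (rule GL2_subgroup_det[OF G g(1)])
  obtain v where v: "v * det g = 1" using unit_inverse[OF unit] by blast
  then have v1: "v dvd 1" by (metis dvdI)
  have det: "det g = t * t + det X"
    unfolding g(2) using sl by (elim sl2_cases) (simp add: mat_mk2 algebra_simps)
  have tt: "t * t dvd 1" by (rule unit_one_plus[OF _ unit]) (simp add: det dX)
  then have t1: "t dvd 1" by (rule dvd_mult_left)
  have "t * t - det X dvd 1" by (rule unit_one_plus[OF _ tt]) (simp add: dX)
  then have T: "v * (t * t - det X) dvd 1" by (rule unit_mult[OF v1])
  have "v * (2 * t) = ell ^ e * (v * w * t)" by (simp only: e(1) ac_simps)
  then have "mat (v * (t * t - det X)) + (ell ^ e * (v * w * t)) *m X \<in> proj_SL2 G"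
    using square_in_proj_SL2[OF G g(1) v g(2) sl] by simp
  from tame_power[OF SL2_subgroup_proj[OF G] X this T unit_mult[OF unit_mult[OF v1 e(2)] t1], of "s - e"]
  show ?thesis using e(3) by (simp only: le_add_diff_inverse)
qed

subsection \<open>Large special Lie algebras force large groups\<close>

text \<open>\<open>E\<close> is nilpotent modulo ell and spans the direction of the ell-part.
  \<open>E = 0\<close> encodes a trivial ell-part, where the set is ell times \<open>sl2\<close>, so
  both situations share one treatment.\<close>

definition nil_dirs :: "'p::prime_card mat2 \<Rightarrow> 'p mat2 set" where
  "nil_dirs E = {X \<in> carrier sl2. \<exists>c. mat_cong 1 X (c *m E)}"

lemma nil_dirs_cong_closed: "cong_closed 1 (nil_dirs E)"
  unfolding cong_closed_def nil_dirs_def by safe (meson mat_cong_sym mat_cong_trans)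

lemma nil_dirs_module: "sl2_module (nil_dirs E)"
proof (rule sl2_moduleI[OF _ _ _ nil_dirs_cong_closed])
  have "0 = 0 *m E" by (cases E rule: mk2_cases) (simp add: zero_mk2)
  then show "0 \<in> nil_dirs E" unfolding nil_dirs_def by (auto intro: exI[of _ 0])
  fix X Y assume "X \<in> nil_dirs E" "Y \<in> nil_dirs E"
  then obtain c d where *: "X \<in> carrier sl2" "Y \<in> carrier sl2" "mat_cong 1 X (c *m E)" "mat_cong 1 Y (d *m E)"
    by (auto simp: nil_dirs_def)
  then have "mat_cong 1 (X + Y) ((c + d) *m E)" using mat_cong_add[OF *(3,4)] by (simp only: smat_add_left)
  then show "X + Y \<in> nil_dirs E" using * unfolding nil_dirs_def by auto
qed (auto simp: nil_dirs_def)

lemma nil_dirs_mult: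
  assumes E: "mat_cong 1 (E ** E) 0" and X: "X \<in> nil_dirs E" "Y \<in> nil_dirs E"
  shows "mat_cong 1 (X ** Y) 0"
proof -
  obtain c d where *: "mat_cong 1 X (c *m E)" "mat_cong 1 Y (d *m E)" using X by (auto simp: nil_dirs_def)
  have "mat_cong 1 (X ** Y) ((c * d) *m (E ** E))"
    using mat_cong_mult[OF *] by (simp add: smat_simps mult.commute)
  also have "mat_cong 1 ((c * d) *m (E ** E)) ((c * d) *m 0)" by (rule mat_cong_smat[OF _ E]) simp
  also have "(c * d) *m 0 = (0 :: 'a mat2)" by (simp add: zero_mk2)
  finally show ?thesis .
qed

lemma nil_dirs_tame:
  fixes E :: "'p::prime_card mat2"
  assumes E: "E \<in> carrier sl2" "mat_cong 1 (E ** E) 0" "CARD('p) \<ge> 5 \<or> mat_cong 1 E 0"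
    and X: "X \<in> nil_dirs E"
  shows "tame X"
proof -
  obtain c where c: "X \<in> carrier sl2" "mat_cong 1 X (c *m E)" using X by (auto simp: nil_dirs_def)
  show ?thesis
  proof (cases "mat_cong 1 E 0")
    case True
    have "mat_cong 1 (c *m E) (c *m 0)" by (rule mat_cong_smat[OF _ True]) simp
    then have "mat_cong 1 X 0" using mat_cong_trans[OF c(2), of 0] by (simp add: zero_mk2)
    then obtain R where "X = ell *m R" by (auto simp: mat_cong_iff)
    then show ?thesis using c(1) by (simp add: tame_def det_smat power2_eq_square)
  next
    case False
    have "ell dvd det E" using E(2) sl2_square[OF E(1)] by (simp add: mk2_const)
    then have "ell dvd det (c *m E)" by (simp add: det_smat)
    then have "ell dvd det (c *m E) + (det X - det (c *m E))"
      using mat_cong_det[OF c(2)] by (intro dvd_add) simp_all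
    then show ?thesis using False c(1) E(3) by (simp add: tame_def)
  qed
qed

lemma mat_plus_Theta: "mat (halve (trace g)) + Theta g = g"
  by (simp add: Theta_def)

text \<open>\<open>halve\<close> is a definite description and opaque to algebra; after doubling,
  \<open>Theta\<close> is polynomial in the entries.\<close>

lemma two_Theta: "odd CARD('p) \<Longrightarrow> 2 *m Theta (g :: 'p::prime_card mat2) = 2 *m g - mat (trace g)"
proof -
  assume "odd CARD('p)"
  then have "2 * halve (trace g) = trace g" by (intro two_halve) simp
  moreover obtain a b c d where "g = mk2 a b c d" by (rule mk2_cases)
  ultimately show ?thesis by (simp add: Theta_def mat_mk2 algebra_simps)
qed

lemma Theta_sl2_odd: "odd CARD('p) \<Longrightarrow> Theta (g :: 'p::prime_card mat2) \<in> carrier sl2"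
  by (rule Theta_in_sl2) simp

lemma Theta_smat: "odd CARD('p) \<Longrightarrow> Theta (c *m g :: 'p::prime_card mat2) = c *m Theta g"
proof -
  assume odd: "odd CARD('p)"
  have "2 *m Theta (c *m g) = 2 *m c *m Theta g"
    using two_Theta[OF odd, of "c *m g"] arg_cong[OF two_Theta[OF odd, of g], of "\<lambda>A. c *m A"]
    by (cases g rule: mk2_cases) (simp add: smat_simps mat_mk2 algebra_simps)
  moreover obtain v where "v * 2 = (1 :: 'p adic_int)" using unit_inverse[OF two_unit[OF odd]] by blast
  ultimately show ?thesis by (metis smat_simps(3,4))
qed

lemma sl2_from_brackets:
  fixes V :: "'p::prime_card mat2 set"
  assumes V: "sl2_module V" and odd: "odd CARD('p)"
    and br: "\<And>X Y. X \<in> carrier sl2 \<Longrightarrow> Y \<in> carrier sl2 \<Longrightarrow> X ** Y - Y ** X \<in> V"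
  shows "carrier sl2 \<subseteq> V"
proof
  fix Z :: "'p mat2" assume "Z \<in> carrier sl2"
  then obtain a b c where Z: "Z = mk2 a b c (- a)" by (rule sl2_cases)
  have "mk2 0 1 0 0 ** mk2 0 0 1 0 - mk2 0 0 1 0 ** mk2 0 1 0 0 \<in> V"
    "mk2 1 0 0 (-1) ** mk2 0 1 0 0 - mk2 0 1 0 0 ** mk2 1 0 0 (-1) \<in> V"
    "mk2 0 0 1 0 ** mk2 1 0 0 (-1) - mk2 1 0 0 (-1) ** mk2 0 0 1 0 \<in> V"
    by (intro br; simp)+
  then have "(2 * a) *m mk2 1 0 0 (-1) + (b *m mk2 0 2 0 0 + c *m mk2 0 0 2 0) \<in> V"
    by (intro sl2_moduleD(3,4)[OF V]) simp_all
  then have "2 *m Z \<in> V" by (simp add: Z mult.commute)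
  then show "Z \<in> V" by (rule sl2_module_unit[OF V two_unit[OF odd]])
qed

text \<open>With 2 a unit, \<open>sl2\<close> is spanned by its brackets, so a full level 2s of
  \<open>proj_SL2 G\<close> brackets with itself to a full level 4s of \<open>G\<close>.\<close>

lemma ball_SL2_subset_of_level:
  fixes G :: "'p::prime_card mat2 set"
  assumes G: "closed_subgroup G GL2" and odd: "odd CARD('p)" and s: "s > 0"
    and lev: "carrier sl2 \<subseteq> level (proj_SL2 G) (s + s)"
  shows "ball_SL2 (4 * s) \<subseteq> G"
proof -
  have sub: "subgroup G GL2" using G by (simp add: closed_subgroup_def)
  have "carrier sl2 \<subseteq> level (G \<inter> SL2) ((s + s) + (s + s))"
    using s lev by (intro sl2_from_brackets[OF _ odd] level_module SL2_subgroup_Int[OF sub] level_bracket[OF sub]) auto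
  moreover have eq: "4 * s = (s + s) + (s + s)" by simp
  ultimately show ?thesis using s unfolding eq by (intro ball_SL2_subset[OF G]) linarith+
qed

lemma scaled_sl2_directions_level:
  fixes G :: "'p::prime_card mat2 set"
  assumes odd: "odd CARD('p)" and s: "s > 0" and V: "scaled_sl2 s \<subseteq> directions G N s 1"
  shows "carrier sl2 \<subseteq> level (proj_SL2 G) (s + s)"
  using assms by (auto simp: scaled_sl2_eq intro!: directions_level[where k = 1])

lemma Theta_in_directions:
  fixes E :: "'p::prime_card mat2"
  assumes G: "subgroup G GL2" and odd: "odd CARD('p)"
    and E: "E \<in> carrier sl2" "mat_cong 1 (E ** E) 0" "CARD('p) \<ge> 5 \<or> mat_cong 1 E 0"
    and g: "g \<in> G" "Theta g \<in> nil_dirs E"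
  shows "Theta g \<in> directions G (nil_dirs E) s 1"
proof -
  have "\<exists>T u. mat T + (ell ^ s * u) *m Theta g \<in> proj_SL2 G \<and> T dvd 1 \<and> u dvd 1"
    by (rule tame_in_proj_SL2[OF G g(1) mat_plus_Theta[symmetric] nil_dirs_tame[OF E g(2)] _ two_unit[OF odd], of 0])
      simp_all
  moreover have "sl2_module (directions G (nil_dirs E) s 1)"
    by (rule directions_module[OF G nil_dirs_module nil_dirs_cong_closed _ nil_dirs_mult[OF E(2)]]) simp_all
  ultimately show ?thesis using directionsI[OF _ nil_dirs_module g(2)] by blast
qed

text \<open>Here the image in PGL_2(F_ell) is an ell-group, trivial if E vanishes modulo ell. Every
  \<open>Theta g\<close> is tame and so is itself a direction; the directions form an open module,
  which then contains the special Lie algebra.\<close>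

theorem ball_subset_nilpotent:
  fixes G :: "'p::prime_card mat2 set"
  assumes G: "closed_subgroup G GL2" and odd: "odd CARD('p)"
    and E: "E \<in> carrier sl2" "mat_cong 1 (E ** E) 0" "CARD('p) \<ge> 5 \<or> mat_cong 1 E 0"
    and nil: "\<And>g. g \<in> G \<Longrightarrow> Theta g \<in> nil_dirs E"
    and s: "s > 0" and L: "scaled_sl2 s \<subseteq> special_Lie G"
  shows "ball_SL2 (4 * s) \<subseteq> G"
proof (rule ball_SL2_subset_of_level[OF G odd s])
  have sub: "subgroup G GL2" using G by (simp add: closed_subgroup_def)
  have "sl2_module (directions G (nil_dirs E) s 1)"
    by (rule directions_module[OF sub nil_dirs_module nil_dirs_cong_closed _ nil_dirs_mult[OF E(2)]]) simp_all
  moreover have "cong_closed (s + 1) (directions G (nil_dirs E) s 1)"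
    by (rule directions_cong_closed[OF nil_dirs_cong_closed]) simp
  moreover have "Theta ` G \<subseteq> directions G (nil_dirs E) s 1"
    using Theta_in_directions[OF sub odd E _ nil] by blast
  ultimately have "special_Lie G \<subseteq> directions G (nil_dirs E) s 1" by (rule special_Lie_subset)
  with L show "carrier sl2 \<subseteq> level (proj_SL2 G) (s + s)"
    by (intro scaled_sl2_directions_level[OF odd s]) (rule subset_trans)
qed

section \<open>Conjugation and brackets; groups that are not unipotent modulo ell up to
  scalars\<close>

lemma det_mat_plus: "X \<in> carrier sl2 \<Longrightarrow> det (mat t + X) = t * t + det X"
  by (erule sl2_cases) (simp add: mat_mk2 algebra_simps)

text \<open>The adjugate of t + Y is t - Y, so the difference is the part odd in Y, which is linear.
  This turns stability under conjugation into stability under a bracket, provided 2t is a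
  unit.\<close>

lemma conj_diff_bracket:
  "(mat t + Y) ** Z ** adj2 (mat t + Y) - adj2 (mat t + Y) ** Z ** (mat t + Y) = (2 * t) *m (Y ** Z - Z ** Y)"
  if "Y \<in> carrier sl2" for Z :: "'p::prime_card mat2"
  using that by (elim sl2_cases) (cases Z rule: mk2_cases, simp add: mat_mk2 algebra_simps)

text \<open>The vector triple product for \<open>sl2\<close> with its trace form: modulo the line of
  Y, the square of ad Y is the scalar -4 det Y.\<close>

lemma double_bracket:
  "Y ** (Y ** Z - Z ** Y) - (Y ** Z - Z ** Y) ** Y = (- 4 * det Y) *m Z - (2 * trace (Y ** Z)) *m Y"
  if "Y \<in> carrier sl2" "Z \<in> carrier sl2" for Z :: "'p::prime_card mat2"
  using that by (elim sl2_cases) (simp add: algebra_simps)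

text \<open>In vector notation (Y x A) x (Y x B) is a multiple of Y. This recovers the direction of
  Y, which is orthogonal to everything in the image of ad Y.\<close>

lemma bracket_of_brackets:
  "(Y ** A - A ** Y) ** (Y ** B - B ** Y) - (Y ** B - B ** Y) ** (Y ** A - A ** Y)
    = (- 2 * trace (Y ** (A ** B - B ** A))) *m Y"
  if "Y \<in> carrier sl2" "A \<in> carrier sl2" "B \<in> carrier sl2" for A :: "'p::prime_card mat2"
  using that by (elim sl2_cases) (simp add: algebra_simps)

lemma conj_inverse_closed:
  assumes G: "subgroup G GL2" and V: "sl2_module V"
    and conj: "\<And>g X. g \<in> G \<Longrightarrow> X \<in> V \<Longrightarrow> g ** X ** adj2 g \<in> V" and g: "g \<in> G" and X: "X \<in> V"
  shows "adj2 g ** X ** g \<in> V"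
proof -
  obtain v where v: "v * det g = 1" using unit_inverse[OF GL2_subgroup_det[OF G g]] by blast
  have "(v *m adj2 g) ** X ** adj2 (v *m adj2 g) \<in> V" by (rule conj[OF GL2_subgroup_inv[OF G g v] X])
  then have "(v * v) *m (adj2 g ** X ** g) \<in> V" by (simp add: smat_simps)
  moreover have "v dvd 1" using v by (metis dvdI)
  then have "v * v dvd 1" by (intro unit_mult)
  ultimately show ?thesis using sl2_module_unit[OF V] by blast
qed

lemma bracket_closed:
  fixes V :: "'p::prime_card mat2 set"
  assumes G: "subgroup G GL2" and V: "sl2_module V" and odd: "odd CARD('p)"
    and conj: "\<And>g X. g \<in> G \<Longrightarrow> X \<in> V \<Longrightarrow> g ** X ** adj2 g \<in> V"
    and h: "h \<in> G" "halve (trace h) dvd 1" and X: "X \<in> V"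
  shows "Theta h ** X - X ** Theta h \<in> V"
proof -
  have "h ** X ** adj2 h - adj2 h ** X ** h \<in> V"
    by (intro sl2_moduleD(5)[OF V] conj[OF h(1) X] conj_inverse_closed[OF G V conj h(1) X])
  then have "(2 * halve (trace h)) *m (Theta h ** X - X ** Theta h) \<in> V"
    using conj_diff_bracket[OF Theta_sl2_odd[OF odd, of h], of "halve (trace h)" X]
    by (simp only: mat_plus_Theta)
  then show ?thesis
    by (rule sl2_module_unit[OF V, rotated]) (intro unit_mult two_unit[OF odd] h(2))
qed

text \<open>\<open>h\<close> does not preserve the kernel of \<open>Theta u\<close> modulo ell, so u
  and its conjugate by h have different directions. It is shown that \<open>Theta u\<close>,
  \<open>Theta h\<close> and their bracket lie in the level 2s and form a basis of
  \<open>sl2\<close>.\<close>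

theorem ball_subset_transvections:
  fixes G :: "'p::prime_card mat2 set"
  assumes G: "closed_subgroup G GL2" and p: "CARD('p) \<ge> 5" "odd CARD('p)"
    and u: "u \<in> G" "ell dvd det (Theta u)" and h: "h \<in> G" "\<not> ell dvd trace (Theta h ** Theta u)"
    and s: "s > 0"
  shows "ball_SL2 (4 * s) \<subseteq> G"
proof (rule ball_SL2_subset_of_level[OF G p(2) s], rule subsetI)
  have sub: "subgroup G GL2" using G by (simp add: closed_subgroup_def)
  define W where "W = level (proj_SL2 G) (s + s)"
  have W: "sl2_module W" unfolding W_def by (rule level_module[OF SL2_subgroup_proj[OF sub]]) (use s in simp)
  have conj: "g ** X ** adj2 g \<in> W" if "g \<in> G" "X \<in> W" for g X
    using level_conj(1)[OF sub _ that(1)] that(2) s by (simp add: W_def)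
  define E where "E = Theta u"
  define X where "X = Theta h"
  define t where "t = halve (trace h)"
  have sl: "E \<in> carrier sl2" "X \<in> carrier sl2" unfolding E_def X_def by (rule Theta_sl2_odd[OF p(2)])+
  have tau: "trace (X ** E) dvd 1" using h(2) by (simp add: adic_unit_iff E_def X_def)
  have tame: "tame E" using u(2) p(1) sl by (simp add: tame_def E_def)
  have EW: "E \<in> W"
  proof -
    \<comment> \<open>The power is ell^(2s) and not ell^s: E itself need not be divisible by ell, so
      the whole level must come from the power.\<close>
    obtain T w where *: "mat T + (ell ^ (s + s) * w) *m E \<in> proj_SL2 G" "T dvd 1" "w dvd 1"
      using tame_in_proj_SL2[OF sub u(1) mat_plus_Theta[symmetric] tame[unfolded E_def] _ two_unit[OF p(2)], of 0 "s + s"]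
      by (auto simp: E_def)
    obtain v where v: "v * T = 1" using unit_inverse[OF *(2)] by blast
    have eq: "mat T + (ell ^ (s + s) * w) *m E = T *m (mat 1 + ell ^ (s + s) *m ((v * w) *m E))"
      unfolding affine_eq_unit_smat[OF v] by (simp add: smat_simps ac_simps)
    have "(v * w) *m E \<in> W"
      unfolding W_def
      by (rule level_of_unit_multiple[OF *(1,2), of _ 1]) (use sl p(2) s eq in auto)
    moreover have "v * w dvd 1" using v *(3) by (intro unit_mult) (metis dvdI)
    ultimately show ?thesis using sl2_module_unit[OF W] by blast
  qed
  have tu: "halve (trace u) dvd 1"
  proof -
    have "det u = halve (trace u) * halve (trace u) + det E"
      using det_mat_plus[OF sl(1), of "halve (trace u)"] by (simp add: E_def mat_plus_Theta)
    then have "halve (trace u) * halve (trace u) dvd 1"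
      using u(2) by (intro unit_one_plus[OF _ GL2_subgroup_det[OF sub u(1)]]) (simp add: E_def)
    then show ?thesis by (rule dvd_mult_left)
  qed
  \<comment> \<open>The part of conjugation by h = t + X that is even in X. By X E + E X = tr(X E)
    it is a combination of E and X, and X has the unit coefficient -2 tr(X E).\<close>
  have "h ** E ** adj2 h + adj2 h ** E ** h \<in> W"
    by (intro sl2_moduleD(3)[OF W] conj[OF h(1) EW] conj_inverse_closed[OF sub W conj h(1) EW])
  moreover have "h ** E ** adj2 h + adj2 h ** E ** h
      = (2 * (t * t) - 2 * det X) *m E - (2 * trace (X ** E)) *m X"
  proof -
    have "h = mat t + X" by (simp add: t_def X_def mat_plus_Theta)
    then show ?thesis using sl by (elim sl2_cases) (simp add: mat_mk2 algebra_simps)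
  qed
  ultimately have "(2 * (t * t) - 2 * det X) *m E - (2 * trace (X ** E)) *m X \<in> W" by simp
  from sl2_moduleD(5)[OF W sl2_moduleD(4)[OF W EW, of "2 * (t * t) - 2 * det X"] this]
  have "(2 * trace (X ** E)) *m X \<in> W" by simp
  then have XW: "X \<in> W"
    by (rule sl2_module_unit[OF W, rotated]) (intro unit_mult two_unit[OF p(2)] tau)
  define C where "C = E ** X - X ** E"
  have CW: "C \<in> W"
    using bracket_closed[OF sub W p(2) conj u(1) tu XW] by (simp add: C_def E_def)
  have slC: "C \<in> carrier sl2" by (simp add: C_def)
  \<comment> \<open>The triple product of E, X and C, which is their determinant up to a constant
    factor. Modulo ell it is 2 tr(X E)^2, because det E vanishes there.\<close>
  have delta: "trace (E ** (X ** C - C ** X)) = 2 * trace (X ** E) ^ 2 - 8 * det E * det X"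
    unfolding C_def using sl by (elim sl2_cases) (simp add: power2_eq_square algebra_simps)
  have "trace (E ** (X ** C - C ** X)) dvd 1"
    using tau two_unit[OF p(2)] u(2) unfolding delta
    by (simp add: unit_iff_red E_def flip: red_eq_0_iff)
  moreover fix Z assume Z: "Z \<in> carrier (sl2 :: 'p mat2 monoid)"
  \<comment> \<open>Cramer's rule in the basis E, X, C, with triple products as
    determinants.\<close>
  have "trace (E ** (X ** C - C ** X)) *m Z
      = trace (Z ** (X ** C - C ** X)) *m E + (trace (Z ** (C ** E - E ** C)) *m X + trace (Z ** (E ** X - X ** E)) *m C)"
    using sl slC Z by (elim sl2_cases) (simp add: algebra_simps)
  then have "trace (E ** (X ** C - C ** X)) *m Z \<in> W"
    using sl2_moduleD(3,4)[OF W] EW XW CW by simp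
  ultimately show "Z \<in> level (proj_SL2 G) (s + s)" using sl2_module_unit[OF W] unfolding W_def by blast
qed

text \<open>Symmetrizing cancels the bracket of X and W, and X W + W X is scalar; what remains is
  linear in the trace-zero parts.\<close>

lemma two_Theta_sym:
  fixes A B :: "'p::prime_card mat2"
  assumes odd: "odd CARD('p)" and A: "A = mat r + X" and B: "B = mat u + W"
    and sl: "X \<in> carrier sl2" "W \<in> carrier sl2"
  shows "2 *m (Theta (A ** B) + Theta (B ** A)) = 2 *m 2 *m (r *m W + u *m X)"
  unfolding smat_add two_Theta[OF odd] unfolding A B
  using sl by (elim sl2_cases) (simp add: mat_mk2 algebra_simps)

text \<open>\<open>nil\<close> and \<open>comm\<close> say that modulo ell the elements with a
  repeated eigenvalue form the ell-part and that commutators fall into it. Only those elements yield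
  directions at once; for all others it is the bracket of \<open>Theta h\<close> with
  \<open>Theta g\<close> that is shown to be a direction. \<open>tr\<close> provides unit traces
  after multiplying a trace-zero g by h.\<close>

theorem ball_subset_split:
  fixes G :: "'p::prime_card mat2 set"
  assumes G: "closed_subgroup G GL2" and odd: "odd CARD('p)"
    and E: "E \<in> carrier sl2" "mat_cong 1 (E ** E) 0" "CARD('p) \<ge> 5 \<or> mat_cong 1 E 0"
    and nil: "\<And>g. g \<in> G \<Longrightarrow> ell dvd det (Theta g) \<Longrightarrow> Theta g \<in> nil_dirs E"
    and conj: "\<And>g. g \<in> G \<Longrightarrow> g ** E ** adj2 g \<in> nil_dirs E"
    and h: "h \<in> G" "\<not> ell dvd trace h" "\<not> ell dvd det (Theta h)"
    and comm: "\<And>A B. A \<in> G \<Longrightarrow> B \<in> G \<Longrightarrow> ell dvd det (Theta (A ** B ** adj2 A ** adj2 B))"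
    and tr: "\<And>g. g \<in> G \<Longrightarrow> ell dvd trace g \<Longrightarrow> \<not> ell dvd trace (Theta h ** Theta g)"
    and s: "s > 0" and L: "scaled_sl2 s \<subseteq> special_Lie G"
  shows "ball_SL2 (4 * s) \<subseteq> G"
proof -
  have sub: "subgroup G GL2" using G by (simp add: closed_subgroup_def)
  note two = two_unit[OF odd]
  have half: "2 * halve (trace g) = trace g" for g :: "'p mat2" by (intro two_halve) (use odd in simp)
  have half_unit: "halve (trace g) dvd 1" if "\<not> ell dvd trace g" for g :: "'p mat2"
    using that half[of g] two by (metis adic_unit_iff ell_dvd_mult_iff)
  note dirs = directions_module[OF sub nil_dirs_module nil_dirs_cong_closed _ nil_dirs_mult[OF E(2)]]
  define V where "V = directions G (nil_dirs E) s 1"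
  have V: "sl2_module V" unfolding V_def by (rule dirs) simp_all
  have Vcong: "cong_closed (s + 1) V"
    unfolding V_def by (rule directions_cong_closed[OF nil_dirs_cong_closed]) simp
  have nil_conj: "g ** X ** adj2 g \<in> nil_dirs E" if g: "g \<in> G" and X: "X \<in> nil_dirs E" for g X
  proof -
    obtain c where c: "X \<in> carrier sl2" "mat_cong 1 X (c *m E)" using X by (auto simp: nil_dirs_def)
    have "mat_cong 1 (g ** (c *m E) ** adj2 g) (g ** X ** adj2 g)"
      by (intro mat_cong_mult mat_cong_refl mat_cong_sym[OF c(2)])
    moreover have "g ** (c *m E) ** adj2 g \<in> nil_dirs E"
      using sl2_moduleD(4)[OF nil_dirs_module conj[OF g], of c] by (simp add: smat_simps)
    ultimately show ?thesis
      using nil_dirs_cong_closed c(1) sl2_conj(1) unfolding cong_closed_def by blast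
  qed
  have Vconj: "g ** X ** adj2 g \<in> V" if "g \<in> G" "X \<in> V" for g X
    unfolding V_def
    by (rule directions_conj[OF sub nil_dirs_module nil_dirs_cong_closed _ nil_dirs_mult[OF E(2)] that(1) nil_conj[OF that(1)]])
      (use that in \<open>simp_all add: V_def\<close>)
  have Vnil: "Theta g \<in> V" if "g \<in> G" "ell dvd det (Theta g)" for g
    unfolding V_def by (rule Theta_in_directions[OF sub odd E that(1) nil[OF that]])
  define Y where "Y = Theta h"
  have slY: "Y \<in> carrier sl2" unfolding Y_def by (rule Theta_sl2_odd[OF odd])
  have inv: "\<exists>v. v dvd 1 \<and> v *m adj2 g \<in> G" if "g \<in> G" for g
    using unit_inverse[OF GL2_subgroup_det[OF sub that]] GL2_subgroup_inv[OF sub that] by (metis dvdI)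
  have adj_conj: "adj2 h ** Z ** h - det h *m Z \<in> W"
    if "sl2_module W" "w dvd 1" "(w *m adj2 h) ** Z ** adj2 (w *m adj2 h) - det (w *m adj2 h) *m Z \<in> W" for W Z w
  proof (rule sl2_module_unit[OF that(1) unit_mult[OF that(2,2)]])
    show "(w * w) *m (adj2 h ** Z ** h - det h *m Z) \<in> W" using that(3) by (simp add: smat_simps det_smat smat_diff)
  qed
  have Vcomm: "Theta (A ** B ** adj2 A ** adj2 B) \<in> V" if A: "A \<in> G" and B: "B \<in> G" for A B
  proof -
    obtain v w where vw: "v dvd 1" "w dvd 1" "v *m adj2 A \<in> G" "w *m adj2 B \<in> G"
      using inv[OF A] inv[OF B] by blast
    have "A ** B ** (v *m adj2 A) ** (w *m adj2 B) \<in> G"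
      by (intro GL2_subgroup_mult[OF sub] A B vw)
    then have "(v * w) *m (A ** B ** adj2 A ** adj2 B) \<in> G" by (simp add: smat_simps mult.commute)
    then have "Theta ((v * w) *m (A ** B ** adj2 A ** adj2 B)) \<in> V"
      using comm[OF A B] by (intro Vnil) (simp_all add: Theta_smat[OF odd] det_smat)
    then have "(v * w) *m Theta (A ** B ** adj2 A ** adj2 B) \<in> V" by (simp add: Theta_smat[OF odd])
    then show ?thesis by (rule sl2_module_unit[OF V unit_mult[OF vw(1,2)]])
  qed
  have Vad: "Y ** Theta g - Theta g ** Y \<in> V" if g: "g \<in> G" and t: "\<not> ell dvd trace g" for g
  proof -
    have sl: "Theta g \<in> carrier sl2" by (rule Theta_sl2_odd[OF odd])
    obtain v where v: "v dvd 1" "v *m adj2 g \<in> G" using inv[OF g] by blast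
    let ?t = "halve (trace g)"
    \<comment> \<open>In other words Ad k - 1 maps \<open>Theta g\<close> into V. With A = k g
      adj(k) and B = adj(g), both A B and B A are commutators up to unit scalars, and their
      symmetrized \<open>Theta\<close> is this difference times 2 tr(g)/2, a unit by
      \<open>t\<close>.\<close>
    have key: "k ** Theta g ** adj2 k - det k *m Theta g \<in> V" if k: "k \<in> G" for k
    proof -
      define A where "A = k ** g ** adj2 k"
      have A: "A = mat (det k * ?t) + k ** Theta g ** adj2 k"
      proof -
        have "k ** (mat ?t + Theta g) ** adj2 k = mat (det k * ?t) + k ** Theta g ** adj2 k"
          by (cases k rule: mk2_cases; cases "Theta g" rule: mk2_cases) (simp add: mat_mk2 algebra_simps)
        then show ?thesis by (simp add: A_def mat_plus_Theta)
      qed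
      have B: "adj2 g = mat ?t + - Theta g"
        using sl mat_plus_Theta[of g] by (elim sl2_cases) (simp add: mat_mk2, metis mk2_simps(1,6) minus_zero add.inverse_inverse add_0 mat_mk2)
      have "Theta ((v *m adj2 g) ** k ** adj2 (v *m adj2 g) ** adj2 k) \<in> V" by (rule Vcomm[OF v(2) k])
      then have "(v * v) *m Theta (adj2 g ** A) \<in> V"
        by (simp add: A_def smat_simps Theta_smat[OF odd] matrix_mul_assoc)
      then have "Theta (adj2 g ** A) \<in> V" by (rule sl2_module_unit[OF V unit_mult[OF v(1) v(1)]])
      moreover have "Theta (A ** adj2 g) \<in> V" using Vcomm[OF k g] by (simp add: A_def)
      ultimately have "2 *m (Theta (A ** adj2 g) + Theta (adj2 g ** A)) \<in> V"
        by (intro sl2_moduleD(3,4)[OF V])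
      then have "2 *m 2 *m ((det k * ?t) *m (- Theta g) + ?t *m (k ** Theta g ** adj2 k)) \<in> V"
        using two_Theta_sym[OF odd A B] sl by simp
      moreover have "2 *m 2 *m ((det k * ?t) *m (- Theta g) + ?t *m (k ** Theta g ** adj2 k))
          = (2 * 2 * ?t) *m (k ** Theta g ** adj2 k - det k *m Theta g)"
        by (cases "k ** Theta g ** adj2 k" rule: mk2_cases; cases "Theta g" rule: mk2_cases) (simp add: algebra_simps)
      moreover have "2 * 2 * ?t dvd 1" by (intro unit_mult two half_unit t)
      ultimately show ?thesis using sl2_module_unit[OF V] by metis
    qed
    obtain w where w: "w dvd 1" "w *m adj2 h \<in> G" using inv[OF h(1)] by blast
    from sl2_moduleD(5)[OF V key[OF h(1)] adj_conj[OF V w(1) key[OF w(2)]]]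
    have "h ** Theta g ** adj2 h - adj2 h ** Theta g ** h \<in> V" by simp
    then have "(2 * halve (trace h)) *m (Y ** Theta g - Theta g ** Y) \<in> V"
      using conj_diff_bracket[OF slY, of "halve (trace h)" "Theta g"] by (simp add: Y_def mat_plus_Theta)
    then show ?thesis
      by (rule sl2_module_unit[OF V, rotated]) (intro unit_mult two half_unit h(2))
  qed
  \<comment> \<open>For trace-zero g, the traces of h g and adj(h) g are tr(Y Theta g) and its
    negative modulo ell, hence units by \<open>tr\<close>. Since h + adj(h) = tr(h), the brackets
    obtained from both add up to a unit multiple of the one for g.\<close>
  have Vad: "Y ** Theta g - Theta g ** Y \<in> V" if g: "g \<in> G" for g
  proof (cases "ell dvd trace g")
    case False
    with g show ?thesis by (rule Vad)
  next
    case True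
    obtain w where w: "w dvd 1" "w *m adj2 h \<in> G" using inv[OF h(1)] by blast
    have red0: "red (trace g) = 0" using True by (simp add: red_eq_0_iff)
    have trY: "red (trace (Y ** Theta g)) \<noteq> 0" using tr[OF g True] by (simp add: Y_def red_eq_0_iff)
    have hY: "h = mat (halve (trace h)) + Y" by (simp add: Y_def mat_plus_Theta)
    have gY: "g = mat (halve (trace g)) + Theta g" by (simp add: mat_plus_Theta)
    have sl: "Theta g \<in> carrier sl2" by (rule Theta_sl2_odd[OF odd])
    have red0': "red (halve (trace g)) = 0"
      using red0 half[of g] two red_mult[of 2 "halve (trace g)"] by (simp add: unit_iff_red)
    have tr1: "trace (h ** g) = 2 * halve (trace h) * halve (trace g) + trace (Y ** Theta g)"
      and tr2: "trace (adj2 h ** g) = 2 * halve (trace h) * halve (trace g) - trace (Y ** Theta g)"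
    proof -
      have "trace ((mat t + Y) ** (mat r + Theta g)) = 2 * t * r + trace (Y ** Theta g)"
        "trace (adj2 (mat t + Y) ** (mat r + Theta g)) = 2 * t * r - trace (Y ** Theta g)" for t r
        using slY sl by (elim sl2_cases; simp add: mat_mk2 algebra_simps)+
      from this[of "halve (trace h)" "halve (trace g)"]
      show "trace (h ** g) = 2 * halve (trace h) * halve (trace g) + trace (Y ** Theta g)"
        "trace (adj2 h ** g) = 2 * halve (trace h) * halve (trace g) - trace (Y ** Theta g)"
        by (simp_all add: Y_def mat_plus_Theta)
    qed
    have "Y ** Theta (h ** g) - Theta (h ** g) ** Y \<in> V"
      using trY red0' by (intro Vad GL2_subgroup_mult[OF sub h(1) g]) (simp add: tr1 flip: red_eq_0_iff)
    moreover have "Y ** Theta ((w *m adj2 h) ** g) - Theta ((w *m adj2 h) ** g) ** Y \<in> V"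
      using trY red0' w(1)
      by (intro Vad GL2_subgroup_mult[OF sub w(2) g])
        (simp add: tr2 smat_simps unit_iff_red flip: red_eq_0_iff)
    then have "w *m (Y ** Theta (adj2 h ** g) - Theta (adj2 h ** g) ** Y) \<in> V"
      by (simp add: smat_simps Theta_smat[OF odd] smat_diff)
    then have "Y ** Theta (adj2 h ** g) - Theta (adj2 h ** g) ** Y \<in> V"
      by (rule sl2_module_unit[OF V w(1)])
    ultimately have "2 *m (Y ** Theta (h ** g) - Theta (h ** g) ** Y
        + (Y ** Theta (adj2 h ** g) - Theta (adj2 h ** g) ** Y)) \<in> V"
      by (intro sl2_moduleD(3,4)[OF V])
    moreover have "2 *m (Y ** Theta (h ** g) - Theta (h ** g) ** Y
        + (Y ** Theta (adj2 h ** g) - Theta (adj2 h ** g) ** Y))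
      = (2 * (2 * halve (trace h))) *m (Y ** Theta g - Theta g ** Y)"
    proof -
      have lin: "2 *m (Y ** A - A ** Y + (Y ** B - B ** Y)) = Y ** (2 *m A + 2 *m B) - (2 *m A + 2 *m B) ** Y" for A B :: "'p mat2"
        by (cases Y rule: mk2_cases; cases A rule: mk2_cases; cases B rule: mk2_cases) (simp add: algebra_simps)
      have "2 *m ((mat t + Y) ** g) - mat (trace ((mat t + Y) ** g)) + (2 *m (adj2 (mat t + Y) ** g) - mat (trace (adj2 (mat t + Y) ** g)))
          = (2 * t) *m (2 *m g - mat (trace g))" for t
        using slY by (elim sl2_cases; cases g rule: mk2_cases) (simp add: mat_mk2 algebra_simps)
      from this[of "halve (trace h)", folded hY]
      have "2 *m Theta (h ** g) + 2 *m Theta (adj2 h ** g) = (2 * halve (trace h)) *m 2 *m Theta g"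
        by (simp only: two_Theta[OF odd])
      then show ?thesis unfolding lin by (simp add: smat_simps smat_diff ac_simps)
    qed
    ultimately have "(2 * (2 * halve (trace h))) *m (Y ** Theta g - Theta g ** Y) \<in> V" by simp
    then show ?thesis
      by (rule sl2_module_unit[OF V, rotated]) (intro unit_mult two half_unit h(2))
  qed
  \<comment> \<open>The preimage of V under ad Y is an open module containing all
    \<open>Theta g\<close>, so it contains the special Lie algebra, even though
    \<open>Theta g\<close> need not lie in V.\<close>
  define W where "W = {X \<in> carrier sl2. Y ** X - X ** Y \<in> V}"
  have Wcong: "cong_closed (s + 1) W"
    unfolding cong_closed_def W_def
  proof safe
    fix X Z assume *: "Y ** X - X ** Y \<in> V" "mat_cong (s + 1) X Z"
    have "mat_cong (s + 1) (Y ** X - X ** Y) (Y ** Z - Z ** Y)"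
      by (intro mat_cong_diff mat_cong_mult mat_cong_refl *(2))
    then show "Y ** Z - Z ** Y \<in> V" using Vcong *(1) sl2_bracket unfolding cong_closed_def by blast
  qed
  have "sl2_module W"
  proof (rule sl2_moduleI[OF _ _ _ Wcong])
    have "Y ** 0 - 0 ** Y = 0" by (cases Y rule: mk2_cases) (simp add: zero_mk2)
    then show "0 \<in> W" using sl2_moduleD(2)[OF V] by (simp add: W_def)
    fix X Z assume *: "X \<in> W" "Z \<in> W"
    have "Y ** (X + Z) - (X + Z) ** Y = (Y ** X - X ** Y) + (Y ** Z - Z ** Y)"
      by (cases Y rule: mk2_cases; cases X rule: mk2_cases; cases Z rule: mk2_cases) (simp add: algebra_simps)
    then show "X + Z \<in> W" using * sl2_moduleD(3)[OF V] by (simp add: W_def)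
  qed (auto simp: W_def)
  moreover have "Theta ` G \<subseteq> W" using Vad Theta_sl2_odd[OF odd] by (auto simp: W_def)
  ultimately have "special_Lie G \<subseteq> W" using Wcong special_Lie_subset by blast
  then have LW: "ell ^ s *m Z \<in> W" if "Z \<in> carrier sl2" for Z
    using L that by (auto simp: scaled_sl2_eq)
  have P: "Y ** Z - Z ** Y \<in> level (proj_SL2 G) (s + s)" if Z: "Z \<in> carrier sl2" for Z
  proof -
    have "ell ^ s *m (Y ** Z - Z ** Y) \<in> V" using LW[OF Z] by (simp add: W_def smat_simps smat_diff)
    then show ?thesis using odd s by (intro directions_level[where k = 1]) (auto simp: V_def)
  qed
  have Q: "sl2_module (level (G \<inter> SL2) j)" if "j \<ge> 1" for j
    by (rule level_module[OF SL2_subgroup_Int[OF sub] that])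
  \<comment> \<open>A second ad Y leads from \<open>proj_SL2 G\<close> to \<open>G\<close> at the
    same level, since h is not close to the identity.\<close>
  have PQ: "Y ** Z - Z ** Y \<in> level (G \<inter> SL2) (s + s)" if Z: "Z \<in> level (proj_SL2 G) (s + s)" for Z
  proof -
    have s1: "s + s \<ge> 1" using s by simp
    obtain w where w: "w dvd 1" "w *m adj2 h \<in> G" using inv[OF h(1)] by blast
    from sl2_moduleD(5)[OF Q[OF s1] level_conj(2)[OF sub Z h(1) s1]
      adj_conj[OF Q[OF s1] w(1) level_conj(2)[OF sub Z w(2) s1]]]
    have "h ** Z ** adj2 h - adj2 h ** Z ** h \<in> level (G \<inter> SL2) (s + s)" by simp
    then have "(2 * halve (trace h)) *m (Y ** Z - Z ** Y) \<in> level (G \<inter> SL2) (s + s)"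
      using conj_diff_bracket[OF slY, of "halve (trace h)" Z] by (simp add: Y_def mat_plus_Theta)
    then show ?thesis
      by (rule sl2_module_unit[OF Q[OF s1], rotated]) (intro unit_mult two half_unit h(2))
  qed
  define K where "K = level (G \<inter> SL2) ((s + s) + (s + s))"
  have K: "sl2_module K" unfolding K_def by (rule Q) (use s in simp)
  \<comment> \<open>These elements already occur at level 2s and are carried up to 4s, where the
    multiples of Y below live.\<close>
  have dbl: "(- 4 * det Y) *m Z - (2 * trace (Y ** Z)) *m Y \<in> K" if Z: "Z \<in> carrier sl2" for Z
    using PQ[OF P[OF Z]] level_mono[OF SL2_subgroup_Int[OF sub], of "s + s" "(s + s) + (s + s)"] s
    unfolding double_bracket[OF slY Z] K_def by auto
  have br: "(2 * trace (Y ** (A ** B - B ** A))) *m Y \<in> K" if A: "A \<in> carrier sl2" and B: "B \<in> carrier sl2" for A B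
  proof -
    have "(- 2 * trace (Y ** (A ** B - B ** A))) *m Y \<in> K"
      using level_bracket[OF sub P[OF A] P[OF B]] s
      unfolding bracket_of_brackets[OF slY A B] K_def by simp
    from sl2_moduleD(4)[OF K this, of "-1"] show ?thesis by (simp add: smat_simps)
  qed
  obtain a b c where abc: "Y = mk2 a b c (- a)" using slY by (rule sl2_cases)
  have YK: "Y \<in> K"
  proof -
    \<comment> \<open>For these A, B the coefficients 2 tr(Y [A, B]) are 4a and 4c. Combined with a
      and b they give 4 (a^2 + b c) = -4 det Y, a unit.\<close>
    have "(4 * a) *m Y \<in> K" "(4 * c) *m Y \<in> K"
      using br[of "mk2 0 1 0 0" "mk2 0 0 1 0"] br[of "mk2 1 0 0 (-1)" "mk2 0 1 0 0"]
      by (simp_all add: abc)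
    from sl2_moduleD(3)[OF K sl2_moduleD(4)[OF K this(1), of a] sl2_moduleD(4)[OF K this(2), of b]]
    have "(- (2 * 2 * det Y)) *m Y \<in> K" by (simp add: abc algebra_simps)
    moreover have "- (2 * 2 * det Y) dvd 1"
      using unit_mult[OF unit_mult[OF two two], of "det Y"] h(3) by (simp add: adic_unit_iff Y_def)
    ultimately show ?thesis using sl2_module_unit[OF K] by blast
  qed
  have "carrier sl2 \<subseteq> K"
  proof
    fix Z :: "'p mat2" assume Z: "Z \<in> carrier sl2"
    from sl2_moduleD(3)[OF K dbl[OF Z] sl2_moduleD(4)[OF K YK, of "2 * trace (Y ** Z)"]]
    have "(- 4 * det Y) *m Z \<in> K" by simp
    moreover have "- 4 * det Y dvd 1"
      using unit_mult[OF unit_mult[OF two two], of "det Y"] h(3) by (simp add: adic_unit_iff Y_def)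
    ultimately show "Z \<in> K" using sl2_module_unit[OF K] by blast
  qed
  moreover have eq: "4 * s = (s + s) + (s + s)" by simp
  ultimately show ?thesis
    using s unfolding K_def eq by (intro ball_SL2_subset[OF G]) linarith+
qed

text \<open>Modulo 2 all brackets in \<open>sl2\<close> are scalar, so with n = 2s they fill only
  the diagonal part at level 2n. The off-diagonal part comes one level later, from commutators of a
  diagonal matrix with elementary matrices.\<close>

theorem ball_subset_two:
  fixes G :: "'p::prime_card mat2 set"
  assumes G: "closed_subgroup G GL2" and p: "CARD('p) = 2"
    and G4: "\<And>g. g \<in> G \<Longrightarrow> mat_cong 2 g (mat 1)"
    and s: "s > 0" and L: "scaled_sl2 s \<subseteq> special_Lie G"
  shows "ball_SL2 (6 * s) \<subseteq> G"
proof -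
  have sub: "subgroup G GL2" using G by (simp add: closed_subgroup_def)
  have two: "(2 :: 'p adic_int) = ell" by (rule two_eq_ell[OF p])
  define N where "N = (nil_dirs 0 :: 'p mat2 set)"
  have N_iff: "X \<in> N \<longleftrightarrow> X \<in> carrier sl2 \<and> mat_cong 1 X 0" for X
    unfolding N_def nil_dirs_def by (cases X rule: mk2_cases) (simp add: zero_mk2)
  have N: "sl2_module N" "cong_closed 1 N"
    unfolding N_def by (rule nil_dirs_module nil_dirs_cong_closed)+
  \<comment> \<open>Products of even matrices vanish modulo 4. This provides the k = 2 that fixing
    the scalar up to sign requires for ell = 2.\<close>
  have NN: "mat_cong 2 (X ** Z) 0" if "X \<in> N" "Z \<in> N" for X Z
  proof -
    have "\<exists>R. A = ell *m R" if "A \<in> N" for A using that unfolding N_iff mat_cong_iff by simp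
    with that obtain R S where "X = ell *m R" "Z = ell *m S" by meson
    then have "X ** Z = ell ^ 2 *m (R ** S)" by (simp add: smat_simps power2_eq_square)
    then show ?thesis unfolding mat_cong_iff by auto
  qed
  define V where "V = directions G N s 2"
  have V: "sl2_module V" unfolding V_def by (rule directions_module[OF sub N _ NN]) simp_all
  have Vcong: "cong_closed (s + 2) V" unfolding V_def by (rule directions_cong_closed[OF N(2)]) simp
  have Theta_N: "Theta g \<in> N" if g: "g \<in> G" for g
  proof -
    obtain a b c d where abcd: "g = mk2 a b c d" by (rule mk2_cases)
    have dvd: "ell ^ 2 dvd a - 1" "ell ^ 2 dvd b" "ell ^ 2 dvd c" "ell ^ 2 dvd d - 1"
      using G4[OF g] by (simp_all add: abcd mat_mk2)
    have ell2: "ell dvd x" if "ell ^ 2 dvd x" for x :: "'p adic_int"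
      using that by (metis dvd_mult_left power2_eq_square)
    have "mat_cong 1 g (mat 1)" by (rule mat_cong_mono[OF G4[OF g]]) simp
    then have sl: "Theta g \<in> carrier sl2" using p by (intro Theta_in_sl2) simp
    have "ell dvd (a - 1) + (d - 1) + ell" using ell2[OF dvd(1)] ell2[OF dvd(4)] by (intro dvd_add) auto
    then have "2 dvd a + d" by (simp flip: two)
    then have half: "2 * halve (a + d) = a + d" by (intro two_halve) simp
    \<comment> \<open>The diagonal entries of \<open>Theta g\<close> are (a - d)/2 and its negative,
      and a - d is divisible by 4: congruence to 1 modulo 4 is just enough to make
      \<open>Theta g\<close> even.\<close>
    have "ell * (a - halve (a + d)) = 2 * a - 2 * halve (a + d)" by (simp only: two right_diff_distrib)
    also have "\<dots> = (a - 1) - (d - 1)" unfolding half by simp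
    finally have "ell ^ (1 + 1) dvd ell ^ 1 * (a - halve (a + d))"
      using dvd_diff[OF dvd(1,4)] by (simp only: power_one_right one_add_one)
    then have "ell dvd a - halve (a + d)" unfolding ell_power_dvd_cancel by simp
    moreover have "ell * (d - halve (a + d)) = 2 * d - 2 * halve (a + d)" by (simp only: two right_diff_distrib)
    moreover have "2 * d - 2 * halve (a + d) = (d - 1) - (a - 1)" unfolding half by simp
    ultimately have "ell ^ (1 + 1) dvd ell ^ 1 * (d - halve (a + d))"
      using dvd_diff[OF dvd(4,1)] by (simp only: power_one_right one_add_one)
    then have "ell dvd d - halve (a + d)" unfolding ell_power_dvd_cancel by simp
    with \<open>ell dvd a - halve (a + d)\<close> have "mat_cong 1 (Theta g) 0"
      using dvd(2,3) ell2 by (simp add: Theta_def abcd mk2_const)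
    with sl show ?thesis by (simp add: N_iff)
  qed
  have "Theta g \<in> V" if g: "g \<in> G" for g
  proof -
    have sl: "Theta g \<in> carrier sl2" "mat_cong 1 (Theta g) 0" using Theta_N[OF g] by (simp_all add: N_iff)
    then obtain R where "Theta g = ell *m R" by (auto simp: mat_cong_iff)
    then have "tame (Theta g)" using sl(1) by (simp add: tame_def det_smat power2_eq_square)
    then have "\<exists>T u. mat T + (ell ^ s * u) *m Theta g \<in> proj_SL2 G \<and> T dvd 1 \<and> u dvd 1"
      by (rule tame_in_proj_SL2[OF sub g mat_plus_Theta[symmetric], of 1 1]) (use two s in simp_all)
    then show ?thesis using directionsI[OF V[unfolded V_def] N(1) Theta_N[OF g]] unfolding V_def by blast
  qed
  then have "special_Lie G \<subseteq> V" using special_Lie_subset[OF V Vcong] by blast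
  with L have LV: "ell ^ s *m Z \<in> directions G N s 2" if "Z \<in> carrier sl2" for Z
    using that by (auto simp: scaled_sl2_eq V_def)
  define n where "n = s + s"
  have n2: "n \<ge> 2" using s by (simp add: n_def)
  have "Z \<in> level (proj_SL2 G) n" if "Z \<in> carrier sl2" for Z
    unfolding n_def using LV[OF that] that p s by (intro directions_level[where k = 2]) auto
  then have P: "level (proj_SL2 G) j = carrier sl2" if "j \<ge> n" for j
    using level_mono[OF SL2_subgroup_proj[OF sub] n2 that] by (auto simp: level_def)
  have approx: "\<exists>p\<in>proj_SL2 G. mat_cong (n + i) p A" if "A \<in> ball_SL2 n" for A i
    by (rule SL2_ball_approx[OF SL2_subgroup_proj[OF sub] P _ that]) (use n2 in auto)
  \<comment> \<open>All levels of \<open>proj_SL2 G\<close> from n on are full, so A and B can be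
    approximated there modulo 2^(2n+2); the commutator of the approximations lies in
    \<open>G\<close>.\<close>
  have comm: "\<exists>k\<in>G \<inter> SL2. mat_cong (Suc (2 * n + 1)) k (A ** B ** adj2 A ** adj2 B)"
    if AB: "A \<in> ball_SL2 n" "B \<in> ball_SL2 n" for A B
  proof -
    obtain p q where *: "p \<in> proj_SL2 G" "q \<in> proj_SL2 G"
      "mat_cong (n + (n + 2)) p A" "mat_cong (n + (n + 2)) q B"
      using approx[OF AB(1), of "n + 2"] approx[OF AB(2), of "n + 2"] by blast
    have "Suc (2 * n + 1) = n + (n + 2)" by simp
    moreover have "mat_cong (n + (n + 2)) (p ** q ** adj2 p ** adj2 q) (A ** B ** adj2 A ** adj2 B)"
      by (intro mat_cong_mult mat_cong_adj2 *)
    ultimately show ?thesis using proj_SL2_commutator[OF sub *(1,2)] by metis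
  qed
  define a where "a = 1 + (ell :: 'p adic_int) ^ n"
  have "a dvd 1" by (rule unit_one_plus[of _ 1]) (use n2 in \<open>auto simp: a_def\<close>)
  then obtain b where b: "b * a = 1" using unit_inverse by blast
  have dvdb: "ell ^ n dvd b - 1"
  proof -
    have "b - 1 = - (ell ^ n * b)" using b by (simp add: a_def algebra_simps)
    then show ?thesis by simp
  qed
  have ab: "a * b = 1" using b by (simp add: mult.commute)
  define e where "e = (1 + (ell :: 'p adic_int) ^ (n - 1))"
  \<comment> \<open>For a = 1 + 2^n, a^2 - 1 = 2^(n+1) (1 + 2^(n-1)): the factor 2 in the middle
    term is the extra level, and n \<ge> 2 makes the cofactor \<open>e\<close> odd.\<close>
  have aa: "ell ^ n * (a * a) - ell ^ n = ell ^ (2 * n + 1) * e"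
  proof -
    have "ell ^ n = ell * (ell :: 'p adic_int) ^ (n - 1)" using n2 by (cases n) simp_all
    then have "a * a - 1 = ell ^ n * ell * e" unfolding a_def e_def two[symmetric] by (simp add: algebra_simps)
    moreover have "(ell :: 'p adic_int) ^ (2 * n + 1) = ell ^ n * ell ^ n * ell" by (simp add: mult_2 power_add)
    ultimately have "ell ^ n * (a * a - 1) = ell ^ (2 * n + 1) * e" by (simp only: ac_simps)
    then show ?thesis by (simp add: algebra_simps)
  qed
  have e: "ell dvd e - 1" using n2 by (simp add: e_def)
  have cong_e: "ell ^ Suc (2 * n + 1) dvd ell ^ (2 * n + 1) * e - ell ^ (2 * n + 1)"
    using ell_power_dvd_cancel[of "2 * n + 1" 1 "e - 1"] e by (simp add: right_diff_distrib)
  have EQ: "mk2 0 1 0 0 \<in> level (G \<inter> SL2) (2 * n + 1)"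
  proof -
    have "mk2 a 0 0 b \<in> ball_SL2 n" "mk2 1 (ell ^ n) 0 1 \<in> ball_SL2 n"
      using ab dvdb by (simp_all add: ball_SL2_def SL2_iff mat_mk2 a_def)
    from comm[OF this] obtain k where k: "k \<in> G \<inter> SL2"
      "mat_cong (Suc (2 * n + 1)) k (mk2 a 0 0 b ** mk2 1 (ell ^ n) 0 1 ** adj2 (mk2 a 0 0 b) ** adj2 (mk2 1 (ell ^ n) 0 1))"
      by blast
    have "mk2 a 0 0 b ** mk2 1 (ell ^ n) 0 1 ** adj2 (mk2 a 0 0 b) ** adj2 (mk2 1 (ell ^ n) 0 1)
        = mk2 1 (ell ^ n * (a * a) - ell ^ n) 0 1"
      using ab b by (simp add: algebra_simps)
    with k(2) have "mat_cong (Suc (2 * n + 1)) k (mk2 1 (ell ^ (2 * n + 1) * e) 0 1)" by (simp only: aa)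
    also have "mat_cong (Suc (2 * n + 1)) (mk2 1 (ell ^ (2 * n + 1) * e) 0 1) (mat 1 + ell ^ (2 * n + 1) *m mk2 0 1 0 0)"
      using cong_e by (simp add: mat_mk2)
    finally show ?thesis using k(1) by (intro levelI) auto
  qed
  have FQ: "mk2 0 0 1 0 \<in> level (G \<inter> SL2) (2 * n + 1)"
  proof -
    have "mk2 b 0 0 a \<in> ball_SL2 n" "mk2 1 0 (ell ^ n) 1 \<in> ball_SL2 n"
      using b dvdb by (simp_all add: ball_SL2_def SL2_iff mat_mk2 a_def)
    from comm[OF this] obtain k where k: "k \<in> G \<inter> SL2"
      "mat_cong (Suc (2 * n + 1)) k (mk2 b 0 0 a ** mk2 1 0 (ell ^ n) 1 ** adj2 (mk2 b 0 0 a) ** adj2 (mk2 1 0 (ell ^ n) 1))"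
      by blast
    have "mk2 b 0 0 a ** mk2 1 0 (ell ^ n) 1 ** adj2 (mk2 b 0 0 a) ** adj2 (mk2 1 0 (ell ^ n) 1)
        = mk2 1 0 (ell ^ n * (a * a) - ell ^ n) 1"
      using ab b by (simp add: algebra_simps)
    with k(2) have "mat_cong (Suc (2 * n + 1)) k (mk2 1 0 (ell ^ (2 * n + 1) * e) 1)" by (simp only: aa)
    also have "mat_cong (Suc (2 * n + 1)) (mk2 1 0 (ell ^ (2 * n + 1) * e) 1) (mat 1 + ell ^ (2 * n + 1) *m mk2 0 0 1 0)"
      using cong_e by (simp add: mat_mk2)
    finally show ?thesis using k(1) by (intro levelI) auto
  qed
  have HQ: "mk2 1 0 0 (-1) \<in> level (G \<inter> SL2) (2 * n + 1)"
  proof -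
    have "mk2 0 1 0 0 ** mk2 0 0 1 0 - mk2 0 0 1 0 ** mk2 0 1 0 0 \<in> level (G \<inter> SL2) (n + n)"
      by (rule level_bracket[OF sub]) (use n2 P[of n] in auto)
    then show ?thesis using level_mono[OF SL2_subgroup_Int[OF sub], of "n + n" "2 * n + 1"] n2 by auto
  qed
  have K: "sl2_module (level (G \<inter> SL2) (2 * n + 1))" by (rule level_module[OF SL2_subgroup_Int[OF sub]]) simp
  have "carrier sl2 \<subseteq> level (G \<inter> SL2) (2 * n + 1)"
  proof
    fix Z :: "'p mat2" assume "Z \<in> carrier sl2"
    then obtain a b c where Z: "Z = mk2 a b c (- a)" by (rule sl2_cases)
    have "a *m mk2 1 0 0 (-1) + (b *m mk2 0 1 0 0 + c *m mk2 0 0 1 0) \<in> level (G \<inter> SL2) (2 * n + 1)"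
      by (intro sl2_moduleD(3,4)[OF K] EQ FQ HQ)
    then show "Z \<in> level (G \<inter> SL2) (2 * n + 1)" by (simp add: Z)
  qed
  moreover have "2 * n + 1 \<le> 6 * s" using s by (simp add: n_def)
  ultimately have "carrier sl2 \<subseteq> level (G \<inter> SL2) (6 * s)"
    using level_mono[OF SL2_subgroup_Int[OF sub], of "2 * n + 1" "6 * s"] n2 by auto
  then show ?thesis by (rule ball_SL2_subset[OF G, rotated]) (use s in simp)
qed

subsection \<open>The class equation\<close>

lemma inverse_nat_cases:
  assumes "m \<ge> (2 :: nat)"
  shows "1 / real m = 1/2 \<or> 1 / real m = 1/3 \<or> 1 / real m = 1/4 \<or> 1 / real m = 1/5 \<or> 1 / real m \<le> 1/6"
proof -
  consider "m = 2" | "m = 3" | "m = 4" | "m = 5" | "m \<ge> 6" using assms by linarith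
  then show ?thesis by cases (auto simp: field_simps)
qed

text \<open>The orbits of a finite subgroup of \<open>PGL2\<close> on the set of its nontrivial cyclic stabilizers
  satisfy this equation, where \<open>n\<close> is the order of the group, \<open>m\<close> the order of a stabilizer and
  \<open>e\<close> its index in its normalizer. The solutions with \<open>n > 24\<close> are the cyclic, dihedral and
  icosahedral ones.\<close>

lemma orbit_equation_bound:
  fixes n :: real and m :: "'a \<Rightarrow> nat" and e :: "'a \<Rightarrow> nat"
  assumes fin: "finite Q" and m: "\<And>X. X \<in> Q \<Longrightarrow> m X \<ge> 2" and e: "\<And>X. X \<in> Q \<Longrightarrow> e X = 1 \<or> e X = 2"
    and n: "n > 24" and eq: "(\<Sum>X\<in>Q. (1 - 1 / real (m X)) / real (e X)) = 1 - 1 / n"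
  shows "\<exists>X\<in>Q. n \<le> 12 * real (m X)"
proof (rule ccontr)
  assume "\<not> ?thesis"
  then have big: "n > 12 * real (m X)" if "X \<in> Q" for X using that by force
  define y where "y = 1 / n"
  have y: "y > 0" "y < 1/24" using n by (auto simp: y_def field_simps)
  define v where "v X = 1 / real (m X)" for X
  define w where "w X = (1 - v X) / real (e X)" for X
  have x: "v X = 1/2 \<or> v X = 1/3 \<or> v X = 1/4 \<or> v X = 1/5 \<or> v X \<le> 1/6" if "X \<in> Q" for X
    unfolding v_def by (rule inverse_nat_cases[OF m[OF that]])
  have xy: "y < v X / 12" if "X \<in> Q" for X
    using big[OF that] m[OF that] n by (simp add: y_def v_def field_simps)
  have w: "w X = 1 - v X \<or> 2 * w X = 1 - v X" if "X \<in> Q" for X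
    using e[OF that] by (auto simp: w_def)
  have half: "v X \<le> 1/2" if "X \<in> Q" for X using x[OF that] by linarith
  have w4: "w X \<ge> 1/4" if "X \<in> Q" for X
    using w[OF that] half[OF that] by (elim disjE) linarith+
  have sum: "(\<Sum>X\<in>Q. w X) = 1 - y" using eq by (simp add: w_def v_def y_def)
  \<comment> \<open>Every term is at least 1/4 and the sum is below 1, so there are at most three
    orbits.\<close>
  have "real (card Q) * (1/4) \<le> (\<Sum>X\<in>Q. w X)"
    using sum_bounded_below[of Q "1/4" w] w4 by simp
  then have "card Q < 4" using sum y by linarith
  then consider "card Q = 0" | "card Q = 1" | "card Q = 2" | "card Q = 3" by linarith
  then show False
  proof cases
    case 1
    then show False using fin sum y by simp
  next
    case 2
    then obtain A where Q: "Q = {A}" by (auto simp: card_1_singleton_iff)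
    then have A: "A \<in> Q" "w A = 1 - y" using sum by auto
    show False using A(2) w[OF A(1)] xy[OF A(1)] y half[OF A(1)] by (elim disjE) linarith+
  next
    case 3
    then obtain A B where Q: "Q = {A, B}" "A \<noteq> B" by (auto simp: card_2_iff)
    have *: "w A + w B = 1 - y" using sum Q by simp
    have AB: "A \<in> Q" "B \<in> Q" using Q by auto
    \<comment> \<open>The equation reads v X + v Y / 2 = 1/2 + y. Its solutions are v X = 1/2, y = v
      Y / 2 (dihedral) and v X = 1/3, v Y = 1/2, y = 1/12 (tetrahedral); the bounds on y exclude
      both.\<close>
    have mixed: False if "w X = 1 - v X" "2 * w Y = 1 - v Y" "X \<in> Q" "Y \<in> Q" "w X + w Y = 1 - y" for X Y
    proof -
      have "v X < 1/2" using that xy[OF that(4)] half[OF that(3)] half[OF that(4)] x[OF that(3)] y by linarith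
      then have "v X \<le> 1/3" using x[OF that(3)] by linarith
      then have "v Y > 1/3" using that y by linarith
      then have "v Y = 1/2" using x[OF that(4)] by linarith
      then have "v X > 1/4" "v X < 7/24" using that y by linarith+
      then show False using x[OF that(3)] by linarith
    qed
    have "w A = 1 - v A \<and> w B = 1 - v B \<or> 2 * w A = 1 - v A \<and> 2 * w B = 1 - v B"
      using w[OF AB(1)] w[OF AB(2)] mixed[of A B] mixed[of B A] * AB by (auto simp: add.commute)
    then show False using * xy[OF AB(1)] half[OF AB(1)] half[OF AB(2)] y xy[OF AB(2)] by (elim disjE conjE) linarith+
  next
    case 4
    then obtain A B C where Q: "Q = {A, B, C}" "A \<noteq> B" "B \<noteq> C" "A \<noteq> C" by (auto simp: card_3_iff)
    have *: "w A + w B + w C = 1 - y" using sum Q by simp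
    have ABC: "A \<in> Q" "B \<in> Q" "C \<in> Q" using Q by auto
    have w2: "2 * w X = 1 - v X" if "X \<in> Q" for X
    proof (rule ccontr)
      assume "2 * w X \<noteq> 1 - v X"
      then have "w X \<ge> 1/2" using w[OF that] half[OF that] by auto
      moreover have "X = A \<or> X = B \<or> X = C" using that Q by simp
      ultimately show False using * w4[OF ABC(1)] w4[OF ABC(2)] w4[OF ABC(3)] y by (elim disjE) auto
    qed
    have "v A + v B + v C = 1 + 2 * y"
      using * w2[OF ABC(1)] w2[OF ABC(2)] w2[OF ABC(3)] by linarith
    \<comment> \<open>The candidates are (1/2, 1/2, v) with y = v/2 (dihedral) and (1/2, 1/3, v)
      with v = 1/3, 1/4, 1/5 and n = 12, 24, 60. The bound n > 24 removes 12 and 24, and 60 = 12 * 5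
      is removed by n > 12 m.\<close>
    moreover have sorted: False
      if "X \<in> Q" "Y \<in> Q" "W \<in> Q" "v X + v Y + v W = 1 + 2 * y" "v X \<ge> v Y" "v Y \<ge> v W" for X Y W
    proof -
      have "v X = 1/2" using x[OF that(1)] that(4-6) y by linarith
      moreover from this have "v Y = 1/2 \<or> v Y = 1/3" using x[OF that(2)] that(4-6) y by linarith
      moreover have "v W = 1/2 \<or> v W = 1/3 \<or> v W = 1/4 \<or> v W = 1/5 \<or> v W \<le> 1/6" by (rule x[OF that(3)])
      ultimately show False using that(4-6) xy[OF that(1)] xy[OF that(2)] xy[OF that(3)] y by (elim disjE) linarith+
    qed
    ultimately show False
      using ABC by (cases "v A \<le> v B"; cases "v B \<le> v C"; cases "v A \<le> v C")
        (auto dest: sorted[of A B C] sorted[of A C B] sorted[of B A C] sorted[of B C A] sorted[of C A B] sorted[of C B A])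
  qed
qed

lemma card_constant_fibers:
  assumes fin: "finite A" and fib: "\<And>y. y \<in> f ` A \<Longrightarrow> card {x \<in> A. f x = y} = n"
  shows "card A = card (f ` A) * n"
proof -
  have "card A = (\<Sum>y\<in>f ` A. \<Sum>x\<in>{x \<in> A. f x = y}. 1)"
    using sum.image_gen[OF fin, of "\<lambda>_. 1 :: nat" f] by simp
  also have "\<dots> = (\<Sum>y\<in>f ` A. n)" by (rule sum.cong) (simp_all add: fib)
  finally show ?thesis by simp
qed

section \<open>Conjugation, centralizers and the count of noncentral elements in a finite
  group\<close>

context group
begin

definition conjg :: "'a \<Rightarrow> 'a \<Rightarrow> 'a" where "conjg k g = k \<otimes> g \<otimes> inv k"

definition commutes :: "'a \<Rightarrow> 'a \<Rightarrow> bool" where "commutes a b \<longleftrightarrow> a \<otimes> b = b \<otimes> a"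

definition centralizer :: "'a \<Rightarrow> 'a set" where "centralizer g = {k \<in> carrier G. commutes k g}"

lemma conjg_closed [simp]: "k \<in> carrier G \<Longrightarrow> g \<in> carrier G \<Longrightarrow> conjg k g \<in> carrier G"
  by (simp add: conjg_def)

lemma inv_mult_cancel: "k \<in> carrier G \<Longrightarrow> x \<in> carrier G \<Longrightarrow> inv k \<otimes> (k \<otimes> x) = x"
  and mult_inv_cancel: "k \<in> carrier G \<Longrightarrow> x \<in> carrier G \<Longrightarrow> k \<otimes> (inv k \<otimes> x) = x"
  by (simp_all flip: m_assoc)

lemma conjg_mult: "k \<in> carrier G \<Longrightarrow> a \<in> carrier G \<Longrightarrow> b \<in> carrier G \<Longrightarrow> conjg k (a \<otimes> b) = conjg k a \<otimes> conjg k b"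
  by (simp add: conjg_def m_assoc inv_mult_cancel)

lemma conjg_conjg: "k \<in> carrier G \<Longrightarrow> l \<in> carrier G \<Longrightarrow> g \<in> carrier G \<Longrightarrow> conjg k (conjg l g) = conjg (k \<otimes> l) g"
  by (simp add: conjg_def m_assoc inv_mult_group)

lemma conjg_one [simp]: "g \<in> carrier G \<Longrightarrow> conjg \<one> g = g"
  by (simp add: conjg_def)

lemma conjg_inv: "k \<in> carrier G \<Longrightarrow> g \<in> carrier G \<Longrightarrow> conjg (inv k) (conjg k g) = g"
  and conjg_inv': "k \<in> carrier G \<Longrightarrow> g \<in> carrier G \<Longrightarrow> conjg k (conjg (inv k) g) = g"
  by (simp_all add: conjg_conjg)

lemma conjg_eq_iff: "k \<in> carrier G \<Longrightarrow> a \<in> carrier G \<Longrightarrow> b \<in> carrier G \<Longrightarrow> conjg k a = conjg k b \<longleftrightarrow> a = b"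
  by (metis conjg_inv)

lemma commutes_conjg: "k \<in> carrier G \<Longrightarrow> a \<in> carrier G \<Longrightarrow> b \<in> carrier G \<Longrightarrow> commutes (conjg k a) (conjg k b) \<longleftrightarrow> commutes a b"
  by (simp add: commutes_def conjg_eq_iff flip: conjg_mult)

lemma commutes_sym: "commutes a b \<Longrightarrow> commutes b a"
  by (simp add: commutes_def)

lemma commutes_iff_conjg: "k \<in> carrier G \<Longrightarrow> g \<in> carrier G \<Longrightarrow> commutes k g \<longleftrightarrow> conjg k g = g"
  unfolding commutes_def conjg_def using inv_solve_right[of g "k \<otimes> g" k] by auto

lemma subgroup_centralizer: "g \<in> carrier G \<Longrightarrow> subgroup (centralizer g) G"
proof (rule subgroupI)
  assume g: "g \<in> carrier G"
  have iff: "k \<in> centralizer g \<longleftrightarrow> k \<in> carrier G \<and> conjg k g = g" for k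
    using commutes_iff_conjg[OF _ g] by (auto simp: centralizer_def)
  show "centralizer g \<subseteq> carrier G" by (auto simp: centralizer_def)
  have "\<one> \<in> centralizer g" using g by (simp add: iff)
  then show "centralizer g \<noteq> {}" by blast
  fix a b assume a: "a \<in> centralizer g" and b: "b \<in> centralizer g"
  show "inv a \<in> centralizer g" using a g conjg_inv[of a g] by (simp add: iff)
  show "a \<otimes> b \<in> centralizer g" using a b g conjg_conjg[of a b g] by (simp add: iff)
qed

lemma card_subgroup_dvd:
  assumes "finite (carrier G)" "subgroup H G" "subgroup K G" "K \<subseteq> H"
  shows "card K dvd card H"
proof -
  interpret H: group "G\<lparr>carrier := H\<rparr>" by (rule subgroup.subgroup_is_group[OF assms(2) group_axioms])
  have "subgroup K (G\<lparr>carrier := H\<rparr>)" by (rule subgroup_incl[OF assms(3,2,4)])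
  from H.lagrange[OF this] have "card (rcosets\<^bsub>G\<lparr>carrier := H\<rparr>\<^esub> K) * card K = card H" by (simp add: order_def)
  then show ?thesis by (metis dvd_triv_right)
qed

text \<open>Off \<open>Z\<close> commuting is an equivalence relation, so the sets
  \<open>centralizer g - Z\<close> partition the noncentral elements and are permuted by
  conjugation; counting orbit by orbit gives the orbit equation. \<open>Z\<close> is not divided
  out: n and m are the orders of the group and of a centralizer divided by that of \<open>Z\<close>,
  and e is the index of a centralizer in its normalizer.\<close>

lemma class_equation_bound:
  assumes fin: "finite (carrier G)" and Z: "subgroup Z G"
    and central: "\<And>z g. z \<in> Z \<Longrightarrow> g \<in> carrier G \<Longrightarrow> commutes z g"
    and trans: "\<And>a b c. a \<in> carrier G - Z \<Longrightarrow> b \<in> carrier G - Z \<Longrightarrow> c \<in> carrier G - Z \<Longrightarrow>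
      commutes a b \<Longrightarrow> commutes b c \<Longrightarrow> commutes a c"
    and norm: "\<And>g. g \<in> carrier G - Z \<Longrightarrow>
      card {conjg k g | k. k \<in> carrier G \<and> commutes (conjg k g) g} \<le> 2"
  shows "card (carrier G) \<le> 24 * card Z
    \<or> (\<exists>g\<in>carrier G - Z. card (carrier G) \<le> 12 * card (centralizer g))"
proof (rule ccontr)
  assume contra: "\<not> ?thesis"
  define a where "a = card (carrier G)"
  define z where "z = card Z"
  define c where "c g = card (centralizer g)" for g
  define N where "N g = {k \<in> carrier G. commutes (conjg k g) g}" for g
  have ZG: "Z \<subseteq> carrier G" using Z subgroup.subset by blast
  have z0: "z > 0" unfolding z_def using finite_subset[OF ZG fin] subgroup.one_closed[OF Z] by (auto simp: card_gt_0_iff)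
  have az: "a > 24 * z" and ac: "\<And>g. g \<in> carrier G - Z \<Longrightarrow> a > 12 * c g"
    using contra by (auto simp: a_def z_def c_def not_le)
  have conjZ: "conjg k x \<in> Z \<longleftrightarrow> x \<in> Z" if "k \<in> carrier G" "x \<in> carrier G" for k x
  proof
    have conj_id: "conjg l y = y" if "l \<in> carrier G" "y \<in> Z" for l y
      using commutes_sym[OF central[OF that(2,1)]] that ZG commutes_iff_conjg[of l y] by auto
    show "x \<in> Z \<Longrightarrow> conjg k x \<in> Z" using conj_id that by simp
    show "conjg k x \<in> Z \<Longrightarrow> x \<in> Z" using conj_id[of "inv k" "conjg k x"] conjg_inv[OF that] that by simp
  qed
  have ZC: "Z \<subseteq> centralizer g" if "g \<in> carrier G" for g
    using central ZG that by (auto simp: centralizer_def)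
  have finC: "finite (centralizer g)" for g using fin by (auto simp: centralizer_def)
  \<comment> \<open>By \<open>trans\<close>, \<open>N g\<close> is the normalizer of the centralizer
    of g. It consists of cosets of that centralizer, one for each conjugate of g that commutes with
    g.\<close>
  have Nc: "\<exists>e. card (N g) = e * c g \<and> (e = 1 \<or> e = 2)" if g: "g \<in> carrier G - Z" for g
  proof -
    have gG: "g \<in> carrier G" using g by simp
    have "card (N g) = card ((\<lambda>k. conjg k g) ` N g) * c g"
    proof (rule card_constant_fibers)
      show "finite (N g)" using fin by (simp add: N_def)
      fix y assume "y \<in> (\<lambda>k. conjg k g) ` N g"
      then obtain k0 where k0: "k0 \<in> carrier G" "commutes (conjg k0 g) g" "y = conjg k0 g" by (auto simp: N_def)
      have "{x \<in> N g. conjg x g = y} = (\<lambda>x. k0 \<otimes> x) ` centralizer g"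
      proof safe
        fix x assume x: "x \<in> N g" "y = conjg x g"
        then have xG: "x \<in> carrier G" by (simp add: N_def)
        have "conjg (inv k0 \<otimes> x) g = g"
          using conjg_conjg[of "inv k0" x g] conjg_inv[of k0 g] k0(1) xG gG
          unfolding x(2)[symmetric] k0(3)[symmetric] by simp
        then have "inv k0 \<otimes> x \<in> centralizer g"
          using k0 xG gG by (simp add: centralizer_def commutes_iff_conjg)
        moreover have "x = k0 \<otimes> (inv k0 \<otimes> x)" using k0 xG by (simp add: mult_inv_cancel)
        ultimately show "x \<in> (\<lambda>x. k0 \<otimes> x) ` centralizer g" by blast
      next
        fix x assume "x \<in> centralizer g"
        then have x: "x \<in> carrier G" "conjg x g = g" using gG by (auto simp: centralizer_def commutes_iff_conjg)
        then have "conjg (k0 \<otimes> x) g = conjg k0 g" using k0 gG by (simp flip: conjg_conjg)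
        then show "conjg (k0 \<otimes> x) g = y" "k0 \<otimes> x \<in> N g" using k0 x by (simp_all add: N_def)
      qed
      moreover have "inj_on (\<lambda>x. k0 \<otimes> x) (centralizer g)"
        using k0 by (auto simp: inj_on_def centralizer_def)
      ultimately show "card {x \<in> N g. conjg x g = y} = c g" by (simp add: card_image c_def)
    qed
    moreover have "(\<lambda>k. conjg k g) ` N g = {conjg k g | k. k \<in> carrier G \<and> commutes (conjg k g) g}"
      by (auto simp: N_def)
    moreover have "\<one> \<in> N g" using gG by (simp add: N_def commutes_def)
    then have "card ((\<lambda>k. conjg k g) ` N g) > 0" using fin by (auto simp: card_gt_0_iff N_def)
    ultimately show ?thesis using norm[OF g]
      by (intro exI[of _ "card ((\<lambda>k. conjg k g) ` N g)"]) auto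
  qed
  define S where "S = carrier G - Z"
  define r where "r = {(g, x) \<in> S \<times> S. \<exists>k\<in>carrier G. commutes (conjg k g) x}"
  have eqv: "equiv S r"
  proof (rule equivI)
    show "r \<subseteq> S \<times> S" by (auto simp: r_def)
    show "refl_on S r"
      by (rule refl_onI) (auto simp: r_def S_def commutes_def intro!: bexI[of _ \<one>])
    show "sym r"
    proof (rule symI)
      fix g x assume "(g, x) \<in> r"
      then obtain k where k: "g \<in> S" "x \<in> S" "k \<in> carrier G" "commutes (conjg k g) x" by (auto simp: r_def)
      then have "commutes g (conjg (inv k) x)"
        using commutes_conjg[of "inv k" "conjg k g" x] conjg_inv[of k g] by (auto simp: S_def)
      then have "commutes (conjg (inv k) x) g" by (rule commutes_sym)
      then show "(x, g) \<in> r" using k by (auto simp: r_def)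
    qed
    show "trans r"
    proof (rule transI)
      fix g x y assume "(g, x) \<in> r" "(x, y) \<in> r"
      then obtain k l where k: "g \<in> S" "x \<in> S" "y \<in> S" "k \<in> carrier G" "l \<in> carrier G"
        "commutes (conjg k g) x" "commutes (conjg l x) y" by (auto simp: r_def)
      then have *: "commutes (conjg l (conjg k g)) (conjg l x)"
        by (simp add: commutes_conjg S_def)
      have "commutes (conjg l (conjg k g)) y"
        by (rule trans[OF _ _ _ * k(7)]) (use k in \<open>auto simp: S_def conjZ\<close>)
      then have "commutes (conjg (l \<otimes> k) g) y" using k by (simp add: S_def conjg_conjg)
      then show "(g, y) \<in> r" using k by (auto simp: r_def)
    qed
  qed
  \<comment> \<open>Double counting of pairs (k, y) with y in the block of g: each element of the
    class is the conjugate of y by k for exactly \<open>card (N g)\<close> pairs.\<close>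
  have card_class: "card (r `` {g}) * card (N g) = a * (c g - z)" if g: "g \<in> S" for g
  proof -
    have gG: "g \<in> carrier G" "g \<notin> Z" using g by (auto simp: S_def)
    let ?A = "carrier G \<times> (centralizer g - Z)"
    let ?f = "\<lambda>(k, y). conjg k y"
    have img: "?f ` ?A = r `` {g}"
    proof (intro equalityI subsetI)
      fix x assume "x \<in> ?f ` ?A"
      then obtain k y where x: "x = conjg k y" and *: "k \<in> carrier G" "y \<in> centralizer g" "y \<notin> Z"
        by (elim imageE SigmaE) simp
      then have "commutes g y" by (simp add: centralizer_def commutes_def)
      with * gG have "commutes (conjg k g) (conjg k y)" by (simp add: centralizer_def commutes_conjg)
      moreover have "conjg k y \<in> S" using * by (simp add: S_def centralizer_def conjZ)
      ultimately show "x \<in> r `` {g}" using *(1) g by (simp add: r_def x) (rule bexI[of _ k])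
    next
      fix x assume "x \<in> r `` {g}"
      then obtain k where k: "x \<in> S" "k \<in> carrier G" "commutes (conjg k g) x" by (auto simp: r_def)
      then have xG: "x \<in> carrier G" "x \<notin> Z" by (auto simp: S_def)
      have "commutes (conjg (inv k) (conjg k g)) (conjg (inv k) x)"
        using k xG gG by (simp add: commutes_conjg)
      then have "commutes g (conjg (inv k) x)" using k gG by (simp add: conjg_inv)
      then have "commutes (conjg (inv k) x) g" by (rule commutes_sym)
      then have "conjg (inv k) x \<in> centralizer g - Z"
        using k xG gG by (simp add: centralizer_def conjZ)
      moreover have "x = ?f (k, conjg (inv k) x)" using k xG by (simp add: conjg_inv')
      ultimately show "x \<in> ?f ` ?A" using k(2) by (intro image_eqI[of _ _ "(k, conjg (inv k) x)"]) simp_all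
    qed
    have "card ?A = card (?f ` ?A) * card (N g)"
    proof (rule card_constant_fibers)
      show "finite ?A" using fin finC by simp
      fix x assume "x \<in> ?f ` ?A"
      then obtain k0 y0 where k0': "k0 \<in> carrier G" "y0 \<in> centralizer g - Z" "x = conjg k0 y0"
        by (elim imageE SigmaE) simp
      then have k0: "k0 \<in> carrier G" "y0 \<in> carrier G" "y0 \<notin> Z" "commutes y0 g" "x = conjg k0 y0"
        by (simp_all add: centralizer_def)
      have "{p \<in> ?A. ?f p = x} = (\<lambda>m. (k0 \<otimes> m, conjg (inv m) y0)) ` N g" (is "?L = ?R")
      proof (intro equalityI subsetI)
        fix p assume "p \<in> ?L"
        then obtain k y where p': "p = (k, y)" "k \<in> carrier G" "y \<in> centralizer g - Z" "conjg k y = x"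
          by (cases p) simp
        then have p: "p = (k, y)" "k \<in> carrier G" "y \<in> carrier G" "y \<notin> Z" "commutes y g" "conjg k y = x"
          by (simp_all add: centralizer_def)
        define m where "m = inv k0 \<otimes> k"
        have m: "m \<in> carrier G" "k = k0 \<otimes> m" using p k0 by (auto simp: m_def mult_inv_cancel)
        have "conjg k0 (conjg m y) = conjg k0 y0" using p k0 m by (simp add: conjg_conjg)
        then have my: "conjg m y = y0" using p k0 m by (simp add: conjg_eq_iff)
        have *: "commutes (conjg m g) y0"
          using commutes_conjg[OF m(1) p(3) gG(1)] p(5) unfolding my by (simp add: commutes_def)
        have "commutes (conjg m g) g"
          by (rule trans[OF _ _ _ * k0(4)]) (use k0 m gG in \<open>auto simp: conjZ\<close>)
        then have "m \<in> N g" using m by (simp add: N_def)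
        moreover have "conjg (inv m) y0 = y" using conjg_inv[OF m(1) p(3)] my by simp
        then have "p = (k0 \<otimes> m, conjg (inv m) y0)" by (simp only: p(1) m(2))
        ultimately show "p \<in> ?R" by (rule rev_image_eqI)
      next
        fix p assume "p \<in> ?R"
        then obtain m where m: "m \<in> carrier G" "commutes (conjg m g) g" "p = (k0 \<otimes> m, conjg (inv m) y0)"
          by (auto simp: N_def)
        have "commutes y0 (conjg m g)"
          by (rule trans[OF _ _ _ k0(4) commutes_sym[OF m(2)]]) (use k0 m gG in \<open>auto simp: conjZ\<close>)
        then have "commutes (conjg (inv m) y0) g"
          using commutes_conjg[of "inv m" y0 "conjg m g"] k0 m gG by (simp add: conjg_inv)
        moreover have "conjg (k0 \<otimes> m) (conjg (inv m) y0) = x"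
          using k0 m by (simp add: conjg_inv' flip: conjg_conjg)
        moreover have "conjg (inv m) y0 \<notin> Z" using k0 m by (simp add: conjZ)
        ultimately show "p \<in> ?L" using k0(1,2) m(1) by (simp add: m(3) centralizer_def)
      qed
      moreover have "inj_on (\<lambda>m. (k0 \<otimes> m, conjg (inv m) y0)) (N g)"
        using k0 by (auto simp: inj_on_def N_def)
      ultimately show "card {p \<in> ?A. ?f p = x} = card (N g)" by (simp add: card_image)
    qed
    moreover have "card (centralizer g - Z) = c g - z"
      unfolding c_def z_def using ZC[OF gG(1)] by (intro card_Diff_subset finite_subset[OF ZG fin])
    ultimately show ?thesis by (simp add: card_cartesian_product img a_def)
  qed
  have cz: "\<exists>m. c g = z * m \<and> m \<ge> 2" if g: "g \<in> S" for g
  proof -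
    have gG: "g \<in> carrier G" "g \<notin> Z" using g by (auto simp: S_def)
    have "z dvd c g" unfolding z_def c_def
      by (rule card_subgroup_dvd[OF fin subgroup_centralizer[OF gG(1)] Z ZC[OF gG(1)]])
    then obtain m where m: "c g = z * m" by (elim dvdE)
    have "Z \<subset> centralizer g" using ZC[OF gG(1)] gG by (auto simp: centralizer_def commutes_def)
    then have "z < c g" unfolding z_def c_def by (rule psubset_card_mono[OF finC])
    then have "m \<ge> 2" using m by (cases m; cases "m - 1") auto
    with m show ?thesis by blast
  qed
  define Q where "Q = S // r"
  have finS: "finite S" using fin by (simp add: S_def)
  have finQ: "finite Q" unfolding Q_def by (rule finite_quotient[OF finS]) (use eqv in \<open>auto simp: equiv_def\<close>)
  have "\<forall>X\<in>Q. \<exists>g. g \<in> S \<and> X = r `` {g}" unfolding Q_def by (auto elim: quotientE)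
  from bchoice[OF this] obtain rep where rep: "\<And>X. X \<in> Q \<Longrightarrow> rep X \<in> S" "\<And>X. X \<in> Q \<Longrightarrow> X = r `` {rep X}" by blast
  have "\<forall>X\<in>Q. \<exists>m. c (rep X) = z * m \<and> m \<ge> 2" using cz rep(1) by blast
  from bchoice[OF this] obtain m where m: "\<And>X. X \<in> Q \<Longrightarrow> c (rep X) = z * m X" "\<And>X. X \<in> Q \<Longrightarrow> m X \<ge> 2" by blast
  have "\<forall>X\<in>Q. \<exists>e. card (N (rep X)) = e * c (rep X) \<and> (e = 1 \<or> e = 2)" using Nc rep(1) by (auto simp: S_def)
  from bchoice[OF this] obtain e where e: "\<And>X. X \<in> Q \<Longrightarrow> card (N (rep X)) = e X * c (rep X)"
    "\<And>X. X \<in> Q \<Longrightarrow> e X = 1 \<or> e X = 2" by blast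
  have a0: "real a > 0" using az by simp
  have cardX: "real (card X) = real a * ((1 - 1 / real (m X)) / real (e X))" if X: "X \<in> Q" for X
  proof -
    have "card X * (e X * (z * m X)) = a * (z * m X - z)"
      using card_class[OF rep(1)[OF X]] rep(2)[OF X] e(1)[OF X] m(1)[OF X] by simp
    also have "z * m X - z = z * (m X - 1)" by (simp add: diff_mult_distrib2)
    finally have "z * (card X * (e X * m X)) = z * (a * (m X - 1))" by (simp add: ac_simps)
    then have "card X * (e X * m X) = a * (m X - 1)" using z0 by simp
    from arg_cong[OF this, of real]
    have "real (card X) * (real (e X) * real (m X)) = real a * (real (m X) - 1)"
      using m(2)[OF X] by (simp add: of_nat_diff)
    moreover have pos: "real (e X) > 0" "real (m X) > 0" using m(2)[OF X] e(2)[OF X] by auto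
    ultimately have "real (card X) = real a * (real (m X) - 1) / (real (e X) * real (m X))"
      by (simp add: eq_divide_eq)
    moreover have "(1 - 1 / real (m X)) / real (e X) = (real (m X) - 1) / (real (e X) * real (m X))"
      using pos by (simp add: field_simps)
    ultimately show ?thesis by simp
  qed
  have "card S = (\<Sum>X\<in>Q. card X)"
  proof -
    have "card (\<Union>Q) = (\<Sum>X\<in>Q. card X)"
      by (rule card_Union_disjoint)
        (use quotient_disj[OF eqv] finite_subset[OF _ finS] in_quotient_imp_subset[OF eqv] in
          \<open>auto simp: Q_def pairwise_def disjnt_def\<close>)
    then show ?thesis using Union_quotient[OF eqv] by (simp add: Q_def)
  qed
  then have "real (card S) = (\<Sum>X\<in>Q. real a * ((1 - 1 / real (m X)) / real (e X)))"
    by (simp only: of_nat_sum cardX cong: sum.cong)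
  moreover have "card S = a - z"
    unfolding S_def a_def z_def by (rule card_Diff_subset[OF finite_subset[OF ZG fin] ZG])
  then have "real (card S) = real a - real z" using az by (simp add: of_nat_diff)
  ultimately have "real a - real z = real a * (\<Sum>X\<in>Q. (1 - 1 / real (m X)) / real (e X))"
    by (simp only: sum_distrib_left)
  then have "(\<Sum>X\<in>Q. (1 - 1 / real (m X)) / real (e X)) = (real a - real z) / real a"
    using a0 by (simp only: eq_divide_eq mult.commute) simp
  also have "\<dots> = 1 - 1 / (real a / real z)" using a0 by (simp add: diff_divide_distrib)
  finally have eq: "(\<Sum>X\<in>Q. (1 - 1 / real (m X)) / real (e X)) = 1 - 1 / (real a / real z)" .
  have "real a / real z > 24" using az z0 by (simp add: field_simps flip: of_nat_mult)
  from orbit_equation_bound[OF finQ m(2) e(2) this eq] obtain X where X: "X \<in> Q" "real a / real z \<le> 12 * real (m X)" by blast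
  then have "real a \<le> real (12 * c (rep X))" using m(1)[OF X(1)] z0 by (simp add: field_simps)
  then have "a \<le> 12 * c (rep X)" by (simp only: of_nat_le_iff)
  then show False using ac[of "rep X"] rep(1)[OF X(1)] by (simp add: S_def)
qed

end

subsection \<open>Two by two matrices over a field\<close>

text \<open>For odd ell this is twice \<open>Theta\<close>, written without halving so that it also
  makes sense over the residue field.\<close>

definition trace_free :: "'a::comm_ring_1 ^ 2 ^ 2 \<Rightarrow> 'a ^ 2 ^ 2" where
  "trace_free g = 2 *m g - mat (trace g)"

text \<open>The negative of the discriminant of the characteristic polynomial; its vanishing detects
  a repeated eigenvalue.\<close>

lemma det_trace_free: "det (trace_free g) = 4 * det g - trace g * trace g"
  by (cases g rule: mk2_cases) (simp add: trace_free_def mat_mk2 algebra_simps)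

text \<open>A nonscalar matrix of size 2 is cyclic, so its centralizer is spanned by 1 and itself.
  The cases follow the entry that witnesses that g is not scalar and determines the
  coefficient.\<close>

lemma commutes_nonscalar:
  fixes g :: "'a::field ^ 2 ^ 2"
  assumes g: "\<And>c. g \<noteq> mat c" and comm: "k ** g = g ** k"
  shows "\<exists>\<alpha> \<beta>. k = mat \<alpha> + \<beta> *m g"
proof -
  obtain a b c d where G: "g = mk2 a b c d" by (rule mk2_cases)
  obtain e f i j where K: "k = mk2 e f i j" by (rule mk2_cases)
  have "mk2 (e * a + f * c) (e * b + f * d) (i * a + j * c) (i * b + j * d)
      = mk2 (a * e + b * i) (a * f + b * j) (c * e + d * i) (c * f + d * j)"
    using comm by (simp only: G K mk2_simps)
  then have eqs0: "e * a + f * c = a * e + b * i" "e * b + f * d = a * f + b * j" "i * a + j * c = c * e + d * i"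
    by (simp_all only: mk2_eq_iff)
  have eqs: "b * i = f * c" using eqs0(1) by (simp only: mult.commute[of e a] add_left_cancel)
  consider "b \<noteq> 0" | "c \<noteq> 0" | "b = 0" "c = 0" "a \<noteq> d"
    using g[of a] by (auto simp: G mat_mk2)
  then show ?thesis
  proof cases
    case 1
    define m where "m = f / b"
    have f: "f = m * b" using 1 by (simp add: m_def)
    have "b * i = b * (m * c)" unfolding eqs by (simp add: f)
    then have i: "i = m * c" using 1 by (simp only: mult_cancel_left simp_thms)
    have "b * j = (e * b + f * d) - a * f" unfolding eqs0(2) by simp
    also have "\<dots> = b * (e - m * a + m * d)" by (simp add: f algebra_simps)
    finally have "b * j = b * (e - m * a + m * d)" .
    then have "j = e - m * a + m * d" using 1 by (simp only: mult_cancel_left simp_thms)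
    then show ?thesis
      by (intro exI[of _ "e - m * a"] exI[of _ m]) (simp add: G K mat_mk2 f i)
  next
    case 2
    define m where "m = i / c"
    have i: "i = m * c" using 2 by (simp add: m_def)
    have "c * f = b * i" unfolding eqs by simp
    then have "c * f = c * (m * b)" by (simp add: i ac_simps)
    then have f: "f = m * b" using 2 by (simp only: mult_cancel_left simp_thms)
    have "c * j = (i * a + j * c) - i * a" by simp
    also have "\<dots> = c * (e - m * a + m * d)" unfolding eqs0(3) by (simp add: i algebra_simps)
    finally have "c * j = c * (e - m * a + m * d)" .
    then have "j = e - m * a + m * d" using 2 by (simp only: mult_cancel_left simp_thms)
    then show ?thesis
      by (intro exI[of _ "e - m * a"] exI[of _ m]) (simp add: G K mat_mk2 f i)
  next
    case 3
    have "f * (d - a) = 0" using eqs0(2) 3 by (simp add: right_diff_distrib mult.commute)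
    moreover have "i * (a - d) = 0" using eqs0(3) 3 by (simp add: right_diff_distrib mult.commute)
    ultimately have fi: "f = 0" "i = 0" using 3 by auto
    define m where "m = (e - j) / (a - d)"
    have "m * (a - d) = e - j" using 3 by (simp add: m_def)
    then have "j = e - m * a + m * d" by (simp add: algebra_simps)
    then show ?thesis
      using 3 fi by (intro exI[of _ "e - m * a"] exI[of _ m]) (simp add: G K mat_mk2)
  qed
qed

text \<open>Passing from g to \<alpha> + \<beta> g multiplies the discriminant by \<beta>^2. Equal
  nonzero discriminants force \<beta> to be 1 or -1, and the trace then fixes \<alpha>; the second
  solution is the adjugate of g.\<close>

lemma conjugate_in_centralizer:
  fixes g :: "'a::field ^ 2 ^ 2"
  assumes two: "(2 :: 'a) \<noteq> 0" and g: "det (trace_free g) \<noteq> 0" "\<And>c. g \<noteq> mat c"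
    and x: "x ** g = g ** x" "trace x = trace g" "det x = det g"
  shows "x = g \<or> x = mat (trace g) - g"
proof -
  obtain \<alpha> \<beta> where ab: "x = mat \<alpha> + \<beta> *m g" using commutes_nonscalar[OF g(2) x(1)] by blast
  obtain a b c d where G: "g = mk2 a b c d" by (rule mk2_cases)
  have tr: "2 * \<alpha> = (1 - \<beta>) * (a + d)" using x(2) by (simp add: ab G mat_mk2 algebra_simps)
  have "4 * det x = 4 * det g" using x(3) by simp
  then have "(2 * \<alpha>) * (2 * \<alpha>) + 2 * (2 * \<alpha>) * \<beta> * (a + d) + 4 * (\<beta> * \<beta>) * (a * d - b * c) = 4 * (a * d - b * c)"
    by (simp add: ab G mat_mk2 algebra_simps)
  moreover have "(1 - \<beta>) * (1 + \<beta>) * det (trace_free g) = 4 * (a * d - b * c)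
      - ((1 - \<beta>) * (a + d) * ((1 - \<beta>) * (a + d)) + 2 * ((1 - \<beta>) * (a + d)) * \<beta> * (a + d)
        + 4 * (\<beta> * \<beta>) * (a * d - b * c))"
    unfolding det_trace_free G mk2_simps by (simp add: algebra_simps)
  ultimately have "(1 - \<beta>) * (1 + \<beta>) * det (trace_free g) = 0" by (simp only: tr) (simp only: diff_self)
  then have "1 - \<beta> = 0 \<or> 1 + \<beta> = 0" using g(1) by (simp only: mult_eq_0_iff simp_thms)
  then have "\<beta> = 1 \<or> \<beta> = -1" by (metis add_eq_0_iff right_minus_eq)
  then show ?thesis
  proof
    assume "\<beta> = 1"
    then show ?thesis using tr two by (simp add: ab G mat_mk2)
  next
    assume b: "\<beta> = -1"
    then have "2 * \<alpha> = 2 * (a + d)" using tr by simp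
    then have "\<alpha> = a + d" using two by (simp only: mult_cancel_left simp_thms)
    then show ?thesis by (simp add: ab b G mat_mk2)
  qed
qed

text \<open>Orthogonality to E under the trace form means that g preserves the line which is both
  image and kernel of E. Then \<open>l\<close> is the eigenvalue of g on that line and
  \<open>m\<close> the one on the quotient.\<close>

lemma nilpotent_eigenvalues:
  fixes g :: "'a::field ^ 2 ^ 2"
  assumes two: "(2 :: 'a) \<noteq> 0" and E: "trace E = 0" "det E = 0" "E \<noteq> 0"
    and g: "trace (trace_free g ** E) = 0"
  shows "\<exists>l m. g ** E = l *m E \<and> E ** g = m *m E \<and> l + m = trace g \<and> l * m = det g"
proof -
  obtain a b c d where G: "g = mk2 a b c d" by (rule mk2_cases)
  obtain p q r s where E': "E = mk2 p q r s" by (rule mk2_cases)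
  have s: "s = - p" using E(1) by (simp add: E' eq_neg_iff_add_eq_0 add.commute)
  have "p * p + q * r = - det E" by (simp add: E' s)
  then have pp: "p * p + q * r = 0" by (simp add: E(2))
  have "2 * ((a - d) * p + b * r + c * q) = 0"
    using g by (simp add: G E' s trace_free_def mat_mk2 algebra_simps)
  then have tr: "(a - d) * p + b * r + c * q = 0" using two by (simp only: mult_eq_0_iff simp_thms)
  have r: "q * r = - (p * p)" using pp by (simp add: eq_neg_iff_add_eq_0 add.commute)
  show ?thesis
  proof (cases "q = 0")
    case False
    define t where "t = p / q"
    have p: "p = t * q" using False by (simp add: t_def)
    have "q * r = q * (- (t * t * q))" unfolding r by (simp add: p algebra_simps)
    then have r': "r = - (t * t * q)" using False by (simp only: mult_cancel_left simp_thms)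
    have "q * ((a - d) * t - b * t * t + c) = (a - d) * p + b * r + c * q" by (simp add: p r' algebra_simps)
    then have "(a - d) * t - b * t * t + c = 0" using tr False by (simp only: mult_eq_0_iff simp_thms)
    then have "c + ((a - d) * t - b * t * t) = 0" by (simp only: add.commute)
    then have "c = - ((a - d) * t - b * t * t)" by (simp only: eq_neg_iff_add_eq_0)
    then have c: "c = b * t * t - (a - d) * t" by simp
    show ?thesis
      by (rule exI[of _ "a - b * t"], rule exI[of _ "d + b * t"]) (simp add: G E' s p r' c algebra_simps)
  next
    case True
    then have p: "p = 0" using pp by simp
    then have r0: "r \<noteq> 0" using E(3) True by (auto simp: E' s zero_mk2)
    then have b: "b = 0" using tr True p by simp
    show ?thesis
      by (rule exI[of _ d], rule exI[of _ a]) (simp add: G E' s p True b mult.commute)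
  qed
qed

lemma smat_eq_cancel: "(c :: 'a::field) *m E = d *m E \<Longrightarrow> E \<noteq> 0 \<Longrightarrow> c = d"
  by (cases E rule: mk2_cases) (auto simp: zero_mk2)

subsection \<open>Reduction modulo the prime\<close>

definition redm :: "'p::prime_card mat2 \<Rightarrow> 'p mod_ring ^ 2 ^ 2" where "redm = map_matrix red"

lemma redm_mk2 [simp]: "redm (mk2 a b c d) = mk2 (red a) (red b) (red c) (red d)"
  by (simp add: redm_def mat2_eq_iff)

lemma redm_simps:
  "redm (A ** B) = redm A ** redm B" "redm (adj2 A) = adj2 (redm A)" "redm (c *m A) = red c *m redm A"
  "redm (A - B) = redm A - redm B" "det (redm A) = red (det A)" "trace (redm A) = red (trace A)"
  "redm (mat c) = mat (red c)" "redm 0 = 0"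
  by (cases A rule: mk2_cases; cases B rule: mk2_cases; simp add: mk2_const)+

lemma redm_eq_iff: "redm A = redm B \<longleftrightarrow> mat_cong 1 A B"
  by (cases A rule: mk2_cases; cases B rule: mk2_cases) (simp add: red_eq_iff)

lemma two_mod_ring: "odd CARD('p) \<Longrightarrow> (2 :: 'p::prime_card mod_ring) \<noteq> 0"
  using two_unit[where 'p = 'p] by (simp add: unit_iff_red)

lemma four_mod_ring: "odd CARD('p) \<Longrightarrow> (4 :: 'p::prime_card mod_ring) \<noteq> 0"
proof -
  assume "odd CARD('p)"
  then have "(2 :: 'p mod_ring) * 2 \<noteq> 0" by (simp only: two_mod_ring mult_eq_0_iff simp_thms)
  then show ?thesis by simp
qed

lemma trace_free_redm: "odd CARD('p) \<Longrightarrow> trace_free (redm g) = 2 *m redm (Theta (g :: 'p::prime_card mat2))"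
  using arg_cong[OF two_Theta[of g], of redm] by (simp add: trace_free_def redm_simps)

lemma dvd_det_Theta_iff:
  "odd CARD('p) \<Longrightarrow> ell dvd det (Theta (g :: 'p::prime_card mat2)) \<longleftrightarrow> det (trace_free (redm g)) = 0"
  using four_mod_ring[where 'p = 'p] by (simp add: trace_free_redm det_smat redm_simps red_eq_0_iff)

lemma dvd_trace_Theta_mult_iff:
  "odd CARD('p) \<Longrightarrow> ell dvd trace (Theta (g :: 'p::prime_card mat2) ** Theta h)
    \<longleftrightarrow> trace (trace_free (redm g) ** trace_free (redm h)) = 0"
  using four_mod_ring[where 'p = 'p]
  by (simp add: trace_free_redm smat_simps redm_simps red_eq_0_iff flip: redm_simps(1))

lemma trace_free_scalar: "trace_free (mat c) = 0"
  by (simp add: trace_free_def mk2_const)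

lemma Theta_cong_0_iff:
  "odd CARD('p) \<Longrightarrow> mat_cong 1 (Theta (g :: 'p::prime_card mat2)) 0 \<longleftrightarrow> (\<exists>c. redm g = mat c)"
proof
  assume odd: "odd CARD('p)"
  have "mat_cong 1 (Theta g) 0 \<longleftrightarrow> redm (Theta g) = 0" using redm_eq_iff[of "Theta g" 0] by (simp add: redm_simps)
  also have "\<dots> \<longleftrightarrow> trace_free (redm g) = 0"
    using two_mod_ring[OF odd] unfolding trace_free_redm[OF odd]
    by (cases "redm (Theta g)" rule: mk2_cases) (simp add: zero_mk2)
  finally have iff: "mat_cong 1 (Theta g) 0 \<longleftrightarrow> trace_free (redm g) = 0" .
  show "\<exists>c. redm g = mat c \<Longrightarrow> mat_cong 1 (Theta g) 0" using iff trace_free_scalar by metis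
  assume "mat_cong 1 (Theta g) 0"
  then have "redm (Theta g) = 0" using redm_eq_iff[of "Theta g" 0] by (simp add: redm_simps)
  moreover have "redm g = mat (red (halve (trace g))) + redm (Theta g)"
    using arg_cong[OF mat_plus_Theta[of g], of redm]
    by (cases "Theta g" rule: mk2_cases) (simp add: mk2_const)
  ultimately show "\<exists>c. redm g = mat c" by auto
qed

lemma nil_dirs_redmI:
  assumes "X \<in> carrier sl2" "redm X = k *m redm E" shows "X \<in> nil_dirs E"
proof -
  obtain c where "red c = k" using red_surj by blast
  then have "redm X = redm (c *m E)" using assms(2) by (simp add: redm_simps)
  then show ?thesis using assms(1) by (auto simp: nil_dirs_def redm_eq_iff)
qed

text \<open>Scalars are not divided out; the image in PGL_2 enters only through orders relative to
  the central subgroup \<open>scalars\<close>.\<close>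

definition red_group :: "'p::prime_card mat2 set \<Rightarrow> ('p mod_ring ^ 2 ^ 2) monoid" where
  "red_group H = \<lparr>carrier = redm ` H, mult = (**), one = mat 1\<rparr>"

lemma GL2_inverse:
  assumes "subgroup H GL2" "A \<in> H"
  obtains v where "v * det A = 1" "v dvd 1" "v *m adj2 A \<in> H" "A ** (v *m adj2 A) = mat 1" "(v *m adj2 A) ** A = mat 1"
proof -
  obtain v where v: "v * det A = 1" using unit_inverse[OF GL2_subgroup_det[OF assms]] by blast
  then show ?thesis using that[OF v _ GL2_subgroup_inv[OF assms v]] adj2_inverse[OF v] by (metis dvdI)
qed

lemma group_red_group:
  assumes H: "subgroup H GL2" shows "group (red_group H)"
proof (rule groupI)
  fix x assume "x \<in> carrier (red_group H)"
  then obtain A where A: "A \<in> H" "x = redm A" by (auto simp: red_group_def)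
  obtain v where "v *m adj2 A \<in> H" "(v *m adj2 A) ** A = mat 1" by (rule GL2_inverse[OF H A(1)])
  then have "redm (v *m adj2 A) \<in> carrier (red_group H)" "redm (v *m adj2 A) ** x = mat 1"
    by (simp_all add: red_group_def A redm_simps(7) flip: redm_simps(1))
  then show "\<exists>y\<in>carrier (red_group H). y \<otimes>\<^bsub>red_group H\<^esub> x = \<one>\<^bsub>red_group H\<^esub>"
    by (auto simp: red_group_def)
next
  show "\<one>\<^bsub>red_group H\<^esub> \<in> carrier (red_group H)"
    using imageI[OF GL2_subgroup_one[OF H], of redm] by (simp add: red_group_def redm_simps)
qed (auto simp: red_group_def matrix_mul_assoc simp flip: redm_simps(1) intro!: imageI GL2_subgroup_mult[OF H])

lemma finite_red_group: "finite (carrier (red_group H))"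
  by (rule finite_subset[OF subset_UNIV]) simp

text \<open>Only one direction is asked of \<open>f\<close>: it may take several values on one
  coset, which permits crude counts.\<close>

lemma index_leI:
  fixes H :: "'p::prime_card mat2 set"
  assumes H: "subgroup H GL2" and K: "subgroup K GL2"
    and f: "\<And>A B v. A \<in> H \<Longrightarrow> B \<in> H \<Longrightarrow> f A = f B \<Longrightarrow> v * det B = 1 \<Longrightarrow> A ** (v *m adj2 B) \<in> K"
    and fin: "finite (f ` H)" "card (f ` H) \<le> n"
  shows "index_le GL2 H K n"
proof -
  define coset where "coset A = (\<lambda>k. k ** A) ` K" for A :: "'p mat2"
  have sub: "coset A \<subseteq> coset B" if AB: "A \<in> H" "B \<in> H" "f A = f B" for A B
  proof
    fix x assume "x \<in> coset A"
    then obtain k where k: "k \<in> K" "x = k ** A" by (auto simp: coset_def)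
    obtain v where v: "v * det B = 1" "(v *m adj2 B) ** B = mat 1" by (rule GL2_inverse[OF H AB(2)])
    have "x = (k ** (A ** (v *m adj2 B))) ** B"
      by (simp add: k v(2) flip: matrix_mul_assoc)
    moreover have "k ** (A ** (v *m adj2 B)) \<in> K" by (intro GL2_subgroup_mult[OF K] k(1) f AB v(1))
    ultimately show "x \<in> coset B" unfolding coset_def by blast
  qed
  define F where "F y = coset (SOME A. A \<in> H \<and> f A = y)" for y
  have F: "coset A = F (f A)" if "A \<in> H" for A
  proof -
    have "(SOME B. B \<in> H \<and> f B = f A) \<in> H \<and> f (SOME B. B \<in> H \<and> f B = f A) = f A"
      by (rule someI[of _ A]) (use that in simp)
    then show ?thesis unfolding F_def using sub that by (metis subset_antisym)
  qed
  have "rcosets\<^bsub>GL2\<lparr>carrier := H\<rparr>\<^esub> K = coset ` H"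
    by (auto simp: RCOSETS_def r_coset_def coset_def GL2_def)
  also have "\<dots> = F ` (f ` H)" unfolding image_image by (rule image_cong[OF refl F])
  finally show ?thesis
    unfolding index_le_def using fin card_image_le[OF fin(1), of F] by (simp add: le_trans)
qed

lemma index_le_self: "subgroup H GL2 \<Longrightarrow> n \<ge> 1 \<Longrightarrow> index_le GL2 H H n"
proof (rule index_leI[where f = "\<lambda>_. ()"])
  show "card ((\<lambda>_. ()) ` H) \<le> n" if "n \<ge> 1" using that card_mono[of UNIV "(\<lambda>_. ()) ` H"] by simp
qed (auto intro: GL2_subgroup_mult GL2_subgroup_inv)

lemma preimage_red_group:
  fixes H :: "'p::prime_card mat2 set"
  assumes H: "closed_subgroup H GL2" and S: "subgroup S (red_group H)"
  defines "K \<equiv> {h \<in> H. redm h \<in> S}"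
  shows "closed_subgroup K GL2" "closed_subgroup K (GL2\<lparr>carrier := H\<rparr>)"
    and "card (carrier (red_group H)) \<le> n * card S \<Longrightarrow> index_le GL2 H K n"
proof -
  have sub: "subgroup H GL2" using H by (simp add: closed_subgroup_def)
  interpret R: group "red_group H" by (rule group_red_group[OF sub])
  have mult: "x \<in> S \<Longrightarrow> y \<in> S \<Longrightarrow> x ** y \<in> S" for x y
    using subgroup.m_closed[OF S, of x y] by (simp add: red_group_def)
  have K: "subgroup K GL2"
  proof (rule GL2_subgroupI)
    show "mat 1 \<in> K"
      using GL2_subgroup_one[OF sub] subgroup.one_closed[OF S] by (simp add: K_def redm_simps red_group_def)
    show "A ** B \<in> K" if "A \<in> K" "B \<in> K" for A B
      using that GL2_subgroup_mult[OF sub] mult by (simp add: K_def redm_simps)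
    show "det A dvd 1" if "A \<in> K" for A using that GL2_subgroup_det[OF sub] by (simp add: K_def)
    show "v *m adj2 A \<in> K" if A: "A \<in> K" and v: "v * det A = 1" for A v
    proof -
      have AH: "A \<in> H" "v *m adj2 A \<in> H" using A GL2_subgroup_inv[OF sub _ v] by (simp_all add: K_def)
      have "redm (v *m adj2 A) ** redm A = mat 1"
        by (simp add: adj2_inverse[OF v] redm_simps(7) flip: redm_simps(1))
      then have "inv\<^bsub>red_group H\<^esub> (redm A) = redm (v *m adj2 A)"
        using AH by (intro R.inv_equality) (simp_all add: red_group_def)
      then show ?thesis using subgroup.m_inv_closed[OF S, of "redm A"] A AH by (simp add: K_def)
    qed
  qed
  have "K \<subseteq> H" by (auto simp: K_def)
  have cong: "B \<in> K" if "A \<in> K" "B \<in> H" "mat_cong 1 A B" for A B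
    using that redm_eq_iff[of A B] by (simp add: K_def)
  show "closed_subgroup K GL2" "closed_subgroup K (GL2\<lparr>carrier := H\<rparr>)"
    by (rule closed_subgroup_cong[OF H \<open>K \<subseteq> H\<close> K cong], assumption+)+
  assume n: "card (carrier (red_group H)) \<le> n * card S"
  define f where "f A = S #>\<^bsub>red_group H\<^esub> redm A" for A
  show "index_le GL2 H K n"
  proof (rule index_leI[OF sub K])
    fix A B v assume *: "A \<in> H" "B \<in> H" "f A = f B" "v * det B = 1"
    have "redm A \<in> f A" unfolding f_def by (rule R.rcos_self[OF _ S]) (use * in \<open>simp add: red_group_def\<close>)
    then obtain s where s: "s \<in> S" "redm A = s ** redm B"
      using *(3) by (auto simp: f_def r_coset_def red_group_def)
    have "redm B ** redm (v *m adj2 B) = mat 1"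
      by (simp add: adj2_inverse[OF *(4)] redm_simps(7) flip: redm_simps(1))
    then have "redm (A ** (v *m adj2 B)) = s"
      by (simp add: redm_simps(1) s(2) flip: matrix_mul_assoc)
    moreover have "A ** (v *m adj2 B) \<in> H" by (intro GL2_subgroup_mult[OF sub] GL2_subgroup_inv[OF sub] *)
    ultimately show "A ** (v *m adj2 B) \<in> K" using s(1) by (simp add: K_def)
  next
    have f: "f ` H = rcosets\<^bsub>red_group H\<^esub> S" by (auto simp: f_def RCOSETS_def red_group_def)
    have lag: "card (rcosets\<^bsub>red_group H\<^esub> S) * card S = card (carrier (red_group H))"
      using R.lagrange[OF S] by (simp add: order_def)
    show "finite (f ` H)" by (rule finite_subset[OF subset_UNIV]) simp
    have "finite S" by (rule finite_subset[OF subset_UNIV]) simp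
    then have "card S > 0" using subgroup.one_closed[OF S] by (auto simp: card_gt_0_iff)
    then show "card (f ` H) \<le> n" using lag n unfolding f by (metis mult_le_cancel2 mult.commute)
  qed
qed

subsection \<open>Choice of the subgroup\<close>

lemma red_group_subgroupI:
  assumes H: "subgroup H GL2" and one: "P (mat 1)"
    and mult: "\<And>x y. P x \<Longrightarrow> P y \<Longrightarrow> P (x ** y)" and inv: "\<And>x c. P x \<Longrightarrow> P (c *m adj2 x)"
  shows "subgroup {x \<in> carrier (red_group H). P x} (red_group H)"
proof -
  interpret R: group "red_group H" by (rule group_red_group[OF H])
  show ?thesis
  proof (rule R.subgroupI)
    show "{x \<in> carrier (red_group H). P x} \<noteq> {}"
      using one R.one_closed by (auto simp: red_group_def)
    fix x assume x: "x \<in> {x \<in> carrier (red_group H). P x}"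
    then obtain A where A: "A \<in> H" "x = redm A" by (auto simp: red_group_def)
    obtain v where v: "v *m adj2 A \<in> H" "(v *m adj2 A) ** A = mat 1" by (rule GL2_inverse[OF H A(1)])
    have "redm (v *m adj2 A) ** redm A = mat 1" using v(2) by (simp add: redm_simps(7) flip: redm_simps(1))
    then have "inv\<^bsub>red_group H\<^esub> x = redm (v *m adj2 A)"
      using A v(1) by (intro R.inv_equality) (simp_all add: red_group_def)
    also have "\<dots> = red v *m adj2 x" by (simp add: A redm_simps)
    finally show "inv\<^bsub>red_group H\<^esub> x \<in> {x \<in> carrier (red_group H). P x}"
      using x R.inv_closed[of x] inv[of x "red v"] by simp
    fix y assume "y \<in> {x \<in> carrier (red_group H). P x}"
    then show "x \<otimes>\<^bsub>red_group H\<^esub> y \<in> {x \<in> carrier (red_group H). P x}"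
      using x R.m_closed[of x y] mult[of x y] by (simp add: red_group_def)
  qed auto
qed

definition scalars :: "'p::prime_card mat2 set \<Rightarrow> ('p mod_ring ^ 2 ^ 2) set" where
  "scalars H = {x \<in> carrier (red_group H). \<exists>c. x = mat c}"

lemma mat_mult_mat: "mat a ** mat b = (mat (a * b) :: 'a::comm_ring_1 ^ 2 ^ 2)"
  and smat_mat: "a *m mat b = (mat (a * b) :: 'a::comm_ring_1 ^ 2 ^ 2)"
  by (simp_all add: mat_mk2)

lemma subgroup_scalars: "subgroup H GL2 \<Longrightarrow> subgroup (scalars H) (red_group H)"
  unfolding scalars_def by (rule red_group_subgroupI) (auto simp: mat_mult_mat smat_mat adj2_mat)

lemma det_red_group: "subgroup H GL2 \<Longrightarrow> x \<in> carrier (red_group H) \<Longrightarrow> det x \<noteq> 0"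
  using GL2_subgroup_det[of H] unfolding red_group_def unit_iff_red by (auto simp: redm_simps)

lemma nil_dirs_zeroI: "X \<in> carrier sl2 \<Longrightarrow> mat_cong 1 X 0 \<Longrightarrow> X \<in> nil_dirs 0"
  by (cases X rule: mk2_cases) (auto simp: nil_dirs_def zero_mk2)

definition has_good_subgroup :: "'p::prime_card mat2 set \<Rightarrow> bool" where
  "has_good_subgroup H \<longleftrightarrow> (\<exists>H1. closed_subgroup H1 (GL2\<lparr>carrier := H\<rparr>) \<and> index_le GL2 H H1 24 \<and>
    (\<forall>s>0. scaled_sl2 s \<subseteq> special_Lie H1 \<longrightarrow> ball_SL2 (4 * s) \<subseteq> H1))"

text \<open>\<open>H1\<close> consists of the elements that are scalar modulo ell, so its index is
  the order of the image in PGL_2; every \<open>Theta g\<close> is divisible by ell, which is the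
  case \<open>E = 0\<close>.\<close>

lemma good_subgroup_scalars:
  fixes H :: "'p::prime_card mat2 set"
  assumes H: "closed_subgroup H GL2" and odd: "odd CARD('p)"
    and card: "card (carrier (red_group H)) \<le> 24 * card (scalars H)"
  shows "has_good_subgroup H"
proof -
  have sub: "subgroup H GL2" using H by (simp add: closed_subgroup_def)
  note pre = preimage_red_group[OF H subgroup_scalars[OF sub]]
  let ?K = "{h \<in> H. redm h \<in> scalars H}"
  have "ball_SL2 (4 * s) \<subseteq> ?K" if "s > 0" "scaled_sl2 s \<subseteq> special_Lie ?K" for s
  proof (rule ball_subset_nilpotent[OF pre(1) odd _ _ _ _ that])
    show "0 \<in> carrier (sl2 :: 'p mat2 monoid)" "mat_cong 1 ((0 :: 'p mat2) ** 0) 0"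
      "CARD('p) \<ge> 5 \<or> mat_cong 1 (0 :: 'p mat2) 0"
      by (simp_all add: zero_mk2)
    fix g assume "g \<in> ?K"
    then have "mat_cong 1 (Theta g) 0" using Theta_cong_0_iff[OF odd, of g] by (auto simp: scalars_def)
    then show "Theta g \<in> nil_dirs 0" by (rule nil_dirs_zeroI[OF Theta_sl2_odd[OF odd]])
  qed
  then show ?thesis unfolding has_good_subgroup_def using pre(2) pre(3)[OF card] by blast
qed

text \<open>GL_2(F_3) has order 48 and scalars 1 and -1. If -1 is missing from the image C, then C
  and -C are disjoint, so C has at most 24 elements.\<close>

lemma card_red_group_three:
  fixes H :: "'p::prime_card mat2 set"
  assumes H: "subgroup H GL2" and p: "CARD('p) = 3"
  shows "card (carrier (red_group H)) \<le> 24 * card (scalars H)"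
proof -
  interpret R: group "red_group H" by (rule group_red_group[OF H])
  let ?C = "carrier (red_group H)"
  let ?F = "UNIV :: ('p mod_ring \<times> 'p mod_ring) set"
  have two: "(2 :: 'p mod_ring) \<noteq> 0" by (rule two_mod_ring) (use p in simp)
  have neg: "a = 0" if "- a = a" for a :: "'p mod_ring"
  proof -
    have "2 * a = a - - a" by simp
    also have "\<dots> = 0" unfolding that by simp
    finally show ?thesis using two by (simp only: mult_eq_0_iff simp_thms)
  qed
  define GL where "GL = {A :: 'p mod_ring ^ 2 ^ 2. det A \<noteq> 0}"
  have finM: "finite A" for A :: "('p mod_ring ^ 2 ^ 2) set" by (rule finite_subset[OF subset_UNIV]) simp
  have "card GL \<le> 48"
  proof -
    define cols where "cols A = ((A $ 1 $ 1, A $ 2 $ 1), (A $ 1 $ 2, A $ 2 $ 2))" for A :: "'p mod_ring ^ 2 ^ 2"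
    \<comment> \<open>A column independent of v avoids 0, v and -v, all the multiples of v over F_3;
      this leaves 8 * 6 pairs of columns.\<close>
    define T where "T = (SIGMA v:?F - {(0, 0)}. ?F - {(0, 0), v, (- fst v, - snd v)})"
    have "inj_on cols GL" by (rule inj_onI) (simp add: cols_def mat2_eq_iff)
    moreover have "cols ` GL \<subseteq> T"
    proof (rule image_subsetI)
      fix A assume A: "A \<in> GL"
      obtain a b c d where abcd: "A = mk2 a b c d" by (rule mk2_cases)
      have "a * d - b * c \<noteq> 0" using A by (simp add: GL_def abcd)
      then show "cols A \<in> T" by (auto simp: T_def cols_def abcd mult.commute)
    qed
    ultimately have "card GL \<le> card T" by (rule card_inj_on_le) (rule finite_subset[OF subset_UNIV], simp)
    also have "card T = (\<Sum>v\<in>?F - {(0, 0)}. card (?F - {(0, 0), v, (- fst v, - snd v)}))"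
      unfolding T_def by (rule card_SigmaI) (auto intro: finite_subset[OF subset_UNIV])
    also have "\<dots> = (\<Sum>v\<in>?F - {(0, 0)}. 6)"
    proof (rule sum.cong[OF refl])
      fix v assume v: "v \<in> ?F - {(0, 0)}"
      have "card {(0, 0), v, (- fst v, - snd v)} = 3"
        using v two by (cases v) auto
      moreover have "card ?F = 9" using p by (simp add: card_cartesian_product flip: UNIV_Times_UNIV)
      ultimately show "card (?F - {(0, 0), v, (- fst v, - snd v)}) = 6"
        by (subst card_Diff_subset) auto
    qed
    also have "\<dots> = 48"
    proof -
      have "card ?F = 9" using p by (simp add: card_cartesian_product flip: UNIV_Times_UNIV)
      then show ?thesis by (simp add: card_Diff_singleton)
    qed
    finally show ?thesis .
  qed
  have sub: "?C \<subseteq> GL" using det_red_group[OF H] by (auto simp: GL_def)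
  have one: "mat 1 \<in> scalars H" using subgroup.one_closed[OF subgroup_scalars[OF H]] by (simp add: red_group_def)
  show ?thesis
  proof (cases "mat (-1) \<in> ?C")
    case True
    then have "{mat 1, mat (-1)} \<subseteq> scalars H" using one by (auto simp: scalars_def)
    moreover have "card {mat 1, mat (-1) :: 'p mod_ring ^ 2 ^ 2} = 2"
      using neg[of 1] by (simp add: mat_mk2) force
    ultimately have "2 \<le> card (scalars H)" using card_mono[OF finM] by metis
    moreover have "card ?C \<le> 48" using card_mono[OF finM sub] \<open>card GL \<le> 48\<close> by simp
    ultimately show ?thesis by linarith
  next
    case False
    have "?C \<inter> (\<lambda>A. - A) ` ?C = {}"
    proof (rule ccontr)
      assume "?C \<inter> (\<lambda>A. - A) ` ?C \<noteq> {}"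
      then obtain A where A: "A \<in> ?C" "- A \<in> ?C" by auto
      have "A ** inv\<^bsub>red_group H\<^esub> A = mat 1" using R.r_inv[OF A(1)] by (simp add: red_group_def)
      moreover have "(- A) ** B = (-1) *m (A ** B)" for B
        by (cases A rule: mk2_cases; cases B rule: mk2_cases) simp
      ultimately have "(- A) ** inv\<^bsub>red_group H\<^esub> A = mat (-1)" by (simp add: smat_mat)
      moreover have "(- A) ** inv\<^bsub>red_group H\<^esub> A \<in> ?C"
        using R.m_closed[OF A(2) R.inv_closed[OF A(1)]] by (simp add: red_group_def)
      ultimately show False using False by simp
    qed
    then have "card (?C \<union> (\<lambda>A. - A) ` ?C) = card ?C + card ((\<lambda>A. - A) ` ?C)"
      by (intro card_Un_disjoint finM)
    also have "card ((\<lambda>A. - A) ` ?C) = card ?C" by (rule card_image) (simp add: inj_on_def)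
    finally have "2 * card ?C = card (?C \<union> (\<lambda>A. - A) ` ?C)" by simp
    also have "\<dots> \<le> card GL"
    proof (rule card_mono[OF finM])
      have "det (- A) = det A" for A :: "'p mod_ring ^ 2 ^ 2" by (cases A rule: mk2_cases) simp
      then show "?C \<union> (\<lambda>A. - A) ` ?C \<subseteq> GL" using sub by (auto simp: GL_def)
    qed
    finally have "2 * card ?C \<le> 48" using \<open>card GL \<le> 48\<close> by simp
    moreover have "card (scalars H) > 0" using one finM by (auto simp: card_gt_0_iff)
    ultimately show ?thesis by linarith
  qed
qed

lemma trace_free_affine: "trace_free (mat a + b *m g) = b *m trace_free g"
  by (cases g rule: mk2_cases) (simp add: trace_free_def mat_mk2 algebra_simps)

lemma trace_square_trace_free: "trace (trace_free g ** trace_free g) = - 2 * det (trace_free g)"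
  by (cases g rule: mk2_cases) (simp add: trace_free_def mat_mk2 algebra_simps)

lemma adj2_eq: "adj2 g = mat (trace g) - (g :: 'a::comm_ring_1 ^ 2 ^ 2)"
  by (cases g rule: mk2_cases) (simp add: mat_mk2)

text \<open>Centralizers of nonscalar elements are spanned by 1 and the element, so commuting is
  transitive off the scalars; as eigenvalues are distinct, g can be conjugate only to itself and its
  adjugate inside its centralizer. So the class equation applies, and \<open>H1\<close> is the
  preimage of a large centralizer.\<close>

lemma good_subgroup_semisimple:
  fixes H :: "'p::prime_card mat2 set"
  assumes H: "closed_subgroup H GL2" and odd: "odd CARD('p)"
    and semi: "\<And>g. g \<in> H \<Longrightarrow> det (trace_free (redm g)) = 0 \<Longrightarrow> \<exists>c. redm g = mat c"
  shows "has_good_subgroup H"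
proof (cases "card (carrier (red_group H)) \<le> 24 * card (scalars H)")
  case True
  then show ?thesis by (rule good_subgroup_scalars[OF H odd])
next
  case False
  have sub: "subgroup H GL2" using H by (simp add: closed_subgroup_def)
  interpret R: group "red_group H" by (rule group_red_group[OF sub])
  let ?C = "carrier (red_group H)"
  have two: "(2 :: 'p mod_ring) \<noteq> 0" by (rule two_mod_ring[OF odd])
  have four: "(4 :: 'p mod_ring) \<noteq> 0" by (rule four_mod_ring[OF odd])
  have comm_iff: "R.commutes x y \<longleftrightarrow> x ** y = y ** x" for x y
    unfolding R.commutes_def by (simp add: red_group_def)
  have nonscalar: "g \<noteq> mat c" if "g \<in> ?C - scalars H" for g c using that by (auto simp: scalars_def)
  have disc: "det (trace_free g) \<noteq> 0" if g: "g \<in> ?C - scalars H" for g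
  proof
    assume "det (trace_free g) = 0"
    moreover obtain A where "A \<in> H" "g = redm A" using g by (auto simp: red_group_def)
    ultimately show False using semi[of A] nonscalar[OF g] by auto
  qed
  have aff_comm: "(mat a + b *m g) ** (mat c + d *m g) = (mat c + d *m g) ** (mat a + b *m g)"
    for a b c d and g :: "'p mod_ring ^ 2 ^ 2"
    by (cases g rule: mk2_cases) (simp add: mat_mk2 algebra_simps)
  have "\<exists>g\<in>?C - scalars H. card ?C \<le> 12 * card (R.centralizer g)"
  proof -
    have "card ?C \<le> 24 * card (scalars H) \<or> (\<exists>g\<in>?C - scalars H. card ?C \<le> 12 * card (R.centralizer g))"
    proof (rule R.class_equation_bound[OF finite_red_group subgroup_scalars[OF sub]])
      fix z g assume "z \<in> scalars H"
      then obtain c where "z = mat c" by (auto simp: scalars_def)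
      then show "R.commutes z g" unfolding comm_iff
        by (cases g rule: mk2_cases) (simp add: mat_mk2 mult.commute)
    next
      fix a b c assume abc: "a \<in> ?C - scalars H" "b \<in> ?C - scalars H" "c \<in> ?C - scalars H"
        "R.commutes a b" "R.commutes b c"
      have "\<exists>x y. a = mat x + y *m b" "\<exists>x y. c = mat x + y *m b"
        using abc(4,5) by (intro commutes_nonscalar nonscalar[OF abc(2)]; simp add: comm_iff)+
      then show "R.commutes a c" unfolding comm_iff using aff_comm by metis
    next
      fix g assume g: "g \<in> ?C - scalars H"
      have "{R.conjg k g | k. k \<in> ?C \<and> R.commutes (R.conjg k g) g} \<subseteq> {g, mat (trace g) - g}"
      proof
        fix x assume "x \<in> {R.conjg k g | k. k \<in> ?C \<and> R.commutes (R.conjg k g) g}"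
        then obtain k where k: "k \<in> ?C" "R.commutes x g" "x = R.conjg k g" by blast
        define l where "l = inv\<^bsub>red_group H\<^esub> k"
        have lk: "l ** k = mat 1" using R.l_inv[OF k(1)] by (simp add: red_group_def l_def)
        have x: "x = k ** g ** l" unfolding k(3) R.conjg_def l_def by (simp add: red_group_def)
        have "det l * det k = 1" using lk by (metis det_I det_mult2)
        moreover have "det x = det g * (det l * det k)" unfolding x by (simp add: det_mult2 ac_simps)
        ultimately have det: "det x = det g" by simp
        have "trace x = trace (l ** (k ** g))" unfolding x by (rule trace_mul_sym)
        also have "\<dots> = trace g" by (simp add: lk matrix_mul_assoc)
        finally have "x = g \<or> x = mat (trace g) - g"
          using k(2) det unfolding comm_iff
          by (intro conjugate_in_centralizer[OF two disc[OF g] nonscalar[OF g]])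
        then show "x \<in> {g, mat (trace g) - g}" by blast
      qed
      then have "card {R.conjg k g | k. k \<in> ?C \<and> R.commutes (R.conjg k g) g} \<le> card {g, mat (trace g) - g}"
        by (rule card_mono[rotated]) simp
      also have "\<dots> \<le> 2" by (simp add: card_insert_if)
      finally show "card {R.conjg k g | k. k \<in> ?C \<and> R.commutes (R.conjg k g) g} \<le> 2" .
    qed
    with False show ?thesis by blast
  qed
  then obtain g0 where g0: "g0 \<in> ?C - scalars H" "card ?C \<le> 12 * card (R.centralizer g0)" by blast
  define S where "S = R.centralizer g0"
  have S: "subgroup S (red_group H)" unfolding S_def by (rule R.subgroup_centralizer) (use g0 in simp)
  have g0S: "g0 \<in> S" using g0 by (simp add: S_def R.centralizer_def comm_iff)
  have SC: "S \<subseteq> ?C" using subgroup.subset[OF S] .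
  note pre = preimage_red_group[OF H S]
  let ?K = "{h \<in> H. redm h \<in> S}"
  have aff: "\<exists>a b. x = mat a + b *m g0" if "x \<in> S" for x
    using that by (intro commutes_nonscalar nonscalar[OF g0(1)]) (simp add: S_def R.centralizer_def comm_iff)
  \<comment> \<open>If every nonscalar element of S had trace zero, each would be a scalar multiple
    of \<open>g0\<close>. Then S would have at most 2 elements modulo scalars and the image at most
    12 * 2 = 24, contrary to the case assumption.\<close>
  have "\<exists>x\<in>S - scalars H. trace x \<noteq> 0"
  proof (rule ccontr)
    assume "\<not> ?thesis"
    then have tr0: "trace x = 0" if "x \<in> S" "x \<notin> scalars H" for x using that by blast
    have "S \<subseteq> scalars H \<union> (\<lambda>z. z ** g0) ` scalars H"
    proof
      fix x assume x: "x \<in> S"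
      show "x \<in> scalars H \<union> (\<lambda>z. z ** g0) ` scalars H"
      proof (cases "x \<in> scalars H")
        case nonsc: False
        obtain a b where ab: "x = mat a + b *m g0" using aff[OF x] by blast
        have "trace x = 2 * a + b * trace g0" unfolding ab by (cases g0 rule: mk2_cases) (simp add: mat_mk2 algebra_simps)
        then have "2 * a = 0" using tr0[OF x nonsc] tr0[OF g0S] g0(1) by simp
        then have "a = 0" using two by (simp only: mult_eq_0_iff simp_thms)
        then have xb: "x = mat b ** g0" unfolding ab by (cases g0 rule: mk2_cases) (simp add: mat_mk2)
        have inC: "x \<in> ?C" "g0 \<in> ?C" using x SC g0S by auto
        have "x \<otimes>\<^bsub>red_group H\<^esub> inv\<^bsub>red_group H\<^esub> g0 = mat b ** (g0 ** inv\<^bsub>red_group H\<^esub> g0)"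
          unfolding xb by (simp add: red_group_def matrix_mul_assoc)
        also have "g0 ** inv\<^bsub>red_group H\<^esub> g0 = mat 1" using R.r_inv[OF inC(2)] by (simp add: red_group_def)
        finally have "mat b \<in> ?C" using R.m_closed[OF inC(1) R.inv_closed[OF inC(2)]] by simp
        then have "mat b \<in> scalars H" by (auto simp: scalars_def)
        with xb show ?thesis by blast
      qed simp
    qed
    moreover have fin: "finite (scalars H)" by (rule finite_subset[OF subset_UNIV]) simp
    ultimately have "card S \<le> card (scalars H \<union> (\<lambda>z. z ** g0) ` scalars H)" by (intro card_mono) auto
    also have "\<dots> \<le> card (scalars H) + card ((\<lambda>z. z ** g0) ` scalars H)" by (rule card_Un_le)
    also have "card ((\<lambda>z. z ** g0) ` scalars H) \<le> card (scalars H)" by (rule card_image_le[OF fin])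
    finally have "card S \<le> 2 * card (scalars H)" by simp
    then show False using g0(2) False by (simp add: S_def)
  qed
  then obtain h where h: "h \<in> H" "redm h \<in> S" "redm h \<notin> scalars H" "trace (redm h) \<noteq> 0"
    using SC by (auto simp: red_group_def)
  have hK: "h \<in> ?K" using h by simp
  have h_disc: "det (trace_free (redm h)) \<noteq> 0" by (rule disc) (use h SC in auto)
  have "ball_SL2 (4 * s) \<subseteq> ?K" if s: "s > 0" "scaled_sl2 s \<subseteq> special_Lie ?K" for s
  proof (rule ball_subset_split[OF pre(1) odd _ _ _ _ _ hK _ _ _ _ s])
    show "0 \<in> carrier (sl2 :: 'p mat2 monoid)" "mat_cong 1 ((0 :: 'p mat2) ** 0) 0"
      "CARD('p) \<ge> 5 \<or> mat_cong 1 (0 :: 'p mat2) 0"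
      by (simp_all add: zero_mk2)
    show "\<not> ell dvd trace h" using h(4) by (simp add: redm_simps red_eq_0_iff)
    show "\<not> ell dvd det (Theta h)" using h_disc by (simp add: dvd_det_Theta_iff[OF odd])
    show "g ** 0 ** adj2 g \<in> nil_dirs 0" for g :: "'p mat2"
    proof -
      have "g ** 0 ** adj2 g = 0" by (cases g rule: mk2_cases) (simp add: zero_mk2)
      then show ?thesis using sl2_moduleD(2)[OF nil_dirs_module] by simp
    qed
    show "Theta g \<in> nil_dirs 0" if "g \<in> ?K" "ell dvd det (Theta g)" for g
      using that semi[of g] Theta_cong_0_iff[OF odd, of g]
      by (intro nil_dirs_zeroI[OF Theta_sl2_odd[OF odd]]) (simp add: dvd_det_Theta_iff[OF odd])
    show "ell dvd det (Theta (A ** B ** adj2 A ** adj2 B))" if A: "A \<in> ?K" and B: "B \<in> ?K" for A B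
    proof -
      obtain a b c d where AB: "redm A = mat a + b *m g0" "redm B = mat c + d *m g0"
        using aff[of "redm A"] aff[of "redm B"] A B by auto
      have "redm (A ** B ** adj2 A ** adj2 B) = redm A ** redm B ** adj2 (redm A) ** adj2 (redm B)"
        by (simp add: redm_simps)
      also have "redm A ** redm B = redm B ** redm A" unfolding AB by (rule aff_comm)
      also have "redm B ** redm A ** adj2 (redm A) ** adj2 (redm B) = redm B ** (redm A ** adj2 (redm A)) ** adj2 (redm B)"
        by (simp add: matrix_mul_assoc)
      also have "\<dots> = mat (det (redm A) * det (redm B))"
        unfolding mult_adj2 by (cases "redm B" rule: mk2_cases) (simp add: mat_mk2 algebra_simps)
      finally show ?thesis
        by (simp add: dvd_det_Theta_iff[OF odd] trace_free_scalar) (simp add: zero_mk2)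
    qed
    \<comment> \<open>Both trace-free parts are nonzero multiples of that of \<open>g0\<close>,
      whose square has nonzero trace because its discriminant is nonzero.\<close>
    show "\<not> ell dvd trace (Theta h ** Theta g)" if g: "g \<in> ?K" "ell dvd trace g" for g
    proof -
      obtain a b c d where gh: "redm g = mat a + b *m g0" "redm h = mat c + d *m g0"
        using aff[of "redm g"] aff[OF h(2)] g by auto
      have trg: "trace (redm g) = 0" using g(2) by (simp add: redm_simps red_eq_0_iff)
      have "det (redm g) \<noteq> 0" using det_red_group[OF sub] SC g(1) by blast
      then have "det (trace_free (redm g)) \<noteq> 0" using four by (simp add: det_trace_free trg)
      then have b: "b \<noteq> 0" unfolding gh trace_free_affine by (auto simp: det_smat)
      have d: "d \<noteq> 0" using h_disc unfolding gh trace_free_affine by (auto simp: det_smat)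
      have "trace (trace_free (redm h) ** trace_free (redm g)) = d * b * (- 2 * det (trace_free g0))"
        unfolding gh trace_free_affine by (simp add: smat_simps trace_square_trace_free)
      also have "\<dots> \<noteq> 0" using b d two disc[OF g0(1)] by simp
      finally show ?thesis by (simp add: dvd_trace_Theta_mult_iff[OF odd])
    qed
  qed
  then show ?thesis
    unfolding has_good_subgroup_def
    using pre(2) pre(3)[of 24] g0(2) by (intro exI[of _ ?K]) (auto simp: S_def)
qed

text \<open>If some h moves the kernel of \<open>Theta u\<close> modulo ell, \<open>H\<close> itself
  works. Otherwise the image is triangular and every g has eigenvalues l, m along the flag of E. If
  some h has nonzero trace and distinct eigenvalues, \<open>H\<close> itself works again; if none
  has, all elements satisfy l = m or l = -m, and those with l = m form a subgroup of index at most
  2.\<close>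

lemma good_subgroup_unipotent:
  fixes H :: "'p::prime_card mat2 set"
  assumes H: "closed_subgroup H GL2" and odd: "odd CARD('p)" and p5: "CARD('p) \<ge> 5"
    and u: "u \<in> H" "det (trace_free (redm u)) = 0" "\<And>c. redm u \<noteq> mat c"
  shows "has_good_subgroup H"
proof (cases "\<exists>h\<in>H. \<not> ell dvd trace (Theta h ** Theta u)")
  case True
  then have "ball_SL2 (4 * s) \<subseteq> H" if "s > 0" for s
    using ball_subset_transvections[OF H p5 odd u(1) _ _ _ that] u(2) by (auto simp: dvd_det_Theta_iff[OF odd])
  moreover have sub: "subgroup H GL2" using H by (simp add: closed_subgroup_def)
  ultimately show ?thesis
    unfolding has_good_subgroup_def
    using closed_subgroup_cong(2)[OF H order_refl sub] index_le_self[OF sub, of 24] by (intro exI[of _ H]) simp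
next
  case False
  have sub: "subgroup H GL2" using H by (simp add: closed_subgroup_def)
  have two: "(2 :: 'p mod_ring) \<noteq> 0" by (rule two_mod_ring[OF odd])
  have four: "(4 :: 'p mod_ring) \<noteq> 0" by (rule four_mod_ring[OF odd])
  define E where "E = redm (Theta u)"
  have tfu: "trace_free (redm u) = 2 *m E" unfolding E_def by (rule trace_free_redm[OF odd])
  have slu: "Theta u \<in> carrier sl2" by (rule Theta_sl2_odd[OF odd])
  have trE: "trace E = 0" using slu unfolding E_def by (elim sl2_cases) simp
  have detE: "det E = 0"
    using u(2) four unfolding tfu by (simp add: det_smat)
  have E0: "E \<noteq> 0"
  proof
    assume "E = 0"
    then have "mat_cong 1 (Theta u) 0" using redm_eq_iff[of "Theta u" 0] by (simp add: E_def redm_simps)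
    then show False using Theta_cong_0_iff[OF odd] u(3) by blast
  qed
  have E_nonscalar: "E \<noteq> mat c" for c
  proof
    assume E: "E = mat c"
    then have "2 * c = 0" using trE by (simp add: mat_mk2)
    then have "c = 0" using two by (simp only: mult_eq_0_iff simp_thms)
    then show False using E E0 by (simp add: mk2_const)
  qed
  obtain e1 e2 e3 where EM: "E = mk2 e1 e2 e3 (- e1)"
    using trE by (cases E rule: mk2_cases) (simp add: eq_neg_iff_add_eq_0 add.commute)
  have "e1 * e1 + e2 * e3 = - det E" by (simp add: EM)
  then have "e1 * e1 + e2 * e3 = 0" by (simp add: detE)
  then have EE: "E ** E = 0" unfolding EM by (simp add: zero_mk2 algebra_simps)
  have eig: "\<exists>l m. redm g ** E = l *m E \<and> E ** redm g = m *m E \<and> l + m = trace (redm g) \<and> l * m = det (redm g)"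
    if "g \<in> H" for g
  proof (rule nilpotent_eigenvalues[OF two trE detE E0])
    have "trace (trace_free (redm g) ** trace_free (redm u)) = 0"
      using False that by (simp add: dvd_trace_Theta_mult_iff[OF odd])
    then have "2 * trace (trace_free (redm g) ** E) = 0" by (simp add: tfu smat_simps)
    then show "trace (trace_free (redm g) ** E) = 0" using two by (simp only: mult_eq_0_iff simp_thms)
  qed
  have adj_eig: "adj2 x ** E = (trace x - l) *m E" "E ** adj2 x = (trace x - m) *m E"
    if "x ** E = l *m E" "E ** x = m *m E" for x l m
  proof -
    have "(mat t - x) ** E = t *m E - x ** E" "E ** (mat t - x) = t *m E - E ** x" for t
      by (cases x rule: mk2_cases; cases E rule: mk2_cases; simp add: mat_mk2 algebra_simps)+
    then show "adj2 x ** E = (trace x - l) *m E" "E ** adj2 x = (trace x - m) *m E"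
      unfolding adj2_eq that by (cases E rule: mk2_cases; simp add: algebra_simps)+
  qed
  \<comment> \<open>For invertible matrices: the scalars times the unipotent group of direction
    E.\<close>
  define P where "P x \<longleftrightarrow> (\<exists>a b. x = mat a + b *m E)" for x
  have P_iff: "P x" if "x ** E = l *m E" "E ** x = l *m E" for x l
    unfolding P_def by (rule commutes_nonscalar[OF E_nonscalar]) (simp add: that)
  have P_disc: "det (trace_free x) = 0" if Px: "P x" for x
  proof -
    obtain a b where x: "x = mat a + b *m E" using Px unfolding P_def by blast
    have "det (trace_free E) = 0" by (simp add: det_trace_free trE detE)
    then show ?thesis unfolding x trace_free_affine by (simp add: det_smat)
  qed
  have disc_eig: "l = m" if "l + m = trace x" "l * m = det x" "det (trace_free x) = 0" for l m and x :: "'p mod_ring ^ 2 ^ 2"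
  proof -
    have "(l - m) * (l - m) = - det (trace_free x)"
      unfolding det_trace_free that(1,2)[symmetric] by (simp add: algebra_simps)
    then show ?thesis using that(3) by simp
  qed
  have disc_P: "P (redm g)" if g: "g \<in> H" "det (trace_free (redm g)) = 0" for g
    using eig[OF g(1)] disc_eig[OF _ _ g(2)] P_iff by metis
  have P_nil: "Theta g \<in> nil_dirs (Theta u)" if "P (redm g)" for g
  proof -
    obtain a b where ab: "redm g = mat a + b *m E" using \<open>P (redm g)\<close> unfolding P_def by blast
    have "trace_free E = 2 *m E" by (cases E rule: mk2_cases) (use trE in \<open>simp add: trace_free_def mat_mk2\<close>)
    then have "2 *m redm (Theta g) = 2 *m b *m E"
      using trace_free_redm[OF odd, of g] unfolding ab trace_free_affine by (simp add: smat_simps mult.commute)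
    then have "redm (Theta g) = b *m E"
      using two by (cases "redm (Theta g)" rule: mk2_cases; cases E rule: mk2_cases) simp
    then show ?thesis unfolding E_def by (rule nil_dirs_redmI[OF Theta_sl2_odd[OF odd]])
  qed
  have ThE: "Theta u \<in> carrier sl2" "mat_cong 1 (Theta u ** Theta u) 0" "CARD('p) \<ge> 5 \<or> mat_cong 1 (Theta u) 0"
    using slu p5 EE redm_eq_iff[of "Theta u ** Theta u" 0] by (simp_all add: redm_simps E_def)
  show ?thesis
  proof (cases "\<exists>h\<in>H. trace (redm h) \<noteq> 0 \<and> det (trace_free (redm h)) \<noteq> 0")
    case True
    then obtain h where h: "h \<in> H" "trace (redm h) \<noteq> 0" "det (trace_free (redm h)) \<noteq> 0" by blast
    have "ball_SL2 (4 * s) \<subseteq> H" if s: "s > 0" "scaled_sl2 s \<subseteq> special_Lie H" for s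
    proof (rule ball_subset_split[OF H odd ThE _ _ h(1) _ _ _ _ s])
      show "\<not> ell dvd trace h" using h(2) by (simp add: redm_simps red_eq_0_iff)
      show "\<not> ell dvd det (Theta h)" using h(3) by (simp add: dvd_det_Theta_iff[OF odd])
      show "Theta g \<in> nil_dirs (Theta u)" if "g \<in> H" "ell dvd det (Theta g)" for g
        using that by (intro P_nil disc_P) (simp_all add: dvd_det_Theta_iff[OF odd])
      show "g ** Theta u ** adj2 g \<in> nil_dirs (Theta u)" if g: "g \<in> H" for g
      proof -
        obtain l m where lm: "redm g ** E = l *m E" "E ** redm g = m *m E" using eig[OF g] by blast
        have "redm (g ** Theta u ** adj2 g) = redm g ** E ** adj2 (redm g)" by (simp add: redm_simps E_def)
        also have "\<dots> = (l * (trace (redm g) - m)) *m E"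
          unfolding lm(1) using adj_eig(2)[OF lm] by (simp add: smat_simps)
        finally show ?thesis unfolding E_def by (intro nil_dirs_redmI[OF sl2_conj(1)[OF slu]])
      qed
      \<comment> \<open>E is an eigenvector of the commutator from the left and from the right, with
        the same eigenvalue l m l' m', so the eigenvalues coincide.\<close>
      show "ell dvd det (Theta (A ** B ** adj2 A ** adj2 B))" if A: "A \<in> H" and B: "B \<in> H" for A B
      proof -
        obtain l m where a: "redm A ** E = l *m E" "E ** redm A = m *m E" "l + m = trace (redm A)" using eig[OF A] by blast
        obtain l' m' where b: "redm B ** E = l' *m E" "E ** redm B = m' *m E" "l' + m' = trace (redm B)" using eig[OF B] by blast
        have a': "adj2 (redm A) ** E = m *m E" "E ** adj2 (redm A) = l *m E"
          using adj_eig[OF a(1,2)] by (simp_all flip: a(3))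
        have b': "adj2 (redm B) ** E = m' *m E" "E ** adj2 (redm B) = l' *m E"
          using adj_eig[OF b(1,2)] by (simp_all flip: b(3))
        have "redm A ** redm B ** adj2 (redm A) ** adj2 (redm B) ** E = (m' * m * l' * l) *m E"
          by (simp add: b' a' a b smat_simps ac_simps flip: matrix_mul_assoc)
        moreover have "E ** (redm A ** redm B ** adj2 (redm A) ** adj2 (redm B)) = (m' * m * l' * l) *m E"
          by (simp add: matrix_mul_assoc b' a' a b smat_simps ac_simps)
        ultimately have "det (trace_free (redm A ** redm B ** adj2 (redm A) ** adj2 (redm B))) = 0"
          by (intro P_disc P_iff)
        then show ?thesis by (simp add: dvd_det_Theta_iff[OF odd] redm_simps)
      qed
      show "\<not> ell dvd trace (Theta h ** Theta g)" if g: "g \<in> H" "ell dvd trace g" for g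
      proof -
        obtain l m where a: "redm g ** E = l *m E" "E ** redm g = m *m E" "l + m = trace (redm g)" "l * m = det (redm g)"
          using eig[OF g(1)] by blast
        obtain l' m' where b: "redm h ** E = l' *m E" "E ** redm h = m' *m E" "l' + m' = trace (redm h)" "l' * m' = det (redm h)"
          using eig[OF h(1)] by blast
        have "l + m = 0" using a(3) g(2) by (simp add: redm_simps red_eq_0_iff)
        then have m: "m = - l" by (simp only: eq_neg_iff_add_eq_0 add.commute)
        have "det (redm g) \<noteq> 0" using det_red_group[OF sub] g(1) by (simp add: red_group_def)
        then have l0: "l \<noteq> 0" using a(4) by auto
        have lm': "l' \<noteq> m'"
        proof
          assume "l' = m'"
          then have "det (trace_free (redm h)) = 0" using P_disc[OF P_iff[OF b(1)]] b(2) by simp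
          then show False using h(3) by simp
        qed
        have tf: "trace_free x ** E = (k - j) *m E" if "x ** E = k *m E" "k + j = trace x" for x k j
        proof -
          have "trace_free x ** E = 2 *m (x ** E) - trace x *m E" unfolding trace_free_def
            by (cases x rule: mk2_cases; cases E rule: mk2_cases) (simp add: mat_mk2 algebra_simps)
          then show ?thesis unfolding that(1) that(2)[symmetric]
            by (cases E rule: mk2_cases) (simp add: algebra_simps)
        qed
        \<comment> \<open>Applied to E, an eigenvector of both factors, this evaluates the trace as
          2 (l' - m') (l - m).\<close>
        have anti: "trace_free x ** trace_free y + trace_free y ** trace_free x = mat (trace (trace_free x ** trace_free y))"
          for x y :: "'p mod_ring ^ 2 ^ 2"
          by (cases x rule: mk2_cases; cases y rule: mk2_cases) (simp add: trace_free_def mat_mk2 algebra_simps)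
        have "trace (trace_free (redm h) ** trace_free (redm g)) *m E
            = (trace_free (redm h) ** trace_free (redm g) + trace_free (redm g) ** trace_free (redm h)) ** E"
          unfolding anti by (cases E rule: mk2_cases) (simp add: mat_mk2)
        also have "\<dots> = trace_free (redm h) ** (trace_free (redm g) ** E) + trace_free (redm g) ** (trace_free (redm h) ** E)"
          by (simp add: mat_mult_add_left matrix_mul_assoc)
        also have "\<dots> = (2 * ((l' - m') * (l - m))) *m E"
          unfolding tf[OF a(1,3)] tf[OF b(1,3)] smat_simps
          by (cases E rule: mk2_cases) (simp add: algebra_simps)
        finally have "trace (trace_free (redm h) ** trace_free (redm g)) = 2 * ((l' - m') * (l - m))"
          using E0 by (rule smat_eq_cancel)
        also have "l - m = 2 * l" by (simp add: m)
        also have "2 * ((l' - m') * (2 * l)) \<noteq> 0"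
          using two l0 lm' by (simp only: mult_eq_0_iff right_minus_eq simp_thms)
        finally show ?thesis by (simp add: dvd_trace_Theta_mult_iff[OF odd])
      qed
    qed
    then show ?thesis
      unfolding has_good_subgroup_def
      using closed_subgroup_cong(2)[OF H order_refl sub] index_le_self[OF sub, of 24] by (intro exI[of _ H]) simp
  next
    case noh: False
    define S where "S = {x \<in> carrier (red_group H). P x}"
    have Pmult: "P (x ** y)" if Pxy: "P x" "P y" for x y
    proof -
      obtain a b c d where xy: "x = mat a + b *m E" "y = mat c + d *m E" using Pxy unfolding P_def by blast
      have "(mat a + b *m E) ** (mat c + d *m E) = mat (a * c) + (a * d + b * c) *m E + (b * d) *m (E ** E)"
        by (cases E rule: mk2_cases) (simp add: mat_mk2 algebra_simps)
      also have "\<dots> = mat (a * c) + (a * d + b * c) *m E" unfolding EE by (simp add: zero_mk2 mat2_eq_iff smat_def)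
      finally show ?thesis unfolding P_def xy by blast
    qed
    have Padj: "P (c *m adj2 x)" if Px: "P x" for x c
    proof -
      obtain a b where x: "x = mat a + b *m E" using Px unfolding P_def by blast
      have "c *m adj2 (mat a + b *m E) = mat (c * a) + (- (c * b)) *m E"
        unfolding EM by (simp add: mat_mk2 algebra_simps)
      then show ?thesis unfolding P_def x by blast
    qed
    have Psmat: "P (c *m x)" if Px: "P x" for x c
    proof -
      obtain a b where x: "x = mat a + b *m E" using Px unfolding P_def by blast
      have "c *m (mat a + b *m E) = mat (c * a) + (c * b) *m E" by (simp add: smat_add smat_mat smat_simps)
      then show ?thesis unfolding P_def x by blast
    qed
    have "mat 1 = mat 1 + 0 *m E" by (cases E rule: mk2_cases) (simp add: mat_mk2)
    then have P1: "P (mat 1)" unfolding P_def by blast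
    have S: "subgroup S (red_group H)"
      unfolding S_def by (rule red_group_subgroupI[of H P, OF sub P1 Pmult Padj])
    note pre = preimage_red_group[OF H S]
    let ?K = "{h \<in> H. redm h \<in> S}"
    have K_iff: "g \<in> ?K \<longleftrightarrow> P (redm g)" if "g \<in> H" for g using that by (simp add: S_def red_group_def)
    have "ball_SL2 (4 * s) \<subseteq> ?K" if s: "s > 0" "scaled_sl2 s \<subseteq> special_Lie ?K" for s
      by (rule ball_subset_nilpotent[OF pre(1) odd ThE P_nil s]) (simp add: S_def)
    \<comment> \<open>Two elements outside the subgroup both have opposite eigenvalues, so their
      quotient has equal ones: there are at most two cosets.\<close>
    moreover have "index_le GL2 H ?K 24"
    proof (rule index_leI[where f = "\<lambda>g. P (redm g)", OF sub])
      show "subgroup ?K GL2" using pre(1) by (simp add: closed_subgroup_def)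
      have "card ((\<lambda>g. P (redm g)) ` H) \<le> card (UNIV :: bool set)" by (rule card_mono) simp_all
      then show "card ((\<lambda>g. P (redm g)) ` H) \<le> 24" by simp
      fix A B v assume *: "A \<in> H" "B \<in> H" "P (redm A) = P (redm B)" "v * det B = 1"
      have inH: "A ** (v *m adj2 B) \<in> H" by (intro GL2_subgroup_mult[OF sub] GL2_subgroup_inv[OF sub] *)
      have "P (redm A ** adj2 (redm B))"
      proof (cases "P (redm A)")
        case True
        then show ?thesis using Pmult[of "redm A" "1 *m adj2 (redm B)"] Padj[of "redm B" 1] *(3) by (simp add: smat_simps)
      next
        case False
        have tr0: "trace (redm g) = 0" if "g \<in> H" "\<not> P (redm g)" for g using noh disc_P that by blast
        obtain l m where a: "redm A ** E = l *m E" "E ** redm A = m *m E" "l + m = trace (redm A)" using eig[OF *(1)] by blast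
        obtain l' m' where b: "redm B ** E = l' *m E" "E ** redm B = m' *m E" "l' + m' = trace (redm B)" using eig[OF *(2)] by blast
        have "l + m = 0" "l' + m' = 0" using a(3) b(3) tr0 *(1-3) False by simp_all
        then have m: "m = - l" "m' = - l'" by (simp_all only: eq_neg_iff_add_eq_0 add.commute)
        have b': "adj2 (redm B) ** E = m' *m E" "E ** adj2 (redm B) = l' *m E"
          using adj_eig[OF b(1,2)] by (simp_all flip: b(3))
        have "redm A ** adj2 (redm B) ** E = (m' * l) *m E"
          by (simp add: b' a smat_simps flip: matrix_mul_assoc)
        moreover have "E ** (redm A ** adj2 (redm B)) = (m * l') *m E"
          by (simp add: matrix_mul_assoc b' a smat_simps)
        moreover have "m * l' = m' * l" by (simp add: m)
        ultimately show ?thesis by (intro P_iff) simp_all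
      qed
      then have "P (redm (A ** (v *m adj2 B)))" using Psmat by (simp add: redm_simps smat_simps)
      then show "A ** (v *m adj2 B) \<in> ?K" using K_iff[OF inH] by simp
    qed simp
    ultimately show ?thesis unfolding has_good_subgroup_def using pre(2) by blast
  qed
qed

text \<open>For ell = 3 nonscalar unipotents need not be tame, so only elements that are scalar
  modulo 3 are kept; the order 24 of PGL_2(F_3) permits this.\<close>

lemma good_subgroup_odd:
  fixes H :: "'p::prime_card mat2 set"
  assumes H: "closed_subgroup H GL2" and odd: "odd CARD('p)"
  shows "has_good_subgroup H"
proof (cases "CARD('p) = 3")
  case True
  have "subgroup H GL2" using H by (simp add: closed_subgroup_def)
  from good_subgroup_scalars[OF H odd card_red_group_three[OF this True]] show ?thesis .
next
  case False
  have "CARD('p) \<ge> 2" by (rule prime_ge_2_nat[OF prime_card])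
  moreover have "CARD('p) \<noteq> 2" "CARD('p) \<noteq> 4" using odd by auto
  ultimately have p5: "CARD('p) \<ge> 5" using False by linarith
  show ?thesis
  proof (cases "\<exists>u\<in>H. det (trace_free (redm u)) = 0 \<and> (\<forall>c. redm u \<noteq> mat c)")
    case True
    then show ?thesis using good_subgroup_unipotent[OF H odd p5] by blast
  next
    case False
    then show ?thesis by (intro good_subgroup_semisimple[OF H odd]) blast
  qed
qed

text \<open>The bound 192 = 12 * 16 counts matrices modulo 4 whose first column is not even (12 of
  16, as the determinant is odd) and whose second column is arbitrary.\<close>

lemma good_subgroup_two:
  fixes H :: "'p::prime_card mat2 set"
  assumes H: "closed_subgroup H GL2" and p: "CARD('p) = 2"
  defines "K \<equiv> {g \<in> H. mat_cong 2 g (mat 1)}"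
  shows "closed_subgroup K GL2" "closed_subgroup K (GL2\<lparr>carrier := H\<rparr>)" "index_le GL2 H K 192"
proof -
  have sub: "subgroup H GL2" using H by (simp add: closed_subgroup_def)
  have K: "subgroup K GL2"
  proof (rule GL2_subgroupI)
    show "A ** B \<in> K" if "A \<in> K" "B \<in> K" for A B
      using that GL2_subgroup_mult[OF sub] mat_cong_mult[of 2 A "mat 1" B "mat 1"] by (simp add: K_def)
    show "v *m adj2 A \<in> K" if A: "A \<in> K" and v: "v * det A = 1" for A v
    proof -
      have "mat_cong 2 (mat 1) A" by (rule mat_cong_sym) (use A in \<open>simp add: K_def\<close>)
      then have "mat_cong 2 ((v *m adj2 A) ** mat 1) ((v *m adj2 A) ** A)"
        by (rule mat_cong_mult[OF mat_cong_refl])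
      then show ?thesis using A GL2_subgroup_inv[OF sub _ v] by (simp add: K_def adj2_inverse[OF v])
    qed
  qed (use GL2_subgroup_one[OF sub] GL2_subgroup_det[OF sub] in \<open>auto simp: K_def\<close>)
  have KH: "K \<subseteq> H" by (auto simp: K_def)
  have cong: "B \<in> K" if "A \<in> K" "B \<in> H" "mat_cong 2 A B" for A B
  proof -
    have "mat_cong 2 B (mat 1)"
      by (rule mat_cong_trans[OF mat_cong_sym[OF that(3)]]) (use that(1) in \<open>simp add: K_def\<close>)
    then show ?thesis using that(2) by (simp add: K_def)
  qed
  show "closed_subgroup K GL2" "closed_subgroup K (GL2\<lparr>carrier := H\<rparr>)"
    by (rule closed_subgroup_cong[OF H KH K cong], assumption+)+
  define f where "f A = ((residue (A $ 1 $ 1) 2, residue (A $ 2 $ 1) 2), (residue (A $ 1 $ 2) 2, residue (A $ 2 $ 2) 2))"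
    for A :: "'p mat2"
  define I where "I = {0..<4 :: int}"
  define T where "T = (I \<times> I - {0, 2} \<times> {0, 2}) \<times> (I \<times> I)"
  have cI: "card (I \<times> I) = 16" by (simp add: I_def card_cartesian_product)
  have finT: "finite T" by (simp add: T_def I_def)
  have "card (I \<times> I - {0, 2} \<times> {0, 2}) = 12"
    using card_Diff_subset[of "{0, 2} \<times> {0, 2}" "I \<times> I"] cI by (auto simp: I_def card_cartesian_product)
  then have cT: "card T = 192" by (simp add: T_def card_cartesian_product) (simp add: I_def)
  have fT: "f ` H \<subseteq> T"
  proof (rule image_subsetI)
    fix A assume A: "A \<in> H"
    have res: "residue x 2 \<in> I" for x :: "'p adic_int"
      using residue_bounds[of x 2] p by (simp add: I_def)
    have even: "ell dvd x" if "residue x 2 = 0 \<or> residue x 2 = 2" for x :: "'p adic_int"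
    proof -
      have "residue x 1 = residue x 2 mod 2" using residue_add_mod[of x 1 1] unfolding one_add_one p by simp
      then have "residue x 1 = 0" using that by auto
      then show ?thesis using of_nat_dvd_iff_residue[of 1 x] by simp
    qed
    have "\<not> (ell dvd A $ 1 $ 1 \<and> ell dvd A $ 2 $ 1)"
    proof
      assume "ell dvd A $ 1 $ 1 \<and> ell dvd A $ 2 $ 1"
      then have "ell dvd det A" unfolding det_2 by (intro dvd_diff dvd_mult dvd_mult2) auto
      then show False using GL2_subgroup_det[OF sub A] by (simp add: adic_unit_iff)
    qed
    then have "(residue (A $ 1 $ 1) 2, residue (A $ 2 $ 1) 2) \<notin> {0, 2} \<times> {0, 2}"
      using even[of "A $ 1 $ 1"] even[of "A $ 2 $ 1"] by blast
    then show "f A \<in> T" unfolding f_def T_def using res by (intro SigmaI DiffI)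
  qed
  show "index_le GL2 H K 192"
  proof (rule index_leI[OF sub K])
    show "finite (f ` H)" "card (f ` H) \<le> 192"
      using finite_subset[OF fT finT] card_mono[OF finT fT] cT by simp_all
    fix A B v assume *: "A \<in> H" "B \<in> H" "f A = f B" "v * det B = 1"
    have eq: "ell ^ 2 dvd x - y" if "residue x 2 = residue y 2" for x y :: "'p adic_int"
      by (simp add: of_nat_dvd_iff_residue minus_adic_int.rep_eq that)
    have AB: "mat_cong 2 A B"
      using *(3) by (simp add: f_def mat_cong_def forall_2 eq)
    have "mat_cong 2 (A ** (v *m adj2 B)) (mat 1)"
      using mat_cong_mult[OF AB mat_cong_refl, of "v *m adj2 B"] by (simp add: adj2_inverse[OF *(4)])
    moreover have "A ** (v *m adj2 B) \<in> H" by (intro GL2_subgroup_mult[OF sub] GL2_subgroup_inv[OF sub] *)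
    ultimately show "A ** (v *m adj2 B) \<in> K" by (simp add: K_def)
  qed
qed

theorem theorem1p5:
  shows "(odd CARD('p::prime_card) \<longrightarrow>
      (\<forall>H :: 'p mat2 set. closed_subgroup H GL2 \<longrightarrow>
        (\<exists>H1. closed_subgroup H1 (GL2\<lparr>carrier := H\<rparr>) \<and> index_le GL2 H H1 24 \<and>
          (\<forall>s>0. scaled_sl2 s \<subseteq> special_Lie H1 \<longrightarrow> ball_SL2 (4 * s) \<subseteq> H1)))) \<and>
    (CARD('p) = 2 \<longrightarrow>
      (\<forall>H :: 'p mat2 set. closed_subgroup H GL2 \<longrightarrow>
        (\<exists>H1. closed_subgroup H1 (GL2\<lparr>carrier := H\<rparr>) \<and> (\<forall>g\<in>H1. mat_cong 1 g (mat 1)) \<and>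
          index_le GL2 H H1 192 \<and>
          (\<forall>s>0. scaled_sl2 s \<subseteq> special_Lie H1 \<longrightarrow> ball_SL2 (6 * s) \<subseteq> H1))))"
proof (intro conjI impI allI)
  fix H :: "'p mat2 set"
  assume "odd CARD('p)" "closed_subgroup H GL2"
  then show "\<exists>H1. closed_subgroup H1 (GL2\<lparr>carrier := H\<rparr>) \<and> index_le GL2 H H1 24 \<and>
      (\<forall>s>0. scaled_sl2 s \<subseteq> special_Lie H1 \<longrightarrow> ball_SL2 (4 * s) \<subseteq> H1)"
    using good_subgroup_odd unfolding has_good_subgroup_def by blast
next
  fix H :: "'p mat2 set"
  assume p: "CARD('p) = 2" and H: "closed_subgroup H GL2"
  let ?K = "{g \<in> H. mat_cong 2 g (mat 1)}"
  note K = good_subgroup_two[OF H p]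
  have "ball_SL2 (6 * s) \<subseteq> ?K" if "s > 0" "scaled_sl2 s \<subseteq> special_Lie ?K" for s
    by (rule ball_subset_two[OF K(1) p _ that]) simp
  moreover have "\<forall>g\<in>?K. mat_cong 1 g (mat 1)" by (auto intro: mat_cong_mono)
  ultimately show "\<exists>H1. closed_subgroup H1 (GL2\<lparr>carrier := H\<rparr>) \<and> (\<forall>g\<in>H1. mat_cong 1 g (mat 1)) \<and>
      index_le GL2 H H1 192 \<and>
      (\<forall>s>0. scaled_sl2 s \<subseteq> special_Lie H1 \<longrightarrow> ball_SL2 (6 * s) \<subseteq> H1)"
    using K(2,3) by blast
qed

end
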